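(* Let $R'\subset\mathbb{R}^{8}$ be the set of all $(a_1,\dots,a_8)$ satisfying $$0\le a_1\le\pi,\quad 0\le a_2\le\tfrac{\pi}{2},\quad 0\le a_3\le\tfrac{\pi}{2},\quad 0\le a_4\le 2\pi,\quad 0\le a_5\le\tfrac{\pi}{4},\quad 0\le a_6\le\pi,\quad 0\le a_7\le\tfrac{\pi}{6},\quad 3a_7\le a_8\le\tfrac{\pi}{2}.$$ Consider the map $R'\to\mathcal{H}=G_2/SO(4)$, $$(a_1,\dots,a_8)\mapsto \sigma(a_1,a_2,a_3)\,s(a_4,a_5,a_6)\,e^{\sqrt3\,a_7C_{11}}\,e^{a_8C_5}\cdot SO(4).$$ This map gives a coordinatization of the eight-dimensional variety $\mathcal{H}$ of quaternionic subalgebras of $\mathbb{O}$: it covers $\mathcal{H}$ exactly once up to sets of measure zero, i.e. there is a Lebesgue-null set $N'\subset R'$ such that the map is injective on $R'\setminus N'$ and the image of $R'\setminus N'$ has full measure in $\mathcal{H}$.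
   Context: The octonions $\mathbb{O}$ are pairs of quaternions with product $(\alpha_1,\alpha_2)(\beta_1,\beta_2)=(\alpha_1\beta_1-\bar\beta_2\alpha_2,\ \beta_2\alpha_1+\alpha_2\bar\beta_1)$. The canonical basis is $e_0=(1,0)$, $e_1=(i,0)$, $e_2=(j,0)$, $e_3=(k,0)$, $e_4=(0,1)$, $e_5=(0,i)$, $e_6=(0,j)$, $e_7=(0,k)$. $G_2$ is the group of algebra automorphisms of $\mathbb{O}$; it fixes $e_0$ and is identified with a group of $7\times7$ real matrices acting on column vectors of coordinates with respect to $e_1,\dots,e_7$. Let $\mathbb{H}=\mathrm{span}\{e_0,e_1,e_2,e_3\}$; every octonion is uniquely $x+ye_4$ with $x,y\in\mathbb{H}$. Identifying $SU(2)$ with the unit quaternions, let $\gamma:SU(2)\times SU(2)\to G_2$ be the homomorphism $\gamma_{ab}(x+ye_4)=ax\bar a+(by\bar a)e_4$. Its image is isomorphic to $SO(4)$ and is denoted simply $SO(4)\subset G_2$; it is the stabilizer of the quaternionic subalgebra $\mathbb{H}$ under the transitive action of $G_2$ on quaternionic subalgebras of $\mathbb{O}$, so $\mathcal{H}=G_2/SO(4)$ is identified with the set of quaternionic subalgebras. "Measure" on $\mathcal{H}$ is the $G_2$-invariant measure. Let $E_{ij}$ be the $7\times 7$ matrix units and $A_{ij}=E_{ij}-E_{ji}$. The following are elements of $\mathrm{Lie}(G_2)$: $$C_2=A_{46}-A_{57},\qquad C_3=-A_{45}-A_{67},\qquad C_5=-A_{26}+A_{37},$$ $$C_8=\tfrac1{\sqrt3}(-2A_{23}+A_{45}-A_{67}),\qquad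 C_9=\tfrac1{\sqrt3}(-2A_{12}+A_{47}-A_{56}),\qquad C_{11}=\tfrac1{\sqrt3}(-2A_{14}-A_{27}+A_{36}).$$ Define $$s(x,y,z)=e^{xC_3}e^{yC_2}e^{zC_3},\qquad \sigma(x,y,z)=e^{\sqrt3\,xC_8}e^{\sqrt3\,yC_9}e^{\sqrt3\,zC_8}.$$ *)

theory Defs
  imports "HOL-Analysis.Analysis" "HOL-Algebra.Left_Coset"
begin

section \<open>Quaternions and octonions\<close>

text \<open>The quaternion \<open>r + u\<^sub>1 i + u\<^sub>2 j + u\<^sub>3 k\<close> is the pair \<open>(r, u)\<close>. The vector space structure
  and the norm are those of the product type, and the product is given by the usual formula in terms
  of the inner product and the cross product.\<close>

type_synonym quat = "real \<times> (real^3)"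

fun quat_mult :: "quat \<Rightarrow> quat \<Rightarrow> quat" (infixl \<open>\<cdot>\<^sub>H\<close> 70) where
  "(r, u) \<cdot>\<^sub>H (s, v) = (r * s - inner u v, r *\<^sub>R v + s *\<^sub>R u + cross3 u v)"

fun quat_cnj :: "quat \<Rightarrow> quat" where
  "quat_cnj (r, u) = (r, - u)"

definition quat_1 :: quat where "quat_1 = (1, 0)"
definition quat_i :: quat where "quat_i = (0, axis 1 1)"
definition quat_j :: quat where "quat_j = (0, axis 2 1)"
definition quat_k :: quat where "quat_k = (0, axis 3 1)"

type_synonym oct = "quat \<times> quat"

fun oct_mult :: "oct \<Rightarrow> oct \<Rightarrow> oct" (infixl \<open>\<cdot>\<^sub>O\<close> 70) where
  "(\<alpha>1, \<alpha>2) \<cdot>\<^sub>O (\<beta>1, \<beta>2) =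
     (\<alpha>1 \<cdot>\<^sub>H \<beta>1 - quat_cnj \<beta>2 \<cdot>\<^sub>H \<alpha>2, \<beta>2 \<cdot>\<^sub>H \<alpha>1 + \<alpha>2 \<cdot>\<^sub>H quat_cnj \<beta>1)"

definition oct_basis :: "nat \<Rightarrow> oct" where
  "oct_basis n =
     [(quat_1, 0), (quat_i, 0), (quat_j, 0), (quat_k, 0),
      (0, quat_1), (0, quat_i), (0, quat_j), (0, quat_k)] ! n"

text \<open>Coordinates with respect to \<open>e\<^sub>1, \<dots>, e\<^sub>7\<close>. In the index type \<open>7\<close> the numerals \<open>1, \<dots>, 7\<close> are
  pairwise distinct (and \<open>7 = 0\<close>).\<close>

definition im_oct :: "real^7 \<Rightarrow> oct" where
  "im_oct v = (\<Sum>n = 1..7. (v $ of_nat n) *\<^sub>R oct_basis n)"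

definition represents :: "real^7^7 \<Rightarrow> (oct \<Rightarrow> oct) \<Rightarrow> bool" where
  "represents M \<phi> \<longleftrightarrow> (\<forall>v. \<phi> (im_oct v) = im_oct (M *v v))"


section \<open>The groups \<open>G\<^sub>2\<close> and \<open>SO(4)\<close>\<close>

definition oct_automorphism :: "(oct \<Rightarrow> oct) \<Rightarrow> bool" where
  "oct_automorphism \<phi> \<longleftrightarrow> linear \<phi> \<and> bij \<phi> \<and> (\<forall>x y. \<phi> (x \<cdot>\<^sub>O y) = \<phi> x \<cdot>\<^sub>O \<phi> y)"

definition G2 :: "(real^7^7) monoid" where
  "G2 = \<lparr>carrier = {M. \<exists>\<phi>. oct_automorphism \<phi> \<and> represents M \<phi>},
         monoid.mult = (\<lambda>M N. M ** N), one = mat 1\<rparr>"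

text \<open>The pair \<open>(x, y)\<close> is the octonion \<open>x + y e\<^sub>4\<close>.\<close>

lemma oct_decomposition: "(x, 0) + (y, 0) \<cdot>\<^sub>O oct_basis 4 = ((x, y) :: oct)"
  by (cases x; cases y) (simp add: oct_basis_def quat_1_def zero_prod_def)

fun oct_gamma :: "quat \<Rightarrow> quat \<Rightarrow> oct \<Rightarrow> oct" where
  "oct_gamma a b (x, y) = (a \<cdot>\<^sub>H x \<cdot>\<^sub>H quat_cnj a, b \<cdot>\<^sub>H y \<cdot>\<^sub>H quat_cnj a)"

definition SO4 :: "(real^7^7) set" where
  "SO4 = {M. \<exists>a b. norm a = 1 \<and> norm b = 1 \<and> represents M (oct_gamma a b)}"


section \<open>The homogeneous space \<open>G\<^sub>2/SO(4)\<close> and its invariant measure\<close>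

definition quat_variety :: "(real^7^7) set set" where
  "quat_variety = lcosets\<^bsub>G2\<^esub> SO4"

definition quat_variety_open :: "(real^7^7) set set \<Rightarrow> bool" where
  \<comment> \<open>quotient topology of the topology on \<open>G\<^sub>2\<close> as a subspace of the matrices\<close>
  "quat_variety_open U \<longleftrightarrow> U \<subseteq> quat_variety \<and>
     openin (top_of_set (carrier G2)) {g \<in> carrier G2. g <#\<^bsub>G2\<^esub> SO4 \<in> U}"

text \<open>The invariant measure is determined only up to a positive factor, which does not affect the
  null sets. Finiteness rules out, for example, counting measure.\<close>

definition G2_invariant_measure :: "(real^7^7) set measure \<Rightarrow> bool" where
  "G2_invariant_measure \<mu> \<longleftrightarrow>
     sets \<mu> = sets (sigma quat_variety {U. quat_variety_open U}) \<and>
     finite_measure \<mu> \<and> emeasure \<mu> (space \<mu>) \<noteq> 0 \<and>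
     (\<forall>g \<in> carrier G2. \<forall>A \<in> sets \<mu>. emeasure \<mu> ((\<lambda>c. g <#\<^bsub>G2\<^esub> c) ` A) = emeasure \<mu> A)"


section \<open>The coordinate map\<close>

definition mat_exp :: "real^'n^'n \<Rightarrow> real^'n^'n" where
  "mat_exp A = (\<Sum>k. (1 / fact k) *\<^sub>R (((\<lambda>B. A ** B) ^^ k) (mat 1)))"

definition E_mat :: "7 \<Rightarrow> 7 \<Rightarrow> real^7^7" where
  "E_mat i j = (\<chi> p q. if p = i \<and> q = j then 1 else 0)"

definition A_mat :: "7 \<Rightarrow> 7 \<Rightarrow> real^7^7" where
  "A_mat i j = E_mat i j - E_mat j i"

definition C2 :: "real^7^7" where "C2 = A_mat 4 6 - A_mat 5 7"
definition C3 :: "real^7^7" where "C3 = - A_mat 4 5 - A_mat 6 7"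
definition C5 :: "real^7^7" where "C5 = - A_mat 2 6 + A_mat 3 7"
definition C8 :: "real^7^7" where
  "C8 = (1 / sqrt 3) *\<^sub>R (- 2 *\<^sub>R A_mat 2 3 + A_mat 4 5 - A_mat 6 7)"
definition C9 :: "real^7^7" where
  "C9 = (1 / sqrt 3) *\<^sub>R (- 2 *\<^sub>R A_mat 1 2 + A_mat 4 7 - A_mat 5 6)"
definition C11 :: "real^7^7" where
  "C11 = (1 / sqrt 3) *\<^sub>R (- 2 *\<^sub>R A_mat 1 4 - A_mat 2 7 + A_mat 3 6)"

definition euler_s :: "real \<Rightarrow> real \<Rightarrow> real \<Rightarrow> real^7^7" where
  "euler_s x y z = mat_exp (x *\<^sub>R C3) ** mat_exp (y *\<^sub>R C2) ** mat_exp (z *\<^sub>R C3)"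

definition euler_\<sigma> :: "real \<Rightarrow> real \<Rightarrow> real \<Rightarrow> real^7^7" where
  "euler_\<sigma> x y z =
     mat_exp ((sqrt 3 * x) *\<^sub>R C8) ** mat_exp ((sqrt 3 * y) *\<^sub>R C9) ** mat_exp ((sqrt 3 * z) *\<^sub>R C8)"

definition R' :: "(real^8) set" where
  "R' = {a. 0 \<le> a $ 1 \<and> a $ 1 \<le> pi \<and> 0 \<le> a $ 2 \<and> a $ 2 \<le> pi / 2 \<and>
            0 \<le> a $ 3 \<and> a $ 3 \<le> pi / 2 \<and> 0 \<le> a $ 4 \<and> a $ 4 \<le> 2 * pi \<and>
            0 \<le> a $ 5 \<and> a $ 5 \<le> pi / 4 \<and> 0 \<le> a $ 6 \<and> a $ 6 \<le> pi \<and>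
            0 \<le> a $ 7 \<and> a $ 7 \<le> pi / 6 \<and> 3 * a $ 7 \<le> a $ 8 \<and> a $ 8 \<le> pi / 2}"

definition coord_map :: "real^8 \<Rightarrow> (real^7^7) set" where
  "coord_map a =
     (euler_\<sigma> (a $ 1) (a $ 2) (a $ 3) ** euler_s (a $ 4) (a $ 5) (a $ 6) **
      mat_exp ((sqrt 3 * a $ 7) *\<^sub>R C11) ** mat_exp ((a $ 8) *\<^sub>R C5)) <#\<^bsub>G2\<^esub> SO4"

end

theory Submission
  imports Defs
begin

text \<open>
  A coset \<open>g SO(4)\<close> corresponds to the quaternionic subalgebra \<open>g H\<close>. In terms of imaginary octonions,
  let \<open>U\<close> and \<open>V\<close> be the imaginary parts of \<open>H\<close> and \<open>g H\<close>. A singular value decomposition of the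
  pairing between \<open>U\<close> and \<open>V\<close> gives orthonormal bases \<open>p\<^sub>1, p\<^sub>2, p\<^sub>3 = p\<^sub>1 p\<^sub>2\<close> of \<open>U\<close> and
  \<open>q\<^sub>1, q\<^sub>2, q\<^sub>3 = q\<^sub>1 q\<^sub>2\<close> of \<open>V\<close> together with a unit vector \<open>u\<close> orthogonal to \<open>H\<close> such that
  \<open>q\<^sub>i = p\<^sub>i (cos t\<^sub>i + u sin t\<^sub>i)\<close> with \<open>t\<^sub>1 + t\<^sub>2 + t\<^sub>3 = 0\<close>. The ordering of the singular values puts
  the angles \<open>(a\<^sub>8 + a\<^sub>7, a\<^sub>7 - a\<^sub>8, - 2 a\<^sub>7)\<close> into the triangle \<open>3 a\<^sub>7 \<le> a\<^sub>8 \<le> pi/2\<close>; the frame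
  \<open>(p\<^sub>i, u)\<close> is described by Euler angles. In the interior of the domain the singular values are
  distinct, so the coset determines these data up to changing two of the signs of the \<open>p\<^sub>i\<close>; the ranges
  of \<open>a\<^sub>3\<close> and \<open>a\<^sub>5\<close> select one of the four choices of signs.

  The image of the boundary is null by Fubini's theorem: Gram-Schmidt orthonormalisation assigns to
  almost every triple \<open>v\<close> of imaginary octonions an element of \<open>G\<^sub>2\<close>, and for a fixed coset \<open>c\<close> the
  triples that move \<open>c\<close> into the image of the boundary lie in a smooth image of a null set of the same
  dimension 21. Integrating over \<open>v\<close> and \<open>c\<close> and using invariance gives measure zero.
\<close>

section \<open>Imaginary octonions as a cross product algebra on seven-space\<close>

lemma exhaust_7:
  fixes x :: 7
  shows "x = 1 \<or> x = 2 \<or> x = 3 \<or> x = 4 \<or> x = 5 \<or> x = 6 \<or> x = 7"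
proof (induct x)
  case (of_int z)
  then have "z = 0 \<or> z = 1 \<or> z = 2 \<or> z = 3 \<or> z = 4 \<or> z = 5 \<or> z = 6" by fastforce
  then show ?case by auto
qed

lemma forall_7: "(\<forall>i::7. P i) \<longleftrightarrow> P 1 \<and> P 2 \<and> P 3 \<and> P 4 \<and> P 5 \<and> P 6 \<and> P 7"
  by (metis exhaust_7)

lemma UNIV_7: "UNIV = {1, 2, 3, 4, 5, 6, 7::7}"
  using exhaust_7 by auto

lemma sum_7: "sum f (UNIV::7 set) = f 1 + f 2 + f 3 + f 4 + f 5 + f 6 + f 7"
  unfolding UNIV_7 by (simp add: ac_simps)

definition vec7 :: "real \<Rightarrow> real \<Rightarrow> real \<Rightarrow> real \<Rightarrow> real \<Rightarrow> real \<Rightarrow> real \<Rightarrow> real^7" where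
  "vec7 x1 x2 x3 x4 x5 x6 x7 = (\<chi> i. if i = 1 then x1 else if i = 2 then x2 else if i = 3 then x3
     else if i = 4 then x4 else if i = 5 then x5 else if i = 6 then x6 else x7)"

lemma vec7_nth [simp]:
  "vec7 x1 x2 x3 x4 x5 x6 x7 $ 1 = x1" "vec7 x1 x2 x3 x4 x5 x6 x7 $ 2 = x2"
  "vec7 x1 x2 x3 x4 x5 x6 x7 $ 3 = x3" "vec7 x1 x2 x3 x4 x5 x6 x7 $ 4 = x4"
  "vec7 x1 x2 x3 x4 x5 x6 x7 $ 5 = x5" "vec7 x1 x2 x3 x4 x5 x6 x7 $ 6 = x6"
  "vec7 x1 x2 x3 x4 x5 x6 x7 $ 7 = x7"
  by (simp_all add: vec7_def)

lemma vec7_eq_iff: "v = w \<longleftrightarrow> v $ 1 = w $ 1 \<and> v $ 2 = w $ 2 \<and> v $ 3 = w $ 3 \<and> v $ 4 = w $ 4 \<and>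
    v $ 5 = w $ 5 \<and> v $ 6 = w $ 6 \<and> v $ 7 = w $ (7::7)"
  by (simp add: vec_eq_iff forall_7)

lemma inner_7: "(v::real^7) \<bullet> w = v $ 1 * w $ 1 + v $ 2 * w $ 2 + v $ 3 * w $ 3 + v $ 4 * w $ 4 +
    v $ 5 * w $ 5 + v $ 6 * w $ 6 + v $ 7 * w $ 7"
  by (simp add: inner_vec_def sum_7)

text \<open>The imaginary part of the product of two imaginary octonions, as
  \<open>octo_mult\<close> confirms. With coordinates spelled out, identities for \<open>cr\<close>
  reduce to polynomial algebra.\<close>

definition cr :: "real^7 \<Rightarrow> real^7 \<Rightarrow> real^7" where
  "cr x y = vec7
    (x$2 * y$3 - x$3 * y$2 - x$5 * y$4 + x$4 * y$5 + x$7 * y$6 - x$6 * y$7)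
    (x$3 * y$1 - x$1 * y$3 - x$6 * y$4 + x$4 * y$6 + x$5 * y$7 - x$7 * y$5)
    (x$1 * y$2 - x$2 * y$1 - x$7 * y$4 + x$4 * y$7 + x$6 * y$5 - x$5 * y$6)
    (x$5 * y$1 + x$6 * y$2 + x$7 * y$3 - x$1 * y$5 - x$2 * y$6 - x$3 * y$7)
    (x$1 * y$4 - x$4 * y$1 + x$3 * y$6 - x$2 * y$7 - x$6 * y$3 + x$7 * y$2)
    (x$2 * y$4 - x$4 * y$2 + x$1 * y$7 - x$3 * y$5 - x$7 * y$1 + x$5 * y$3)
    (x$3 * y$4 - x$4 * y$3 + x$2 * y$5 - x$1 * y$6 - x$5 * y$2 + x$6 * y$1)"

definition octo :: "real \<Rightarrow> real^7 \<Rightarrow> oct" where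
  "octo r v = ((r, vector [v$1, v$2, v$3]), (v$4, vector [v$5, v$6, v$7]))"

lemma octo_surj: "\<exists>r v. x = octo r v"
proof -
  obtain r u s w where x: "x = ((r, u), (s, w))" by (metis surj_pair)
  have "x = octo r (vec7 (u$1) (u$2) (u$3) s (w$1) (w$2) (w$3))"
    by (simp add: x octo_def vec_eq_iff forall_3)
  then show ?thesis by blast
qed

lemma vector3_eq_iff: "vector [a, b, c] = (vector [a', b', c'] :: real^3) \<longleftrightarrow> a = a' \<and> b = b' \<and> c = c'"
  by (auto simp: vec_eq_iff forall_3)

lemma octo_eq_iff [simp]: "octo r v = octo s w \<longleftrightarrow> r = s \<and> v = w"
  by (auto simp: octo_def vec7_eq_iff vector3_eq_iff)

lemma octo_add: "octo r v + octo s w = octo (r + s) (v + w)"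
  by (auto simp: octo_def vec_eq_iff forall_3)

lemma octo_scale: "c *\<^sub>R octo r v = octo (c * r) (c *\<^sub>R v)"
  by (auto simp: octo_def vec_eq_iff forall_3)

lemma octo_mult: "octo r v \<cdot>\<^sub>O octo s w = octo (r * s - v \<bullet> w) (r *\<^sub>R w + s *\<^sub>R v + cr v w)"
  by (simp add: octo_def cr_def inner_7 cross3_def inner_vec_def sum_3 vec_eq_iff forall_3 algebra_simps)

lemma im_oct_eq: "im_oct v = octo 0 v"
proof -
  have s: "{1..7::nat} = {1,2,3,4,5,6,7}" by auto
  show ?thesis
    unfolding im_oct_def s
    by (simp add: oct_basis_def octo_def quat_1_def quat_i_def quat_j_def quat_k_def
        zero_prod_def vec_eq_iff forall_3 axis_def)
qed

text \<open>An automorphism fixes the unit, so its action on imaginary octonions determines it; the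
  real and imaginary parts of a product of such elements are \<open>- (v \<bullet> w)\<close> and
  \<open>cr v w\<close>. Conversely, a matrix preserving both extends by the identity on the
  reals.\<close>

lemma carrier_G2:
  "M \<in> carrier G2 \<longleftrightarrow> (\<forall>v w. (M *v v) \<bullet> (M *v w) = v \<bullet> w) \<and> (\<forall>v w. M *v cr v w = cr (M *v v) (M *v w))"
  (is "_ \<longleftrightarrow> ?R")
proof
  assume "M \<in> carrier G2"
  then obtain \<phi> where lin: "linear \<phi>" and bij: "bij \<phi>"
    and mult: "\<And>x y. \<phi> (x \<cdot>\<^sub>O y) = \<phi> x \<cdot>\<^sub>O \<phi> y" and rep: "\<And>v. \<phi> (octo 0 v) = octo 0 (M *v v)"
    by (auto simp: G2_def oct_automorphism_def represents_def im_oct_eq)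
  obtain e where e: "\<phi> e = octo 1 0" using bij by (metis bij_pointE)
  have unit: "octo 1 0 \<cdot>\<^sub>O x = x" "x \<cdot>\<^sub>O octo 1 0 = x" for x
    using octo_surj[of x] by (auto simp: octo_mult cr_def vec7_eq_iff)
  have one: "\<phi> (octo 1 0) = octo 1 0" using mult[of "octo 1 0" e] by (simp add: unit e)
  have full: "\<phi> (octo r v) = octo r (M *v v)" for r v
  proof -
    have "\<phi> (octo r v) = \<phi> (r *\<^sub>R octo 1 0 + octo 0 v)" by (simp add: octo_add octo_scale)
    also have "\<dots> = r *\<^sub>R octo 1 0 + octo 0 (M *v v)"
      using lin by (simp add: linear_add linear_scale one rep)
    finally show ?thesis by (simp add: octo_add octo_scale)
  qed
  show ?R using mult[of "octo 0 _" "octo 0 _"] by (simp add: octo_mult full)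
next
  assume R: ?R
  define \<phi> where "\<phi> x = (let (r, v) = (SOME (r, v). x = octo r v) in octo r (M *v v))" for x
  have \<phi>: "\<phi> (octo r v) = octo r (M *v v)" for r v
  proof -
    have "(SOME (r', v'). octo r v = octo r' v') = (r, v)" by (rule some_equality) auto
    then show ?thesis by (simp add: \<phi>_def)
  qed
  have lin: "linear \<phi>"
  proof
    fix x y :: oct and c :: real
    show "\<phi> (x + y) = \<phi> x + \<phi> y" using octo_surj[of x] octo_surj[of y]
      by (auto simp: octo_add \<phi> matrix_vector_right_distrib)
    show "\<phi> (c *\<^sub>R x) = c *\<^sub>R \<phi> x" using octo_surj[of x]
      by (auto simp: octo_scale \<phi> matrix_vector_mult_scaleR)
  qed
  have "inj \<phi>"
  proof (rule injI)
    fix x y assume "\<phi> x = \<phi> y"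
    moreover obtain r v s w where xy: "x = octo r v" "y = octo s w" using octo_surj by meson
    ultimately have rs: "r = s" and "M *v (v - w) = 0" by (auto simp: \<phi> matrix_vector_mult_diff_distrib)
    then have "(v - w) \<bullet> (v - w) = 0" using R by (metis inner_zero_left)
    then show "x = y" using rs xy by simp
  qed
  then have "bij \<phi>" using lin by (simp add: bij_def linear_injective_imp_surjective)
  moreover have "\<phi> (x \<cdot>\<^sub>O y) = \<phi> x \<cdot>\<^sub>O \<phi> y" for x y
  proof -
    obtain r v s w where xy: "x = octo r v" "y = octo s w" using octo_surj by meson
    show ?thesis using R
      by (simp add: xy \<phi> octo_mult matrix_vector_right_distrib matrix_vector_mult_scaleR)
  qed
  ultimately show "M \<in> carrier G2" using lin
    by (auto simp: G2_def oct_automorphism_def represents_def im_oct_eq \<phi>)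
qed

lemma G2_inner: "M \<in> carrier G2 \<Longrightarrow> (M *v v) \<bullet> (M *v w) = v \<bullet> w"
  and G2_cr: "M \<in> carrier G2 \<Longrightarrow> M *v cr v w = cr (M *v v) (M *v w)"
  by (auto simp: carrier_G2)

lemma G2_orthogonal: "M \<in> carrier G2 \<Longrightarrow> transpose M ** M = mat 1 \<and> M ** transpose M = mat 1"
proof -
  assume M: "M \<in> carrier G2"
  have "orthogonal_transformation ((*v) M)"
    unfolding orthogonal_transformation_def using M by (simp add: G2_inner)
  then have "orthogonal_matrix M" by (simp add: orthogonal_transformation_matrix)
  then show ?thesis by (simp add: orthogonal_matrix_def)
qed

lemma G2_transpose_mult:
  "M \<in> carrier G2 \<Longrightarrow> transpose M *v (M *v v) = v" "M \<in> carrier G2 \<Longrightarrow> M *v (transpose M *v v) = v"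
  by (simp_all only: matrix_vector_mul_assoc G2_orthogonal matrix_vector_mul_lid)

lemma G2_mult [intro]: "M \<in> carrier G2 \<Longrightarrow> N \<in> carrier G2 \<Longrightarrow> M ** N \<in> carrier G2"
  by (simp add: carrier_G2 flip: matrix_vector_mul_assoc)

lemma G2_one [simp]: "mat 1 \<in> carrier G2"
  by (simp add: carrier_G2)

lemma G2_transpose [intro]: "M \<in> carrier G2 \<Longrightarrow> transpose M \<in> carrier G2"
  by (subst carrier_G2) (metis G2_cr G2_inner G2_transpose_mult)

section \<open>The one-parameter subgroups\<close>

lemma sums_vec:
  fixes f :: "nat \<Rightarrow> real^'n^'m"
  assumes "\<And>i j. (\<lambda>k. f k $ i $ j) sums (L $ i $ j)"
  shows "f sums L"
  unfolding sums_def
  by (intro vec_tendstoI) (use assms in \<open>simp add: sums_def\<close>)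

text \<open>As \<open>X ** X\<close> is diagonal, even powers of \<open>X\<close> are diagonal and
  odd ones are \<open>X\<close> times a diagonal matrix, so the exponential series splits into
  cosine and sine series. Where \<open>w j = 0\<close> the quotient by zero is 0, in agreement with
  the vanishing column of \<open>X\<close>.\<close>

lemma mat_exp_rotation:
  fixes X :: "real^'n^'n" and w :: "'n \<Rightarrow> real"
  assumes sq: "X ** X = (\<chi> i j. if i = j then - (w j)\<^sup>2 else 0)" and zero: "\<And>i j. w j = 0 \<Longrightarrow> X $ i $ j = 0"
  shows "mat_exp (t *\<^sub>R X) =
    (\<chi> i j. (if i = j then cos (t * w j) else 0) + X $ i $ j * (sin (t * w j) / w j))"
proof -
  define A where "A = t *\<^sub>R X"
  have AA: "A ** A = (\<chi> i j. if i = j then - (t * w j)\<^sup>2 else 0)"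
    using sq by (simp add: A_def vec_eq_iff matrix_matrix_mult_def power_mult_distrib mult.assoc mult.left_commute
        power2_eq_square[of t] flip: sum_distrib_left)
  define P where "P k = ((\<lambda>B. A ** B) ^^ k) (mat 1)" for k
  have P_Suc: "P (Suc k) = A ** P k" for k by (simp add: P_def)
  have even: "P (2 * k) = (\<chi> i j. if i = j then (-1) ^ k * (t * w j) ^ (2 * k) else 0)" for k
  proof (induction k)
    case 0
    show ?case by (simp add: P_def mat_def vec_eq_iff)
  next
    case (Suc k)
    have "P (2 * Suc k) = (A ** A) ** P (2 * k)" by (simp add: P_Suc matrix_mul_assoc)
    also have "\<dots> = (\<chi> i j. if i = j then (-1) ^ Suc k * (t * w j) ^ (2 * Suc k) else 0)"
      unfolding AA Suc
      by (auto simp: matrix_matrix_mult_def vec_eq_iff if_distrib[of "\<lambda>x. x * _"] power2_eq_square cong: if_cong)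
    finally show ?case .
  qed
  have odd: "P (Suc (2 * k)) $ i $ j = A $ i $ j * ((-1) ^ k * (t * w j) ^ (2 * k))" for k i j
    unfolding P_Suc even by (simp add: matrix_matrix_mult_def if_distrib[of "\<lambda>x. _ * x"] cong: if_cong)
  have entry: "(1 / fact k) *\<^sub>R P k $ i $ j =
      (if i = j then cos_coeff k *\<^sub>R (t * w j) ^ k else 0) + X $ i $ j * ((sin_coeff k *\<^sub>R (t * w j) ^ k) / w j)" for k i j
  proof (cases "even k")
    case True
    then obtain m where m: "k = 2 * m" by (elim evenE)
    show ?thesis unfolding m even by (simp add: cos_coeff_def sin_coeff_def)
  next
    case False
    then obtain m where m: "k = Suc (2 * m)" by (elim oddE) simp
    show ?thesis unfolding m odd using zero[of j i]
      by (cases "w j = 0") (simp_all add: cos_coeff_def sin_coeff_def A_def)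
  qed
  have "(\<lambda>k. (1 / fact k) *\<^sub>R P k) sums
     (\<chi> i j. (if i = j then cos (t * w j) else 0) + X $ i $ j * (sin (t * w j) / w j))"
  proof (rule sums_vec)
    fix i j
    have "(\<lambda>k. if i = j then cos_coeff k *\<^sub>R (t * w j) ^ k else 0) sums (if i = j then cos (t * w j) else 0)"
      using cos_converges[of "t * w j"] by auto
    moreover have "(\<lambda>k. X $ i $ j * ((sin_coeff k *\<^sub>R (t * w j) ^ k) / w j)) sums (X $ i $ j * (sin (t * w j) / w j))"
      by (intro sums_mult sums_divide sin_converges)
    ultimately show "(\<lambda>k. ((1 / fact k) *\<^sub>R P k) $ i $ j) sums
       ((\<chi> i j. (if i = j then cos (t * w j) else 0) + X $ i $ j * (sin (t * w j) / w j)) $ i $ j)"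
      using sums_add by (fastforce simp: entry[simplified])
  qed
  then show ?thesis
    unfolding mat_exp_def A_def[symmetric] P_def[symmetric] by (simp add: sums_iff)
qed

lemma A_mat_nth: "A_mat a b $ i $ j = (if i = a \<and> j = b then 1 else 0) - (if i = b \<and> j = a then 1 else 0)"
  by (simp add: A_mat_def E_mat_def)

text \<open>The factor \<open>sqrt 3\<close> cancels the normalisation of the generator, so
  \<open>m8\<close>, \<open>m9\<close>, \<open>m11\<close> rotate planes by the angles t and
  2t.\<close>

definition m8 :: "real \<Rightarrow> real^7^7" where "m8 t = mat_exp ((sqrt 3 * t) *\<^sub>R C8)"
definition m9 :: "real \<Rightarrow> real^7^7" where "m9 t = mat_exp ((sqrt 3 * t) *\<^sub>R C9)"
definition m11 :: "real \<Rightarrow> real^7^7" where "m11 t = mat_exp ((sqrt 3 * t) *\<^sub>R C11)"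
definition m2 :: "real \<Rightarrow> real^7^7" where "m2 t = mat_exp (t *\<^sub>R C2)"
definition m3 :: "real \<Rightarrow> real^7^7" where "m3 t = mat_exp (t *\<^sub>R C3)"
definition m5 :: "real \<Rightarrow> real^7^7" where "m5 t = mat_exp (t *\<^sub>R C5)"

lemma sqrt3_scale: "((sqrt 3 * t) *\<^sub>R ((1 / sqrt 3) *\<^sub>R X)) = t *\<^sub>R (X::real^7^7)"
  by (simp add: field_simps)

lemmas gen_simps = matrix_matrix_mult_def sum_7 vec_eq_iff forall_7 A_mat_nth

lemma m8_apply: "m8 t *v x = vec7 (x$1) (cos (2*t) * x$2 - sin (2*t) * x$3) (sin (2*t) * x$2 + cos (2*t) * x$3)
   (cos t * x$4 + sin t * x$5) (cos t * x$5 - sin t * x$4) (cos t * x$6 - sin t * x$7) (sin t * x$6 + cos t * x$7)"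
proof -
  \<comment> \<open>\<open>w j\<close> is the frequency at which the plane containing axis
    \<open>j\<close> turns, read off from the squared generator. The same device serves the next
    five lemmas.\<close>
  define w :: "7 \<Rightarrow> real" where "w j = (if j = 1 then 0 else if j = 2 \<or> j = 3 then 2 else 1)" for j
  have "m8 t = (\<chi> i j. (if i = j then cos (t * w j) else 0) +
      (- 2 *\<^sub>R A_mat 2 3 + A_mat 4 5 - A_mat 6 7) $ i $ j * (sin (t * w j) / w j))"
    unfolding m8_def C8_def sqrt3_scale
    by (rule mat_exp_rotation) (simp_all add: gen_simps w_def split: if_splits)
  then show ?thesis
    by (simp add: vec7_eq_iff matrix_vector_mult_def sum_7 A_mat_nth w_def algebra_simps)
qed

lemma m9_apply: "m9 t *v x = vec7 (cos (2*t) * x$1 - sin (2*t) * x$2) (sin (2*t) * x$1 + cos (2*t) * x$2) (x$3)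
   (cos t * x$4 + sin t * x$7) (cos t * x$5 - sin t * x$6) (sin t * x$5 + cos t * x$6) (cos t * x$7 - sin t * x$4)"
proof -
  define w :: "7 \<Rightarrow> real" where "w j = (if j = 3 then 0 else if j = 1 \<or> j = 2 then 2 else 1)" for j
  have "m9 t = (\<chi> i j. (if i = j then cos (t * w j) else 0) +
      (- 2 *\<^sub>R A_mat 1 2 + A_mat 4 7 - A_mat 5 6) $ i $ j * (sin (t * w j) / w j))"
    unfolding m9_def C9_def sqrt3_scale
    by (rule mat_exp_rotation) (simp_all add: gen_simps w_def split: if_splits)
  then show ?thesis
    by (simp add: vec7_eq_iff matrix_vector_mult_def sum_7 A_mat_nth w_def algebra_simps)
qed

lemma m11_apply: "m11 t *v x = vec7 (cos (2*t) * x$1 - sin (2*t) * x$4) (cos t * x$2 - sin t * x$7) (cos t * x$3 + sin t * x$6)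
   (sin (2*t) * x$1 + cos (2*t) * x$4) (x$5) (cos t * x$6 - sin t * x$3) (sin t * x$2 + cos t * x$7)"
proof -
  define w :: "7 \<Rightarrow> real" where "w j = (if j = 5 then 0 else if j = 1 \<or> j = 4 then 2 else 1)" for j
  have "m11 t = (\<chi> i j. (if i = j then cos (t * w j) else 0) +
      (- 2 *\<^sub>R A_mat 1 4 - A_mat 2 7 + A_mat 3 6) $ i $ j * (sin (t * w j) / w j))"
    unfolding m11_def C11_def sqrt3_scale
    by (rule mat_exp_rotation) (simp_all add: gen_simps w_def split: if_splits)
  then show ?thesis
    by (simp add: vec7_eq_iff matrix_vector_mult_def sum_7 A_mat_nth w_def algebra_simps)
qed

lemma m2_apply: "m2 t *v x = vec7 (x$1) (x$2) (x$3)
   (cos t * x$4 + sin t * x$6) (cos t * x$5 - sin t * x$7) (cos t * x$6 - sin t * x$4) (sin t * x$5 + cos t * x$7)"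
proof -
  define w :: "7 \<Rightarrow> real" where "w j = (if j = 1 \<or> j = 2 \<or> j = 3 then 0 else 1)" for j
  have "m2 t = (\<chi> i j. (if i = j then cos (t * w j) else 0) + C2 $ i $ j * (sin (t * w j) / w j))"
    unfolding m2_def
    by (rule mat_exp_rotation) (auto simp: C2_def gen_simps w_def split: if_splits)
  then show ?thesis
    by (simp add: C2_def vec7_eq_iff matrix_vector_mult_def sum_7 A_mat_nth w_def algebra_simps)
qed

lemma m3_apply: "m3 t *v x = vec7 (x$1) (x$2) (x$3)
   (cos t * x$4 - sin t * x$5) (sin t * x$4 + cos t * x$5) (cos t * x$6 - sin t * x$7) (sin t * x$6 + cos t * x$7)"
proof -
  define w :: "7 \<Rightarrow> real" where "w j = (if j = 1 \<or> j = 2 \<or> j = 3 then 0 else 1)" for j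
  have "m3 t = (\<chi> i j. (if i = j then cos (t * w j) else 0) + C3 $ i $ j * (sin (t * w j) / w j))"
    unfolding m3_def
    by (rule mat_exp_rotation) (auto simp: C3_def gen_simps w_def split: if_splits)
  then show ?thesis
    by (simp add: C3_def vec7_eq_iff matrix_vector_mult_def sum_7 A_mat_nth w_def algebra_simps)
qed

lemma m5_apply: "m5 t *v x = vec7 (x$1) (cos t * x$2 - sin t * x$6) (cos t * x$3 + sin t * x$7)
   (x$4) (x$5) (sin t * x$2 + cos t * x$6) (cos t * x$7 - sin t * x$3)"
proof -
  define w :: "7 \<Rightarrow> real" where "w j = (if j = 1 \<or> j = 4 \<or> j = 5 then 0 else 1)" for j
  have "m5 t = (\<chi> i j. (if i = j then cos (t * w j) else 0) + C5 $ i $ j * (sin (t * w j) / w j))"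
    unfolding m5_def
    by (rule mat_exp_rotation) (auto simp: C5_def gen_simps w_def split: if_splits)
  then show ?thesis
    by (simp add: C5_def vec7_eq_iff matrix_vector_mult_def sum_7 A_mat_nth w_def algebra_simps)
qed

lemmas m_apply = m8_apply m9_apply m11_apply m2_apply m3_apply m5_apply

lemma G2I:
  assumes "\<And>v. (M *v v) \<bullet> (M *v v) = v \<bullet> v" "\<And>v w. M *v cr v w = cr (M *v v) (M *v w)"
  shows "M \<in> carrier G2"
proof -
  have "(M *v v) \<bullet> (M *v w) = v \<bullet> w" for v w
    using assms(1)[of "v + w"] assms(1)[of v] assms(1)[of w]
    by (simp add: matrix_vector_right_distrib inner_add_left inner_add_right inner_commute)
  with assms(2) show ?thesis by (simp add: carrier_G2)
qed

lemma m_G2: "m8 t \<in> carrier G2" "m9 t \<in> carrier G2" "m11 t \<in> carrier G2"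
    "m2 t \<in> carrier G2" "m3 t \<in> carrier G2" "m5 t \<in> carrier G2"
proof -
  have cc: "cos t * cos t = 1 - sin t * sin t"
    using sin_cos_squared_add[of t] by (simp add: power2_eq_square)
  \<comment> \<open>The variant of \<open>cc\<close> for products bracketed to the right; with both,
    the conditions become polynomial identities in sines and cosines.\<close>
  have ccx: "cos t * (cos t * x) = x - sin t * (sin t * x)" for x
    using cc by (metis (no_types, opaque_lifting) left_diff_distrib mult.assoc mult_1)
  note s = m_apply inner_7 vec7_eq_iff cr_def cos_double sin_double power2_eq_square vec7_nth
  show "m8 t \<in> carrier G2"
    by (rule G2I; simp only: s; simp add: algebra_simps cc ccx)
  show "m9 t \<in> carrier G2"
    by (rule G2I; simp only: s; simp add: algebra_simps cc ccx)
  show "m11 t \<in> carrier G2"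
    by (rule G2I; simp only: s; simp add: algebra_simps cc ccx)
  show "m2 t \<in> carrier G2"
    by (rule G2I; simp only: s; simp add: algebra_simps cc ccx)
  show "m3 t \<in> carrier G2"
    by (rule G2I; simp only: s; simp add: algebra_simps cc ccx)
  show "m5 t \<in> carrier G2"
    by (rule G2I; simp only: s; simp add: algebra_simps cc ccx)
qed

lemma euler_\<sigma>_eq: "euler_\<sigma> x y z = m8 x ** m9 y ** m8 z"
  by (simp add: euler_\<sigma>_def m8_def m9_def)

lemma euler_s_eq: "euler_s x y z = m3 x ** m2 y ** m3 z"
  by (simp add: euler_s_def m3_def m2_def)

lemma euler_G2: "euler_\<sigma> x y z \<in> carrier G2" "euler_s x y z \<in> carrier G2"
  by (auto simp: euler_\<sigma>_eq euler_s_eq intro!: m_G2)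

section \<open>Euler angles\<close>

abbreviation E1 :: "real^7" where "E1 \<equiv> vec7 1 0 0 0 0 0 0"
abbreviation E2 :: "real^7" where "E2 \<equiv> vec7 0 1 0 0 0 0 0"
abbreviation E3 :: "real^7" where "E3 \<equiv> vec7 0 0 1 0 0 0 0"
abbreviation E4 :: "real^7" where "E4 \<equiv> vec7 0 0 0 1 0 0 0"
abbreviation E5 :: "real^7" where "E5 \<equiv> vec7 0 0 0 0 1 0 0"
abbreviation E6 :: "real^7" where "E6 \<equiv> vec7 0 0 0 0 0 1 0"
abbreviation E7 :: "real^7" where "E7 \<equiv> vec7 0 0 0 0 0 0 1"

definition imH :: "(real^7) set" where "imH = {v. v$4 = 0 \<and> v$5 = 0 \<and> v$6 = 0 \<and> v$7 = 0}"
definition imHp :: "(real^7) set" where "imHp = {v. v$1 = 0 \<and> v$2 = 0 \<and> v$3 = 0}"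

text \<open>\<open>E1\<close>, \<open>E2\<close>, \<open>E4\<close> generate the octonions: the
  other basis vectors are iterated products of them.\<close>

lemma G2_eqI:
  assumes M: "M \<in> carrier G2" and N: "N \<in> carrier G2"
    and "M *v E1 = N *v E1" "M *v E2 = N *v E2" "M *v E4 = N *v E4"
  shows "M = N"
proof -
  have c: "E3 = cr E1 E2" "E5 = cr E1 E4" "E6 = cr E2 E4" "E7 = cr (cr E1 E2) E4"
    by (simp_all add: cr_def vec7_eq_iff)
  have e: "M *v E3 = N *v E3" "M *v E5 = N *v E5" "M *v E6 = N *v E6" "M *v E7 = N *v E7"
    unfolding c using assms by (simp_all add: G2_cr)
  have "M *v x = N *v x" for x
  proof -
    have x: "x = x$1 *\<^sub>R E1 + x$2 *\<^sub>R E2 + x$3 *\<^sub>R E3 + x$4 *\<^sub>R E4 + x$5 *\<^sub>R E5 + x$6 *\<^sub>R E6 + x$7 *\<^sub>R E7"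
      by (simp add: vec7_eq_iff)
    show ?thesis
      by (subst (1 2) x) (simp only: matrix_vector_right_distrib matrix_vector_mult_scaleR assms e)
  qed
  then show ?thesis by (simp add: matrix_eq)
qed

lemma polar_coordinates:
  fixes p q :: real
  obtains A where "0 \<le> A" "A < 2 * pi" "p = sqrt (p\<^sup>2 + q\<^sup>2) * cos A" "q = sqrt (p\<^sup>2 + q\<^sup>2) * sin A"
proof (cases "p\<^sup>2 + q\<^sup>2 = 0")
  case True
  then show ?thesis by (intro that[of 0]) (simp_all add: sum_power2_eq_zero_iff)
next
  case False
  define r where "r = sqrt (p\<^sup>2 + q\<^sup>2)"
  have r: "r > 0" "r\<^sup>2 = p\<^sup>2 + q\<^sup>2" using False by (auto simp: r_def sum_power2_gt_zero_iff)
  have "(p / r)\<^sup>2 + (q / r)\<^sup>2 = r\<^sup>2 / r\<^sup>2"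
    by (simp only: power_divide r(2) add_divide_distrib)
  then have "(p / r)\<^sup>2 + (q / r)\<^sup>2 = 1" using r(1) by simp
  then obtain A where A: "0 \<le> A" "A < 2 * pi" "p / r = cos A" "q / r = sin A"
    by (metis sincos_total_2pi)
  have "p = r * cos A" "q = r * sin A" using r(1) by (simp_all flip: A(3,4))
  then show ?thesis unfolding r_def by (intro that[OF A(1,2)])
qed

text \<open>Hopf coordinates: polar angles in two orthogonal planes, with radii \<open>cos y\<close>
  and \<open>sin y\<close>. The last clause halves the range of \<open>y\<close> when the first
  radius dominates.\<close>

lemma sphere3_coordinates:
  fixes p q r t :: real
  assumes "p\<^sup>2 + q\<^sup>2 + r\<^sup>2 + t\<^sup>2 = 1"
  obtains y A B where "0 \<le> y" "y \<le> pi / 2" "0 \<le> A" "A < 2 * pi" "0 \<le> B" "B < 2 * pi"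
    "p = cos y * cos A" "q = cos y * sin A" "r = sin y * cos B" "t = sin y * sin B"
    "r\<^sup>2 + t\<^sup>2 \<le> p\<^sup>2 + q\<^sup>2 \<Longrightarrow> y \<le> pi / 4"
proof -
  obtain A where A: "0 \<le> A" "A < 2 * pi" "p = sqrt (p\<^sup>2 + q\<^sup>2) * cos A" "q = sqrt (p\<^sup>2 + q\<^sup>2) * sin A"
    by (rule polar_coordinates)
  obtain B where B: "0 \<le> B" "B < 2 * pi" "r = sqrt (r\<^sup>2 + t\<^sup>2) * cos B" "t = sqrt (r\<^sup>2 + t\<^sup>2) * sin B"
    by (rule polar_coordinates)
  have "(sqrt (p\<^sup>2 + q\<^sup>2))\<^sup>2 + (sqrt (r\<^sup>2 + t\<^sup>2))\<^sup>2 = 1" using assms by simp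
  then obtain y where y: "0 \<le> y" "y \<le> pi / 2" "sqrt (p\<^sup>2 + q\<^sup>2) = cos y" "sqrt (r\<^sup>2 + t\<^sup>2) = sin y"
    by (metis sincos_total_pi_half real_sqrt_ge_zero sum_power2_ge_zero)
  have "y \<le> pi / 4" if "r\<^sup>2 + t\<^sup>2 \<le> p\<^sup>2 + q\<^sup>2"
  proof (rule ccontr)
    assume "\<not> y \<le> pi / 4"
    then have "pi / 2 - y < y" by simp
    then have "sin (pi / 2 - y) < sin y" using y by (intro sin_monotone_2pi) auto
    then have "cos y < sin y" by (simp add: sin_diff)
    moreover have "sin y \<le> cos y" unfolding y(3,4)[symmetric] using that by simp
    ultimately show False by simp
  qed
  note le = this
  have "p = cos y * cos A" "q = cos y * sin A" "r = sin y * cos B" "t = sin y * sin B"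
    using A(3,4) B(3,4) unfolding y(3,4) .
  then show ?thesis
    using that[OF y(1,2) A(1,2) B(1,2)] le by metis
qed

lemma sigma_imH: "v \<in> imH \<Longrightarrow> euler_\<sigma> x y z *v v \<in> imH"
  by (simp add: imH_def euler_\<sigma>_eq m_apply flip: matrix_vector_mul_assoc)

lemma s_imH: "v \<in> imH \<Longrightarrow> euler_s x y z *v v = v"
  by (simp add: imH_def euler_s_eq m_apply vec7_eq_iff flip: matrix_vector_mul_assoc)

lemma sigma_imHp: "v \<in> imHp \<Longrightarrow> euler_\<sigma> x y z *v v \<in> imHp"
  by (simp add: imHp_def euler_\<sigma>_eq m_apply flip: matrix_vector_mul_assoc)

lemma s_imHp: "v \<in> imHp \<Longrightarrow> euler_s x y z *v v \<in> imHp"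
  by (simp add: imHp_def euler_s_eq m_apply flip: matrix_vector_mul_assoc)

lemma sigma_E1: "euler_\<sigma> x y z *v E1 = vec7 (cos (2*y)) (cos (2*x) * sin (2*y)) (sin (2*x) * sin (2*y)) 0 0 0 0"
  by (simp add: euler_\<sigma>_eq m_apply vec7_eq_iff flip: matrix_vector_mul_assoc)

lemma s_E5: "euler_s x y z *v E5 = vec7 0 0 0 (- cos y * sin (x + z)) (cos y * cos (x + z))
    (- sin y * sin (x - z)) (sin y * cos (x - z))"
  by (simp add: euler_s_eq m_apply vec7_eq_iff sin_add cos_add sin_diff cos_diff algebra_simps
      flip: matrix_vector_mul_assoc)

text \<open>Holds because \<open>m3 (- pi / 2)\<close> maps \<open>E5\<close> to
  \<open>E4\<close>.\<close>

lemma s_E4: "euler_s x y z *v E4 = euler_s x y (z - pi / 2) *v E5"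
  by (simp add: euler_s_eq m_apply vec7_eq_iff sin_diff cos_diff flip: matrix_vector_mul_assoc)

lemma m89_add: "m8 s *v (m8 t *v v) = m8 (s + t) *v v" "m9 s *v (m9 t *v v) = m9 (s + t) *v v"
  by (simp_all add: m_apply vec7_eq_iff sin_add cos_add distrib_left[of 2] left_diff_distrib
      distrib_right right_diff_distrib distrib_left mult.assoc)

text \<open>On \<open>imH\<close> the matrix \<open>euler_\<sigma> x y z\<close> is a rotation with
  doubled Euler angles. Spherical coordinates of \<open>p\<close> give x and y; a rotation about
  \<open>E1\<close> then adjusts the second vector. The entries \<open>c\<close>, \<open>d\<close>
  let both \<open>E2\<close> and \<open>F3\<close> serve as that vector.\<close>

lemma sigma_exists:
  assumes p: "p \<in> imH" "p \<bullet> p = 1" and q: "q \<in> imH" "q \<bullet> q = 1" and pq: "p \<bullet> q = 0"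
    and cd: "c\<^sup>2 + d\<^sup>2 = 1"
  obtains x y z where "0 \<le> x" "x \<le> pi" "0 \<le> y" "y \<le> pi / 2" "0 \<le> z" "z < pi"
    "euler_\<sigma> x y z *v E1 = p" "euler_\<sigma> x y z *v vec7 0 c d 0 0 0 0 = q"
proof -
  have p1: "(p$1)\<^sup>2 + (p$2)\<^sup>2 + (p$3)\<^sup>2 = 1" using p by (simp add: inner_7 imH_def power2_eq_square)
  define h where "h = sqrt ((p$2)\<^sup>2 + (p$3)\<^sup>2)"
  have h: "h \<ge> 0" "(p$1)\<^sup>2 + h\<^sup>2 = 1" using p1 by (auto simp: h_def)
  then obtain Y where Y: "0 \<le> Y" "Y \<le> pi" "p$1 = cos Y" "h = sin Y" by (metis sincos_total_pi)
  obtain X where X: "0 \<le> X" "X < 2 * pi" "p$2 = h * cos X" "p$3 = h * sin X"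
    unfolding h_def by (rule polar_coordinates)
  define N where "N = m8 (X / 2) ** m9 (Y / 2)"
  have N: "N \<in> carrier G2" by (auto simp: N_def intro!: m_G2)
  have N1: "N *v E1 = p"
    using p X Y by (simp add: N_def m_apply vec7_eq_iff imH_def flip: matrix_vector_mul_assoc)
  have Ninv: "\<exists>r \<in> imH. N *v r = q"
  proof -
    define r where "r = m9 (- Y / 2) *v (m8 (- X / 2) *v q)"
    have "m8 t *v (m8 (- t) *v v) = v" "m9 t *v (m9 (- t) *v v) = v" for t v
      using m89_add[of t "- t" v] by (simp_all add: m_apply vec7_eq_iff)
    from this(1)[of "X / 2"] this(2)[of "Y / 2"]
    have "N *v r = q" by (simp add: r_def N_def flip: matrix_vector_mul_assoc)
    moreover have "r \<in> imH" using q by (simp add: r_def imH_def m_apply)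
    ultimately show ?thesis by blast
  qed
  then obtain r where r: "r \<in> imH" "N *v r = q" by blast
  have r1: "r \<bullet> r = 1" and r2: "E1 \<bullet> r = 0"
    using G2_inner[OF N, of r r] G2_inner[OF N, of E1 r] q pq by (simp_all add: r N1)
  have rr: "r$1 = 0" "(r$2)\<^sup>2 + (r$3)\<^sup>2 = 1" using r1 r2 r(1) by (auto simp: inner_7 imH_def power2_eq_square)
  \<comment> \<open>The two terms are the real and imaginary part of \<open>r$2 + i r$3\<close>
    times the conjugate of \<open>c + i d\<close>; the argument of this product is the missing
    rotation angle \<open>Z\<close>.\<close>
  have "(r$2 * c + r$3 * d)\<^sup>2 + (r$3 * c - r$2 * d)\<^sup>2 = ((r$2)\<^sup>2 + (r$3)\<^sup>2) * (c\<^sup>2 + d\<^sup>2)" by algebra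
  then have "(r$2 * c + r$3 * d)\<^sup>2 + (r$3 * c - r$2 * d)\<^sup>2 = 1" using rr cd by simp
  then obtain Z where Z: "0 \<le> Z" "Z < 2 * pi" "r$2 * c + r$3 * d = cos Z" "r$3 * c - r$2 * d = sin Z"
    by (metis sincos_total_2pi)
  have "cos Z * c - sin Z * d = r$2 * (c\<^sup>2 + d\<^sup>2)" "sin Z * c + cos Z * d = r$3 * (c\<^sup>2 + d\<^sup>2)"
    unfolding Z(3,4)[symmetric] by algebra+
  then have m: "m8 (Z / 2) *v vec7 0 c d 0 0 0 0 = r"
    using rr r(1) cd by (simp add: m_apply vec7_eq_iff imH_def)
  have mE: "m8 (Z / 2) *v E1 = E1" by (simp add: m_apply)
  have eN: "euler_\<sigma> (X / 2) (Y / 2) (Z / 2) *v v = N *v (m8 (Z / 2) *v v)" for v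
    by (simp add: euler_\<sigma>_eq N_def flip: matrix_vector_mul_assoc)
  show ?thesis
  proof (rule that)
    show "euler_\<sigma> (X / 2) (Y / 2) (Z / 2) *v E1 = p" by (simp only: eN mE N1)
    show "euler_\<sigma> (X / 2) (Y / 2) (Z / 2) *v vec7 0 c d 0 0 0 0 = q" by (simp only: eN m r)
  qed (use X(1,2) Y(1,2) Z(1,2) in linarith)+
qed

text \<open>By \<open>s_E5\<close> the sum and the difference of the outer angles are the Hopf
  angles of \<open>w\<close>. It remains to choose representatives modulo a full turn that put x and
  z into their ranges.\<close>

lemma s_exists:
  assumes w: "w \<in> imHp" "w \<bullet> w = 1"
  obtains x y z where "0 \<le> x" "x \<le> 2 * pi" "0 \<le> y" "y \<le> pi / 2" "0 \<le> z" "z \<le> pi"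
    "euler_s x y z *v E5 = w" "(w$6)\<^sup>2 + (w$7)\<^sup>2 \<le> (w$4)\<^sup>2 + (w$5)\<^sup>2 \<Longrightarrow> y \<le> pi / 4"
proof -
  have "(w$5)\<^sup>2 + (- w$4)\<^sup>2 + (w$7)\<^sup>2 + (- w$6)\<^sup>2 = 1"
    using w by (simp add: inner_7 imHp_def power2_eq_square)
  then obtain y A B where y: "0 \<le> y" "y \<le> pi / 2" and A: "0 \<le> A" "A < 2 * pi" and B: "0 \<le> B" "B < 2 * pi"
    and eq: "w$5 = cos y * cos A" "- w$4 = cos y * sin A" "w$7 = sin y * cos B" "- w$6 = sin y * sin B"
    and le: "(w$7)\<^sup>2 + (- w$6)\<^sup>2 \<le> (w$5)\<^sup>2 + (- w$4)\<^sup>2 \<Longrightarrow> y \<le> pi / 4"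
    by (rule sphere3_coordinates) blast
  have main: "\<exists>x z. 0 \<le> x \<and> x \<le> 2 * pi \<and> 0 \<le> z \<and> z \<le> pi \<and> sin (x + z) = sin A \<and> cos (x + z) = cos A \<and>
    sin (x - z) = sin B \<and> cos (x - z) = cos B"
  proof -
    \<comment> \<open>Solving \<open>x + z = A\<close>, \<open>x - z = B\<close> gives a negative
      \<open>z\<close> if \<open>A < B\<close>; then one right-hand side is shifted by a full turn,
      and the size of \<open>A + B\<close> decides which, so that \<open>x\<close> stays in
      range.\<close>
    have *: "\<exists>x z. 0 \<le> x \<and> x \<le> 2 * pi \<and> 0 \<le> z \<and> z \<le> pi \<and>
        (x + z = A \<or> x + z = A + 2 * pi) \<and> (x - z = B \<or> x - z = B - 2 * pi)"
    proof -
      consider "B \<le> A" | "A < B" "A + B \<le> 2 * pi" | "A < B" "A + B > 2 * pi" by linarith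
      then show ?thesis
      proof cases
        case 1
        show ?thesis
          by (rule exI[of _ "A / 2 + B / 2"], rule exI[of _ "A / 2 - B / 2"]) (use A B 1 in \<open>auto simp: field_simps\<close>)
      next
        case 2
        show ?thesis
          by (rule exI[of _ "A / 2 + B / 2 + pi"], rule exI[of _ "A / 2 - B / 2 + pi"])
            (use A B 2 in \<open>auto simp: field_simps\<close>)
      next
        case 3
        show ?thesis
          by (rule exI[of _ "A / 2 + B / 2 - pi"], rule exI[of _ "A / 2 - B / 2 + pi"])
            (use A B 3 in \<open>auto simp: field_simps\<close>)
      qed
    qed
    have "sin (B - 2 * pi) = sin B" "cos (B - 2 * pi) = cos B" by (simp_all add: sin_diff cos_diff)
    with * show ?thesis by (metis sin_periodic cos_periodic)
  qed
  then obtain x z where xz: "0 \<le> x" "x \<le> 2 * pi" "0 \<le> z" "z \<le> pi" "sin (x + z) = sin A" "cos (x + z) = cos A"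
    "sin (x - z) = sin B" "cos (x - z) = cos B" by blast
  have "euler_s x y z *v E5 = w"
    unfolding s_E5 xz using w eq by (simp add: vec7_eq_iff imHp_def minus_equation_iff)
  then show ?thesis using that[OF xz(1,2) y xz(3,4)] le by (simp add: add.commute)
qed

section \<open>The subgroup \<open>SO(4)\<close> and its cosets\<close>

lemma quat_mult_assoc: "(a \<cdot>\<^sub>H b) \<cdot>\<^sub>H c = a \<cdot>\<^sub>H (b \<cdot>\<^sub>H c)"
  by (cases a; cases b; cases c) (simp add: cross3_simps forall_3)

lemma quat_cnj_mult: "quat_cnj (a \<cdot>\<^sub>H b) = quat_cnj b \<cdot>\<^sub>H quat_cnj a"
  by (cases a; cases b) (simp add: cross3_simps forall_3)

lemma norm_quat_mult: "norm (a \<cdot>\<^sub>H b) = norm a * norm b"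
proof -
  obtain r u s v where ab: "a = (r, u)" "b = (s, v)" by fastforce
  have "(norm (a \<cdot>\<^sub>H b))\<^sup>2 = (norm a * norm b)\<^sup>2"
    unfolding power_mult_distrib power2_norm_eq_inner ab
    by (simp add: inner_prod_def cross3_simps)
  then show ?thesis by (simp add: power2_eq_iff_nonneg)
qed

lemma quat_1_mult [simp]: "quat_1 \<cdot>\<^sub>H a = a" "a \<cdot>\<^sub>H quat_1 = a" "norm quat_1 = 1"
  by (cases a, simp add: quat_1_def cross3_simps forall_3 norm_Pair)+

lemma oct_gamma_comp: "oct_gamma a b (oct_gamma c d x) = oct_gamma (a \<cdot>\<^sub>H c) (b \<cdot>\<^sub>H d) x"
  by (cases x) (simp add: quat_cnj_mult quat_mult_assoc)

lemma represents_mult: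
  "represents M \<phi> \<Longrightarrow> represents N \<psi> \<Longrightarrow> represents (M ** N) (\<lambda>x. \<phi> (\<psi> x))"
  by (simp add: represents_def matrix_vector_mul_assoc)

lemma represents_gamma_mult:
  "represents M (oct_gamma a b) \<Longrightarrow> represents N (oct_gamma c d) \<Longrightarrow>
    represents (M ** N) (oct_gamma (a \<cdot>\<^sub>H c) (b \<cdot>\<^sub>H d))"
  using represents_mult by (fastforce simp: oct_gamma_comp)

lemma represents_unique: "represents M \<phi> \<Longrightarrow> represents N \<phi> \<Longrightarrow> M = N"
  by (simp add: represents_def im_oct_eq matrix_eq)

definition qi :: "real \<Rightarrow> quat" where "qi t = (cos t, vector [sin t, 0, 0])"
definition qj :: "real \<Rightarrow> quat" where "qj t = (cos t, vector [0, sin t, 0])"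
definition qk :: "real \<Rightarrow> quat" where "qk t = (cos t, vector [0, 0, sin t])"

lemma norm_q [simp]: "norm (qi t) = 1" "norm (qj t) = 1" "norm (qk t) = 1"
  by (simp_all add: qi_def qj_def qk_def norm_eq_sqrt_inner inner_prod_def inner_vec_def sum_3 flip: power2_eq_square)

text \<open>Places \<open>m8\<close>, \<open>m9\<close> in the first unit quaternion factor and
  \<open>m3\<close>, \<open>m2\<close> in the second, so that Euler decompositions of unit
  quaternions become decompositions of elements of \<open>SO4\<close>.\<close>

lemma represents_m:
  "represents (m8 t) (oct_gamma (qi t) quat_1)" "represents (m9 t) (oct_gamma (qk t) quat_1)"
  "represents (m3 t) (oct_gamma quat_1 (qi t))" "represents (m2 t) (oct_gamma quat_1 (qj (- t)))"
proof -
  have cc: "cos t * cos t = 1 - sin t * sin t"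
    using sin_cos_squared_add[of t] by (simp add: power2_eq_square)
  have ccx: "cos t * (cos t * x) = x - sin t * (sin t * x)" for x
    using cc by (metis (no_types, opaque_lifting) left_diff_distrib mult.assoc mult_1)
  show "represents (m8 t) (oct_gamma (qi t) quat_1)" "represents (m9 t) (oct_gamma (qk t) quat_1)"
  "represents (m3 t) (oct_gamma quat_1 (qi t))" "represents (m2 t) (oct_gamma quat_1 (qj (- t)))"
    by (simp_all add: represents_def im_oct_eq octo_def m_apply qi_def qj_def qk_def quat_1_def cross3_def
        inner_vec_def sum_3 vec_eq_iff forall_3 cos_double sin_double power2_eq_square)
      (simp_all add: algebra_simps cc ccx)
qed

lemma represents_euler:
  "represents (euler_\<sigma> x y z ** euler_s x' y' z')
     (oct_gamma (qi x \<cdot>\<^sub>H qk y \<cdot>\<^sub>H qi z) (qi x' \<cdot>\<^sub>H qj (- y') \<cdot>\<^sub>H qi z'))"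
proof -
  have "represents (euler_\<sigma> x y z) (oct_gamma (qi x \<cdot>\<^sub>H qk y \<cdot>\<^sub>H qi z) quat_1)"
    unfolding euler_\<sigma>_eq
    using represents_gamma_mult[OF represents_gamma_mult[OF represents_m(1) represents_m(2)] represents_m(1)] by simp
  moreover have "represents (euler_s x' y' z') (oct_gamma quat_1 (qi x' \<cdot>\<^sub>H qj (- y') \<cdot>\<^sub>H qi z'))"
    unfolding euler_s_eq
    using represents_gamma_mult[OF represents_gamma_mult[OF represents_m(3) represents_m(4)] represents_m(3)] by simp
  ultimately show ?thesis using represents_gamma_mult by fastforce
qed

lemma euler_in_SO4: "euler_\<sigma> x y z ** euler_s x' y' z' \<in> SO4"
  unfolding SO4_def using represents_euler[of x y z x' y' z']
  by (intro CollectI exI conjI; assumption?) (simp_all add: norm_quat_mult)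

lemma quat_euler_coordinates:
  assumes "norm (a::quat) = 1"
  obtains y A B where "a = (cos y * cos A, vector [cos y * sin A, - sin y * sin B, sin y * cos B])"
proof -
  obtain r u where a: "a = (r, u)" by fastforce
  have "norm a ^ 2 = 1" using assms by simp
  then have "r\<^sup>2 + (u$1)\<^sup>2 + (u$3)\<^sup>2 + (- u$2)\<^sup>2 = 1"
    unfolding power2_norm_eq_inner a by (simp add: inner_prod_def inner_vec_def sum_3 power2_eq_square)
  then obtain y A B where eq: "r = cos y * cos A" "u$1 = cos y * sin A" "u$3 = sin y * cos B" "- u$2 = sin y * sin B"
    by (rule sphere3_coordinates)
  then have "u = vector [cos y * sin A, - sin y * sin B, sin y * cos B]"
    by (simp add: vec_eq_iff forall_3 minus_equation_iff)
  then show ?thesis using that a eq(1) by simp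
qed

lemma quat_euler_sigma:
  assumes "norm (a::quat) = 1"
  shows "\<exists>x y z. a = qi x \<cdot>\<^sub>H qk y \<cdot>\<^sub>H qi z"
proof -
  obtain y A B where a: "a = (cos y * cos A, vector [cos y * sin A, - sin y * sin B, sin y * cos B])"
    using assms by (rule quat_euler_coordinates)
  have "\<exists>x z. A = x + z \<and> B = x - z"
    by (rule exI[of _ "A / 2 + B / 2"], rule exI[of _ "A / 2 - B / 2"]) simp
  then obtain x z where "A = x + z" "B = x - z" by blast
  then have "sin A = sin x * cos z + cos x * sin z" "cos A = cos x * cos z - sin x * sin z"
      "sin B = sin x * cos z - cos x * sin z" "cos B = cos x * cos z + sin x * sin z"
    by (simp_all add: sin_add cos_add sin_diff cos_diff)
  then have "a = qi x \<cdot>\<^sub>H qk y \<cdot>\<^sub>H qi z"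
    by (simp add: a qi_def qk_def cross3_def inner_vec_def sum_3 vec_eq_iff forall_3
        right_diff_distrib left_diff_distrib distrib_left distrib_right)
  then show ?thesis by blast
qed

lemma quat_euler_s:
  assumes "norm (b::quat) = 1"
  shows "\<exists>x y z. b = qi x \<cdot>\<^sub>H qj (- y) \<cdot>\<^sub>H qi z"
proof -
  obtain y A B where b: "b = (cos y * cos A, vector [cos y * sin A, - sin y * sin B, sin y * cos B])"
    using assms by (rule quat_euler_coordinates)
  \<comment> \<open>The middle factor is now the exponential of \<open>- j y\<close> instead of
    \<open>k y\<close>, which turns the second Hopf angle by a quarter:
    \<open>B = x - z + pi / 2\<close>.\<close>
  have "\<exists>x z. A = x + z \<and> B + pi / 2 = x - z + pi"
    by (rule exI[of _ "A / 2 + B / 2 - pi / 4"], rule exI[of _ "A / 2 - B / 2 + pi / 4"]) simp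
  then obtain x z where xz: "A = x + z" "B = x - z + pi / 2" by force
  then have "sin A = sin x * cos z + cos x * sin z" "cos A = cos x * cos z - sin x * sin z"
      "sin B = cos x * cos z + sin x * sin z" "cos B = cos x * sin z - sin x * cos z"
    by (simp_all add: sin_add cos_add sin_diff cos_diff)
  then have "b = qi x \<cdot>\<^sub>H qj (- y) \<cdot>\<^sub>H qi z"
    by (simp add: b qi_def qj_def cross3_def inner_vec_def sum_3 vec_eq_iff forall_3
        right_diff_distrib left_diff_distrib distrib_left distrib_right)
  then show ?thesis by blast
qed

lemma SO4_cases:
  assumes "M \<in> SO4"
  obtains x y z x' y' z' where "M = euler_\<sigma> x y z ** euler_s x' y' z'"
proof -
  obtain a b where ab: "norm a = 1" "norm b = 1" "represents M (oct_gamma a b)"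
    using assms by (auto simp: SO4_def)
  obtain x y z where a: "a = qi x \<cdot>\<^sub>H qk y \<cdot>\<^sub>H qi z" using quat_euler_sigma[OF ab(1)] by blast
  obtain x' y' z' where b: "b = qi x' \<cdot>\<^sub>H qj (- y') \<cdot>\<^sub>H qi z'" using quat_euler_s[OF ab(2)] by blast
  show ?thesis
    by (rule that, rule represents_unique[OF ab(3)]) (unfold a b, rule represents_euler)
qed

text \<open>An \<open>euler_\<sigma>\<close> factor reproduces the images of \<open>E1\<close>,
  \<open>E2\<close> and hence of \<open>E3\<close>. What remains is the image of \<open>E4\<close>,
  which after undoing this factor is a unit vector of \<open>imHp\<close> and is reached by an
  \<open>euler_s\<close> factor.\<close>

lemma G2_agree:
  assumes M: "M \<in> carrier G2" and "M *v E1 \<in> imH" "M *v E2 \<in> imH"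
  obtains x y z x' y' z' where "M = euler_\<sigma> x y z ** euler_s x' y' z'"
proof -
  have "(M *v E1) \<bullet> (M *v E1) = 1" "(M *v E2) \<bullet> (M *v E2) = 1" "(M *v E1) \<bullet> (M *v E2) = 0"
    unfolding G2_inner[OF M] by (simp_all add: inner_7)
  then obtain x y z where xyz: "euler_\<sigma> x y z *v E1 = M *v E1" "euler_\<sigma> x y z *v E2 = M *v E2"
    using sigma_exists[of "M *v E1" "M *v E2" 1 0] assms by simp blast
  define N where "N = euler_\<sigma> x y z"
  have N: "N \<in> carrier G2" by (simp add: N_def euler_G2)
  define w where "w = transpose N *v (M *v E4)"
  have Nw: "N *v w = M *v E4" by (simp add: w_def N G2_transpose_mult del: transpose_matrix_vector)
  have E3: "E3 = cr E1 E2" by (simp add: cr_def vec7_eq_iff)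
  have N3: "N *v E3 = M *v E3" unfolding E3 using N M xyz by (simp add: G2_cr N_def)
  have i: "E1 \<bullet> w = 0" "E2 \<bullet> w = 0" "E3 \<bullet> w = 0" "w \<bullet> w = 1"
    unfolding G2_inner[OF N, of _ w, symmetric] Nw
    unfolding N_def xyz unfolding N_def[symmetric] N3 G2_inner[OF M] by (simp_all add: inner_7)
  then have "w \<in> imHp" by (simp add: imHp_def inner_7)
  then obtain x' y' z' where s: "euler_s x' y' z' *v E5 = w" using i(4) by (rule s_exists)
  \<comment> \<open>By \<open>s_E4\<close> the quarter turn converts the statement about
    \<open>E5\<close> into one about \<open>E4\<close>.\<close>
  have "M = N ** euler_s x' y' (z' + pi / 2)"
  proof (rule G2_eqI)
    show "M *v E1 = (N ** euler_s x' y' (z' + pi / 2)) *v E1" "M *v E2 = (N ** euler_s x' y' (z' + pi / 2)) *v E2"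
      using xyz by (simp_all add: s_imH imH_def N_def flip: matrix_vector_mul_assoc)
    show "M *v E4 = (N ** euler_s x' y' (z' + pi / 2)) *v E4"
      by (simp add: s_E4 s Nw flip: matrix_vector_mul_assoc)
  qed (use M N euler_G2 in auto)
  then show ?thesis using that N_def by blast
qed

lemma SO4_preserves:
  assumes "M \<in> SO4"
  shows "M \<in> carrier G2" "v \<in> imH \<Longrightarrow> M *v v \<in> imH" "v \<in> imHp \<Longrightarrow> M *v v \<in> imHp"
proof -
  obtain x y z x' y' z' where M: "M = euler_\<sigma> x y z ** euler_s x' y' z'" using assms by (rule SO4_cases)
  show "M \<in> carrier G2" "v \<in> imH \<Longrightarrow> M *v v \<in> imH" "v \<in> imHp \<Longrightarrow> M *v v \<in> imHp"
    by (auto simp: M euler_G2 sigma_imH s_imH sigma_imHp s_imHp simp flip: matrix_vector_mul_assoc)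
qed

text \<open>The reflection in the imaginary quaternions; its conjugates separate the cosets of \<open>SO(4)\<close>.\<close>

definition refl_H :: "real^7^7" where
  "refl_H = (\<chi> i j. if i = j then if i = 1 \<or> i = 2 \<or> i = 3 then 1 else - 1 else 0)"

lemma refl_H_apply: "refl_H *v v = vec7 (v$1) (v$2) (v$3) (- v$4) (- v$5) (- v$6) (- v$7)"
  by (simp add: refl_H_def matrix_vector_mult_def sum_7 vec7_eq_iff)

lemma refl_H_imH: "refl_H *v v = v \<longleftrightarrow> v \<in> imH"
  by (auto simp: refl_H_apply vec7_eq_iff imH_def)

text \<open>\<open>imH\<close> and \<open>imHp\<close> are the eigenspaces of \<open>refl_H\<close>,
  and elements of \<open>SO4\<close> preserve both; conversely a matrix commuting with
  \<open>refl_H\<close> preserves \<open>imH\<close>, so \<open>G2_agree\<close> applies. Membership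
  becomes a matrix equation, from which closure under products and inverses follows.\<close>

lemma SO4_iff: "M \<in> SO4 \<longleftrightarrow> M \<in> carrier G2 \<and> M ** refl_H = refl_H ** M"
proof
  assume M: "M \<in> SO4"
  have "M *v (refl_H *v v) = refl_H *v (M *v v)" for v
  proof -
    define a where "a = vec7 (v$1) (v$2) (v$3) 0 0 0 0"
    define b where "b = vec7 0 0 0 (v$4) (v$5) (v$6) (v$7)"
    have v: "v = a + b" by (simp add: a_def b_def vec7_eq_iff)
    have H: "M *v a \<in> imH" "M *v b \<in> imHp"
      by (rule SO4_preserves[OF M], simp add: a_def b_def imH_def imHp_def)+
    have "refl_H *v v = a - b" "refl_H *v (M *v v) = M *v a - M *v b"
      using H by (simp_all add: v matrix_vector_right_distrib) (simp_all add: refl_H_apply vec7_eq_iff imH_def imHp_def a_def b_def)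
    then show ?thesis by (simp add: matrix_vector_mult_diff_distrib)
  qed
  then show "M \<in> carrier G2 \<and> M ** refl_H = refl_H ** M"
    using SO4_preserves(1)[OF M] by (simp add: matrix_eq flip: matrix_vector_mul_assoc)
next
  assume M: "M \<in> carrier G2 \<and> M ** refl_H = refl_H ** M"
  have "M *v v \<in> imH" if "v \<in> imH" for v
    using M that by (metis refl_H_imH matrix_vector_mul_assoc)
  then have "M *v E1 \<in> imH" "M *v E2 \<in> imH" by (simp_all add: imH_def)
  then obtain x y z x' y' z' where "M = euler_\<sigma> x y z ** euler_s x' y' z'" using M G2_agree by blast
  then show "M \<in> SO4" using euler_in_SO4 by simp
qed

lemma SO4_mult: "M \<in> SO4 \<Longrightarrow> N \<in> SO4 \<Longrightarrow> M ** N \<in> SO4"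
  by (auto simp: SO4_iff) (metis matrix_mul_assoc)

lemma SO4_transpose:
  assumes "M \<in> SO4"
  shows "transpose M \<in> SO4"
proof -
  have M: "M \<in> carrier G2" "M ** refl_H = refl_H ** M" using assms by (auto simp: SO4_iff)
  have o: "transpose M ** M = mat 1" "M ** transpose M = mat 1" using G2_orthogonal[OF M(1)] by auto
  have "transpose M ** refl_H = transpose M ** (refl_H ** M) ** transpose M"
    by (metis o(2) matrix_mul_assoc matrix_mul_rid)
  also have "\<dots> = refl_H ** transpose M" by (metis M(2) o(1) matrix_mul_assoc matrix_mul_lid)
  finally show ?thesis using M(1) by (auto simp: SO4_iff)
qed

lemma SO4_one: "mat 1 \<in> SO4"
  by (simp add: SO4_iff)

text \<open>For \<open>g\<close> in G2 the transpose is the inverse, so this is the reflection in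
  the imaginary part of \<open>g H\<close>. It is continuous in \<open>g\<close> with values in a
  fixed matrix space.\<close>

definition conj_refl :: "real^7^7 \<Rightarrow> real^7^7" where
  "conj_refl g = g ** refl_H ** transpose g"

section \<open>Equality of cosets\<close>

lemma SO4_coset_eq: "g <#\<^bsub>G2\<^esub> SO4 = {g ** h | h. h \<in> SO4}"
  by (auto simp: l_coset_def G2_def)

text \<open>For the second criterion, orthogonal factors are moved across: equality of the two
  reflections says that \<open>transpose g ** h\<close> commutes with \<open>refl_H\<close>, which
  is membership in \<open>SO4\<close>.\<close>

lemma coset_eq_iff:
  assumes g: "g \<in> carrier G2" and h: "h \<in> carrier G2"
  shows "g <#\<^bsub>G2\<^esub> SO4 = h <#\<^bsub>G2\<^esub> SO4 \<longleftrightarrow> transpose g ** h \<in> SO4"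
    and "g <#\<^bsub>G2\<^esub> SO4 = h <#\<^bsub>G2\<^esub> SO4 \<longleftrightarrow> conj_refl g = conj_refl h"
proof -
  note og = G2_orthogonal[OF g] and oh = G2_orthogonal[OF h]
  have 1: "transpose g ** h \<in> SO4" if "g <#\<^bsub>G2\<^esub> SO4 = h <#\<^bsub>G2\<^esub> SO4"
  proof -
    have "h \<in> h <#\<^bsub>G2\<^esub> SO4" using SO4_one by (auto simp: SO4_coset_eq intro: exI[of _ "mat 1"])
    then have "h \<in> g <#\<^bsub>G2\<^esub> SO4" using that by simp
    then obtain k where "h = g ** k" "k \<in> SO4" by (auto simp: SO4_coset_eq)
    then show ?thesis using og by (simp add: matrix_mul_assoc)
  qed
  have 2: "g <#\<^bsub>G2\<^esub> SO4 = h <#\<^bsub>G2\<^esub> SO4" if k: "transpose g ** h \<in> SO4"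
  proof -
    have hg: "h = g ** (transpose g ** h)" using og by (simp add: matrix_mul_assoc)
    have gh: "g = h ** (transpose (transpose g ** h))"
      using oh by (simp add: matrix_transpose_mul matrix_mul_assoc)
    show ?thesis
    proof (intro subset_antisym subsetI)
      fix m assume "m \<in> g <#\<^bsub>G2\<^esub> SO4"
      then obtain l where "m = g ** l" "l \<in> SO4" by (auto simp: SO4_coset_eq)
      then show "m \<in> h <#\<^bsub>G2\<^esub> SO4" unfolding SO4_coset_eq
        by (metis (mono_tags, lifting) gh SO4_mult SO4_transpose k matrix_mul_assoc mem_Collect_eq)
    next
      fix m assume "m \<in> h <#\<^bsub>G2\<^esub> SO4"
      then obtain l where "m = h ** l" "l \<in> SO4" by (auto simp: SO4_coset_eq)
      then show "m \<in> g <#\<^bsub>G2\<^esub> SO4" unfolding SO4_coset_eq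
        by (metis (mono_tags, lifting) hg SO4_mult k matrix_mul_assoc mem_Collect_eq)
    qed
  qed
  show "g <#\<^bsub>G2\<^esub> SO4 = h <#\<^bsub>G2\<^esub> SO4 \<longleftrightarrow> transpose g ** h \<in> SO4"
    using 1 2 by blast
  have "transpose g ** h \<in> SO4 \<longleftrightarrow> (transpose g ** h) ** refl_H = refl_H ** (transpose g ** h)"
    using g h by (auto simp: SO4_iff)
  also have "\<dots> \<longleftrightarrow> conj_refl g = conj_refl h"
  proof
    assume a: "(transpose g ** h) ** refl_H = refl_H ** (transpose g ** h)"
    have "conj_refl h = g ** ((transpose g ** h) ** refl_H) ** transpose h"
      using og by (simp add: conj_refl_def matrix_mul_assoc)
    also have "\<dots> = g ** refl_H ** transpose g ** (h ** transpose h)" unfolding a by (simp add: matrix_mul_assoc)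
    finally show "conj_refl g = conj_refl h" using oh by (simp add: conj_refl_def)
  next
    assume a: "conj_refl g = conj_refl h"
    have "(transpose g ** h) ** refl_H = transpose g ** conj_refl h ** h"
      using oh by (simp add: conj_refl_def flip: matrix_mul_assoc)
    also have "\<dots> = transpose g ** conj_refl g ** h" by (simp add: a)
    also have "\<dots> = refl_H ** (transpose g ** h)"
      using og by (simp add: conj_refl_def matrix_mul_assoc)
    finally show "(transpose g ** h) ** refl_H = refl_H ** (transpose g ** h)" .
  qed
  finally show "g <#\<^bsub>G2\<^esub> SO4 = h <#\<^bsub>G2\<^esub> SO4 \<longleftrightarrow> conj_refl g = conj_refl h" using 1 2 by blast
qed

lemma quat_variety_eq: "quat_variety = {g <#\<^bsub>G2\<^esub> SO4 | g. g \<in> carrier G2}"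
  by (auto simp: quat_variety_def LCOSETS_def)

lemma coset_translate: "g <#\<^bsub>G2\<^esub> (h <#\<^bsub>G2\<^esub> SO4) = (g ** h) <#\<^bsub>G2\<^esub> SO4"
  by (auto simp: l_coset_def G2_def matrix_mul_assoc)

section \<open>Surjectivity: the position of two quaternionic subalgebras\<close>

lemma cr_add: "cr (x + y) z = cr x z + cr y z" "cr z (x + y) = cr z x + cr z y"
  and cr_scaleR: "cr (a *\<^sub>R x) y = a *\<^sub>R cr x y" "cr x (a *\<^sub>R y) = a *\<^sub>R cr x y"
  and cr_minus: "cr (- x) y = - cr x y" "cr x (- y) = - cr x y"
  and cr_diff: "cr (x - y) z = cr x z - cr y z" "cr z (x - y) = cr z x - cr z y"
  by (simp_all add: cr_def vec7_eq_iff algebra_simps)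

lemma cr_self [simp]: "cr x x = 0"
  by (simp add: cr_def vec7_eq_iff)

lemma cr_swap: "cr y x = - cr x y"
  by (simp add: cr_def vec7_eq_iff)

text \<open>The left alternative law x(xy) = (xx)y for imaginary octonions.\<close>

lemma cr_cr: "cr x (cr x y) = (x \<bullet> y) *\<^sub>R x - (x \<bullet> x) *\<^sub>R y"
  by (simp add: cr_def vec7_eq_iff inner_7 algebra_simps)

lemma inner_cr_self [simp]: "x \<bullet> cr x y = 0" "y \<bullet> cr x y = 0"
  by (simp_all add: cr_def inner_7 algebra_simps)

lemma inner_cr_self' [simp]: "cr x y \<bullet> x = 0" "cr x y \<bullet> y = 0"
  by (simp_all add: inner_commute[of "cr x y"])

lemma inner_cr_cr: "cr x y \<bullet> cr x y = (x \<bullet> x) * (y \<bullet> y) - (x \<bullet> y)\<^sup>2"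
proof -
  have "cr x y \<bullet> cr x y = - (y \<bullet> cr x (cr x y))"
    by (simp add: cr_def inner_7 algebra_simps)
  then show ?thesis
    by (simp add: cr_cr inner_diff_right inner_commute[of y x] power2_eq_square algebra_simps)
qed

section \<open>Singular vectors for a pair of quaternionic subalgebras\<close>

lemma maximal_pair:
  fixes U V :: "'a::euclidean_space set"
  assumes U: "subspace U" "u \<in> U" "norm u = 1" and V: "subspace V" "v \<in> V" "norm v = 1"
  obtains p q where "p \<in> U" "norm p = 1" "q \<in> V" "norm q = 1"
    "\<And>x y. x \<in> U \<Longrightarrow> norm x = 1 \<Longrightarrow> y \<in> V \<Longrightarrow> norm y = 1 \<Longrightarrow> x \<bullet> y \<le> p \<bullet> q"
proof -
  have cpt: "compact (W \<inter> sphere 0 1)" if "subspace W" for W :: "'a set"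
    using that by (simp add: closed_Int_compact closed_subspace)
  have "\<exists>z \<in> (U \<inter> sphere 0 1) \<times> (V \<inter> sphere 0 1). \<forall>y \<in> (U \<inter> sphere 0 1) \<times> (V \<inter> sphere 0 1).
      fst y \<bullet> snd y \<le> fst z \<bullet> snd z"
    by (rule continuous_attains_sup) (use U V in \<open>auto intro!: compact_Times cpt continuous_intros\<close>)
  then show ?thesis using that by auto
qed

text \<open>First variation at a maximiser, made explicit: if \<open>q\<close> had a component along
  a unit vector \<open>n\<close> of \<open>U\<close> orthogonal to \<open>p\<close>, the normalised
  projection of \<open>q\<close> to the plane of \<open>p\<close> and \<open>n\<close> would do
  better.\<close>

lemma maximal_pair_critical:
  fixes U :: "'a::real_inner set"
  assumes U: "subspace U" "p \<in> U" "norm p = 1" and x: "x \<in> U" "x \<bullet> p = 0"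
    and max: "\<And>x. x \<in> U \<Longrightarrow> norm x = 1 \<Longrightarrow> x \<bullet> q \<le> p \<bullet> q"
  shows "x \<bullet> q = 0"
proof (rule ccontr)
  assume xq: "x \<bullet> q \<noteq> 0"
  then have "norm x > 0" by auto
  define n where "n = x /\<^sub>R norm x"
  define c where "c = p \<bullet> q"
  define d where "d = n \<bullet> q"
  have n: "n \<in> U" "n \<bullet> p = 0" "n \<bullet> n = 1"
    using x U \<open>norm x > 0\<close> by (simp_all add: n_def subspace_scale dot_square_norm power2_eq_square)
  have pp: "p \<bullet> p = 1" using U by (simp add: dot_square_norm)
  have d: "d \<noteq> 0" using xq \<open>norm x > 0\<close> by (simp add: d_def n_def)
  define r where "r = sqrt (c\<^sup>2 + d\<^sup>2)"
  have r: "r > 0" "r\<^sup>2 = c\<^sup>2 + d\<^sup>2" using d by (simp_all add: r_def sum_power2_gt_zero_iff)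
  define y where "y = (c / r) *\<^sub>R p + (d / r) *\<^sub>R n"
  have "y \<bullet> y = (c\<^sup>2 + d\<^sup>2) / r\<^sup>2"
    using n pp by (simp add: y_def inner_add_left inner_add_right inner_commute[of p n] power2_eq_square
        add_divide_distrib)
  then have "y \<bullet> y = 1" using r by (metis div_self less_irrefl zero_eq_power2)
  then have "norm y = 1" by (simp add: norm_eq_1)
  moreover have "y \<in> U" using U n by (simp add: y_def subspace_add subspace_scale)
  moreover have "y \<bullet> q = (c\<^sup>2 + d\<^sup>2) / r"
    by (simp add: y_def inner_add_left c_def[symmetric] d_def[symmetric] power2_eq_square add_divide_distrib)
  ultimately have "r\<^sup>2 / r \<le> c" using max[of y] r by (simp add: c_def)
  then have "r \<le> c" using r by (simp add: power2_eq_square)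
  then have "r\<^sup>2 \<le> c\<^sup>2" using r by (intro power_mono) auto
  moreover have "d\<^sup>2 > 0" using d by simp
  ultimately show False using r(2) by linarith
qed

lemma orthogonal_in_plane:
  fixes x y q :: "'a::real_inner"
  assumes "x \<bullet> x = 1" "y \<bullet> y = 1" "x \<bullet> y = 0" "subspace V" "x \<in> V" "y \<in> V"
  obtains z where "z \<in> V" "norm z = 1" "z \<bullet> q = 0"
proof (cases "x \<bullet> q = 0")
  case True
  then show ?thesis using that[of x] assms by (simp add: norm_eq_sqrt_inner)
next
  case False
  define z where "z = (y \<bullet> q) *\<^sub>R x - (x \<bullet> q) *\<^sub>R y"
  have "z \<bullet> z = (y \<bullet> q)\<^sup>2 + (x \<bullet> q)\<^sup>2"
    using assms by (simp add: z_def inner_diff_left inner_diff_right inner_commute[of y x] power2_eq_square)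
  then have "z \<noteq> 0" using False by (auto simp: sum_power2_eq_zero_iff)
  moreover have "z \<in> V" using assms by (simp add: z_def subspace_diff subspace_scale)
  moreover have "z \<bullet> q = 0" by (simp add: z_def inner_diff_left)
  ultimately show ?thesis using that[of "z /\<^sub>R norm z"] assms by (simp add: subspace_scale)
qed

text \<open>For orthonormal \<open>x\<close>, \<open>y\<close> this is the imaginary part of the
  quaternionic subalgebra that they generate.\<close>

definition qspan :: "real^7 \<Rightarrow> real^7 \<Rightarrow> (real^7) set" where
  "qspan x y = span {x, y, cr x y}"

lemma span3_iff: "z \<in> span {x, y, w} \<longleftrightarrow> (\<exists>a b c. z = a *\<^sub>R x + b *\<^sub>R y + c *\<^sub>R (w::'a::real_vector))"
proof -
  have "z \<in> span {x, y, w} \<longleftrightarrow> (\<exists>a b c. z - a *\<^sub>R x - b *\<^sub>R y = c *\<^sub>R w)"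
    by (simp add: span_breakdown_eq span_empty) 
  then show ?thesis by (simp add: algebra_simps)
qed

lemma qspan_closed:
  assumes o: "x \<bullet> x = 1" "y \<bullet> y = 1" "x \<bullet> y = 0" and uv: "u \<in> qspan x y" "v \<in> qspan x y"
  shows "cr u v \<in> qspan x y"
proof -
  obtain a b c a' b' c' where u: "u = a *\<^sub>R x + b *\<^sub>R y + c *\<^sub>R cr x y"
    and v: "v = a' *\<^sub>R x + b' *\<^sub>R y + c' *\<^sub>R cr x y"
    using uv unfolding qspan_def span3_iff by blast
  have 1: "cr x (cr x y) = - y" using o by (simp add: cr_cr)
  have 2: "cr y (cr x y) = x"
    using o cr_cr[of y x] by (simp add: cr_swap[of y x] cr_minus inner_commute)
  have 3: "cr (cr x y) x = y" "cr (cr x y) y = - x" "cr y x = - cr x y"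
    using 1 2 by (simp_all add: cr_swap[of "cr x y"] cr_swap[of y x])
  have "cr u v = (b * c' - c * b') *\<^sub>R x + (c * a' - a * c') *\<^sub>R y + (a * b' - b * a') *\<^sub>R cr x y"
    by (simp add: u v cr_add cr_scaleR 1 2 3 algebra_simps)
  then show ?thesis unfolding qspan_def span3_iff by blast
qed

text \<open>Dimension count: \<open>u\<close>, \<open>v\<close>, \<open>cr u v\<close> are
  orthonormal and lie in \<open>qspan x y\<close>, whose dimension is at most 3.\<close>

lemma qspan_eq:
  assumes o: "x \<bullet> x = 1" "y \<bullet> y = 1" "x \<bullet> y = 0" and uv: "u \<in> qspan x y" "v \<in> qspan x y"
    and o': "u \<bullet> u = 1" "v \<bullet> v = 1" "u \<bullet> v = 0"
  shows "qspan u v = qspan x y"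
proof -
  have c: "cr u v \<bullet> cr u v = 1" using o' by (simp add: inner_cr_cr)
  have i: "u \<bullet> cr u v = 0" "v \<bullet> cr u v = 0" by simp_all
  have "u \<noteq> v" using o' by auto
  moreover have "u \<noteq> cr u v" using i(1) o'(1) by force
  moreover have "v \<noteq> cr u v" using i(2) o'(2) by force
  ultimately have card: "card {u, v, cr u v} = 3" by simp
  have "independent {u, v, cr u v}"
  proof (rule pairwise_orthogonal_independent)
    show "pairwise orthogonal {u, v, cr u v}"
      using o' by (auto simp: pairwise_def orthogonal_def inner_commute[of v u]
          inner_commute[of "cr u v" u] inner_commute[of "cr u v" v])
    show "0 \<notin> {u, v, cr u v}" using o' c by auto
  qed
  then have "dim (qspan u v) = card {u, v, cr u v}" by (simp add: qspan_def dim_eq_card_independent)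
  also note card
  finally have "dim (qspan u v) = 3" .
  moreover have "dim (qspan x y) \<le> 3"
    unfolding qspan_def by (rule order_trans[OF dim_le_card[of _ "{x, y, cr x y}"]]) (auto simp: card_insert_if)
  moreover have "qspan u v \<subseteq> qspan x y"
    unfolding qspan_def[of u v] using uv qspan_closed[OF o uv]
    by (intro span_minimal) (auto simp: qspan_def)
  ultimately show ?thesis
    by (intro subspace_dim_equal) (auto simp: qspan_def)
qed

lemma imH_qspan: "imH = qspan E1 E2"
proof -
  have "cr E1 E2 = E3" by (simp add: cr_def vec7_eq_iff)
  then show ?thesis
    unfolding qspan_def by (auto simp: set_eq_iff span3_iff imH_def vec7_eq_iff)
qed

text \<open>Two successive maximisations: \<open>p3\<close>, \<open>q3\<close> over all unit
  vectors, then \<open>p2\<close>, \<open>q2\<close> over the orthogonal complements. The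
  first-order conditions make the pairing diagonal. The third vectors are products, so the third
  singular value carries a sign; comparison with both \<open>q1\<close> and \<open>- q1\<close>
  bounds its absolute value.\<close>

lemma svd_frame:
  assumes o: "x \<bullet> x = 1" "y \<bullet> y = 1" "x \<bullet> y = 0"
  obtains p2 p3 q2 q3 where
    "p2 \<in> imH" "p3 \<in> imH" "p2 \<bullet> p2 = 1" "p3 \<bullet> p3 = 1" "p3 \<bullet> p2 = 0"
    "q2 \<in> qspan x y" "q3 \<in> qspan x y" "q2 \<bullet> q2 = 1" "q3 \<bullet> q3 = 1" "q2 \<bullet> q3 = 0"
    "p2 \<bullet> q3 = 0" "p3 \<bullet> q2 = 0" "cr p2 p3 \<bullet> q2 = 0" "cr p2 p3 \<bullet> q3 = 0"
    "p2 \<bullet> cr q2 q3 = 0" "p3 \<bullet> cr q2 q3 = 0"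
    "p2 \<bullet> q2 \<le> p3 \<bullet> q3" "\<bar>cr p2 p3 \<bullet> cr q2 q3\<bar> \<le> p2 \<bullet> q2"
proof -
  define V where "V = qspan x y"
  have V: "subspace V" "x \<in> V" "y \<in> V" "norm x = 1"
    using o by (auto simp: V_def qspan_def norm_eq_sqrt_inner intro: span_base)
  have crV: "cr u v \<in> V" if "u \<in> V" "v \<in> V" for u v using qspan_closed[OF o] that by (simp add: V_def)
  have U: "subspace imH" unfolding imH_qspan qspan_def by simp
  have crU: "cr u v \<in> imH" if "u \<in> imH" "v \<in> imH" for u v
    using that by (simp add: imH_def cr_def)
  have E: "E1 \<in> imH" "E2 \<in> imH" "norm E1 = 1" "E1 \<bullet> E1 = 1" "E2 \<bullet> E2 = 1" "E1 \<bullet> E2 = 0"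
    by (simp_all add: imH_def norm_eq_sqrt_inner inner_7)
  obtain p3 q3 where p3: "p3 \<in> imH" "norm p3 = 1" and q3: "q3 \<in> V" "norm q3 = 1"
    and max3: "\<And>x y. x \<in> imH \<Longrightarrow> norm x = 1 \<Longrightarrow> y \<in> V \<Longrightarrow> norm y = 1 \<Longrightarrow> x \<bullet> y \<le> p3 \<bullet> q3"
    using maximal_pair[OF U E(1,3) V(1,2,4)] by blast
  define U2 where "U2 = {u \<in> imH. u \<bullet> p3 = 0}"
  define V2 where "V2 = {v \<in> V. v \<bullet> q3 = 0}"
  have sub: "subspace U2" "subspace V2"
    using U V(1) by (auto simp: U2_def V2_def subspace_def inner_add_left)
  obtain u where u: "u \<in> U2" "norm u = 1"
    using orthogonal_in_plane[OF E(4,5,6) U E(1,2)] unfolding U2_def by blast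
  obtain v where v: "v \<in> V2" "norm v = 1"
    using orthogonal_in_plane[OF o V(1,2,3)] unfolding V2_def by blast
  obtain p2 q2 where p2: "p2 \<in> U2" "norm p2 = 1" and q2: "q2 \<in> V2" "norm q2 = 1"
    and max2: "\<And>x y. x \<in> U2 \<Longrightarrow> norm x = 1 \<Longrightarrow> y \<in> V2 \<Longrightarrow> norm y = 1 \<Longrightarrow> x \<bullet> y \<le> p2 \<bullet> q2"
    using maximal_pair[OF sub(1) u sub(2) v] by blast
  define p1 where "p1 = cr p2 p3"
  define q1 where "q1 = cr q2 q3"
  have ip: "p2 \<in> imH" "p2 \<bullet> p3 = 0" "p2 \<bullet> p2 = 1" "p3 \<bullet> p3 = 1"
    and iq: "q2 \<in> V" "q2 \<bullet> q3 = 0" "q2 \<bullet> q2 = 1" "q3 \<bullet> q3 = 1"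
    using p2 q2 p3 q3 by (auto simp: U2_def V2_def norm_eq_1)
  have p1: "p1 \<in> U2" "p1 \<bullet> p2 = 0" "norm p1 = 1"
    using ip p3 by (auto simp: p1_def U2_def crU norm_eq_1 inner_cr_cr)
  have q1: "q1 \<in> V2" "q1 \<bullet> q2 = 0" "norm q1 = 1"
    using iq q3 by (auto simp: q1_def V2_def crV norm_eq_1 inner_cr_cr)
  have A: "w \<bullet> q3 = 0" if "w \<in> U2" for w
    by (rule maximal_pair_critical[OF U p3]) (use that q3 max3 in \<open>auto simp: U2_def\<close>)
  have B: "w \<bullet> p3 = 0" if "w \<in> V2" for w
  proof (rule maximal_pair_critical[OF V(1) q3])
    show "x \<bullet> p3 \<le> q3 \<bullet> p3" if "x \<in> V" "norm x = 1" for x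
      using max3[OF p3 that] by (metis inner_commute)
  qed (use that in \<open>auto simp: V2_def\<close>)
  have C: "p1 \<bullet> q2 = 0"
    by (rule maximal_pair_critical[OF sub(1) p2 p1(1,2)]) (use q2 max2 in auto)
  have D: "q1 \<bullet> p2 = 0"
  proof (rule maximal_pair_critical[OF sub(2) q2 q1(1,2)])
    show "x \<bullet> p2 \<le> q2 \<bullet> p2" if "x \<in> V2" "norm x = 1" for x
      using max2[OF p2 that] by (metis inner_commute)
  qed
  have c32: "p2 \<bullet> q2 \<le> p3 \<bullet> q3" using p2 q2 by (intro max3) (auto simp: U2_def V2_def)
  have "p1 \<bullet> q1 \<le> p2 \<bullet> q2" using p1 q1 by (intro max2) auto
  moreover have "p1 \<bullet> (- q1) \<le> p2 \<bullet> q2" using p1 q1 sub by (intro max2) (auto intro: subspace_neg)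
  ultimately have c21: "\<bar>p1 \<bullet> q1\<bar> \<le> p2 \<bullet> q2" by simp
  show ?thesis
    by (rule that[of p2 p3 q2 q3])
      (use ip iq p3(1) q3(1) A[OF p2(1)] B[OF q2(1)] A[OF p1(1)] B[OF q1(1)] C D c32 c21 in
        \<open>simp_all add: V_def inner_commute p1_def q1_def\<close>)
qed

text \<open>\<open>u\<close> and its products with an orthonormal basis of \<open>imH\<close> form
  an orthonormal basis of \<open>imHp\<close>. The expansion is verified for \<open>E1\<close>,
  \<open>E2\<close>, \<open>E3\<close>, and then \<open>E2\<close>, \<open>E3\<close> are replaced
  by their normalised sum and difference.\<close>

lemma imHp_expansion:
  assumes u: "u \<in> imHp" "u \<bullet> u = 1" and n: "n \<in> imHp" and h: "h * h = 1 / 2"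
  shows "n = (n \<bullet> u) *\<^sub>R u + (n \<bullet> cr E1 u) *\<^sub>R cr E1 u + (n \<bullet> cr (vec7 0 h h 0 0 0 0) u) *\<^sub>R cr (vec7 0 h h 0 0 0 0) u
     + (n \<bullet> cr (vec7 0 h (-h) 0 0 0 0) u) *\<^sub>R cr (vec7 0 h (-h) 0 0 0 0) u"
proof -
  have "(u \<bullet> u) *\<^sub>R n = (n \<bullet> u) *\<^sub>R u + (n \<bullet> cr E1 u) *\<^sub>R cr E1 u + (n \<bullet> cr E2 u) *\<^sub>R cr E2 u
     + (n \<bullet> cr E3 u) *\<^sub>R cr E3 u"
    using u(1) n by (simp add: vec7_eq_iff inner_7 imHp_def cr_def algebra_simps)
  moreover have "vec7 0 h h 0 0 0 0 = h *\<^sub>R (E2 + E3)" "vec7 0 h (-h) 0 0 0 0 = h *\<^sub>R (E2 - E3)"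
    by (simp_all add: vec7_eq_iff)
  moreover have "(n \<bullet> (h *\<^sub>R (a + b))) *\<^sub>R (h *\<^sub>R (a + b)) + (n \<bullet> (h *\<^sub>R (a - b))) *\<^sub>R (h *\<^sub>R (a - b)) =
      (h * h * 2) *\<^sub>R ((n \<bullet> a) *\<^sub>R a + (n \<bullet> b) *\<^sub>R b)" for a b :: "real^7"
    by (simp add: inner_add_right inner_diff_right vec_eq_iff algebra_simps)
  ultimately show ?thesis using u(2) h by (simp add: cr_add cr_diff cr_scaleR add.assoc)
qed

section \<open>A frame of the imaginary quaternions adapted to the torus\<close>

definition rh :: real where "rh = sqrt (1 / 2)"

lemma rh: "rh > 0" "rh * rh = 1 / 2" "rh * (rh * x) = x / 2"
  by (simp_all add: rh_def flip: mult.assoc)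

text \<open>Products of \<open>m11\<close> and \<open>m5\<close> turn each of \<open>E1\<close>,
  \<open>F3\<close>, \<open>F1\<close> within the plane spanned by it and its product with
  \<open>E5\<close>, see \<open>torus_apply\<close>; these vectors therefore play the role of
  singular vectors.\<close>

definition F1 :: "real^7" where "F1 = vec7 0 rh (- rh) 0 0 0 0"
definition F3 :: "real^7" where "F3 = vec7 0 rh rh 0 0 0 0"

lemma F_inner: "F1 \<bullet> F1 = 1" "F3 \<bullet> F3 = 1" "F1 \<bullet> F3 = 0" "F3 \<bullet> F1 = 0" "E1 \<bullet> E1 = 1"
    "E1 \<bullet> F1 = 0" "E1 \<bullet> F3 = 0" "F1 \<bullet> E1 = 0" "F3 \<bullet> E1 = 0"
  by (simp_all add: F1_def F3_def inner_7 rh)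

lemma F_imH: "E1 \<in> imH" "F1 \<in> imH" "F3 \<in> imH"
  by (simp_all add: F1_def F3_def imH_def)

lemma F_cr: "cr F3 E1 = F1"
  by (simp add: F1_def F3_def cr_def vec7_eq_iff)

lemma imH_imHp_inner: "e \<in> imH \<Longrightarrow> v \<in> imHp \<Longrightarrow> e \<bullet> v = 0" "e \<in> imH \<Longrightarrow> v \<in> imHp \<Longrightarrow> v \<bullet> e = 0"
  by (simp_all add: imH_def imHp_def inner_7)

lemma imHp_iff: "v \<in> imHp \<longleftrightarrow> (\<forall>e \<in> imH. e \<bullet> v = 0)"
proof
  assume "\<forall>e \<in> imH. e \<bullet> v = 0"
  then have "E1 \<bullet> v = 0" "E2 \<bullet> v = 0" "E3 \<bullet> v = 0" by (simp_all add: imH_def)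
  then show "v \<in> imHp" by (simp add: imHp_def inner_7)
qed (simp add: imH_imHp_inner)

lemma cr_imH_imHp: "e \<in> imH \<Longrightarrow> v \<in> imHp \<Longrightarrow> cr e v \<in> imHp" "e \<in> imH \<Longrightarrow> v \<in> imHp \<Longrightarrow> cr v e \<in> imHp"
  "v \<in> imHp \<Longrightarrow> w \<in> imHp \<Longrightarrow> cr v w \<in> imH" "e \<in> imH \<Longrightarrow> f \<in> imH \<Longrightarrow> cr e f \<in> imH"
  by (simp_all add: imH_def imHp_def cr_def)

text \<open>For \<open>u\<close> orthogonal to the quaternions e(fu) = (fe)u: left multiplications
  compose in reversed order.\<close>

lemma cr_cr_imHp: "u \<in> imHp \<Longrightarrow> e \<in> imH \<Longrightarrow> f \<in> imH \<Longrightarrow> e \<bullet> f = 0 \<Longrightarrow> cr e (cr f u) = cr (cr f e) u"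
  by (simp add: imHp_def imH_def cr_def inner_7 vec7_eq_iff) (auto; algebra)

lemma triple_product: "cr x y \<bullet> z = y \<bullet> cr z x" "cr x y \<bullet> z = x \<bullet> cr y z"
  by (simp_all add: cr_def inner_7 algebra_simps)

lemma imHp_decompose:
  assumes "r \<bullet> F1 = 0" "r \<bullet> F3 = 0"
  shows "r - (r \<bullet> E1) *\<^sub>R E1 \<in> imHp"
  using assms rh(1) by (simp add: imHp_def F1_def F3_def inner_7 flip: distrib_right right_diff_distrib)

lemma imHp_decompose':
  assumes "r \<bullet> F1 = 0" "r \<bullet> E1 = 0"
  shows "r - (r \<bullet> F3) *\<^sub>R F3 \<in> imHp"
proof -
  have "r$2 = r$3" "r$1 = 0" using assms rh(1) by (simp_all add: F1_def inner_7)
  then show ?thesis using rh(2) by (simp add: imHp_def F3_def inner_7 algebra_simps rh)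
qed

text \<open>Let \<open>m\<close>, \<open>n\<close> be the components of \<open>r2\<close>,
  \<open>r3\<close> orthogonal to the quaternions. Unless it vanishes, \<open>m\<close> defines
  \<open>u\<close>; the vanishing entries of the pairing then force
  \<open>n = s *\<^sub>R cr E1 u\<close> with \<open>s\<close> equal to \<open>sin \<alpha>\<close>
  up to sign. The bound on the third singular value settles the sign and yields
  \<open>\<alpha> + 2 * \<beta> \<le> pi\<close>.\<close>

lemma angle_form:
  assumes r: "r2 \<bullet> r2 = 1" "r3 \<bullet> r3 = 1" "r2 \<bullet> r3 = 0"
    and z: "r3 \<bullet> F1 = 0" "r3 \<bullet> F3 = 0" "r2 \<bullet> F1 = 0" "r2 \<bullet> E1 = 0" "cr r2 r3 \<bullet> E1 = 0" "cr r2 r3 \<bullet> F3 = 0"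
    and c: "r2 \<bullet> F3 \<le> r3 \<bullet> E1" "\<bar>cr r2 r3 \<bullet> F1\<bar> \<le> r2 \<bullet> F3"
  obtains u \<alpha> \<beta> where "u \<in> imHp" "u \<bullet> u = 1" "0 \<le> \<alpha>" "\<alpha> \<le> \<beta>" "\<beta> \<le> pi / 2" "\<alpha> + 2 * \<beta> \<le> pi"
    "r3 = cos \<alpha> *\<^sub>R E1 - sin \<alpha> *\<^sub>R cr E1 u" "r2 = cos \<beta> *\<^sub>R F3 - sin \<beta> *\<^sub>R cr F3 u"
proof -
  define c2 where "c2 = r2 \<bullet> F3"
  define c3 where "c3 = r3 \<bullet> E1"
  define m where "m = r2 - c2 *\<^sub>R F3"
  define n where "n = r3 - c3 *\<^sub>R E1"
  have mn: "m \<in> imHp" "n \<in> imHp"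
    using imHp_decompose[OF z(1,2)] imHp_decompose'[OF z(3,4)] by (simp_all add: m_def n_def c2_def c3_def)
  have r2: "r2 = c2 *\<^sub>R F3 + m" and r3: "r3 = c3 *\<^sub>R E1 + n" by (simp_all add: m_def n_def)
  note ortho = imH_imHp_inner[OF F_imH(1) mn(1)] imH_imHp_inner[OF F_imH(2) mn(1)] imH_imHp_inner[OF F_imH(3) mn(1)]
    imH_imHp_inner[OF F_imH(1) mn(2)] imH_imHp_inner[OF F_imH(2) mn(2)] imH_imHp_inner[OF F_imH(3) mn(2)]
  have c2: "c2\<^sup>2 + m \<bullet> m = 1"
    using r(1) by (simp add: r2 inner_add_left inner_add_right F_inner ortho power2_eq_square)
  have c3: "c3\<^sup>2 + n \<bullet> n = 1"
    using r(2) by (simp add: r3 inner_add_left inner_add_right F_inner ortho power2_eq_square)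
  have c0: "0 \<le> c2" "c2 \<le> c3" using c by (simp_all add: c2_def c3_def)
  have "c3\<^sup>2 \<le> 1\<^sup>2" using c3 inner_ge_zero[of n] by (simp del: inner_ge_zero)
  then have c1: "c3 \<le> 1" by (rule power2_le_imp_le) simp
  define \<alpha> where "\<alpha> = arccos c3"
  define \<beta> where "\<beta> = arccos c2"
  have co: "cos \<alpha> = c3" "cos \<beta> = c2" using c0 c1 by (simp_all add: \<alpha>_def \<beta>_def)
  have \<alpha>\<beta>: "0 \<le> \<alpha>" "\<alpha> \<le> \<beta>" "\<beta> \<le> pi / 2"
    using c0 c1 arccos_lbound[of c3] arccos_le_pi2[of c2] by (auto simp: \<alpha>_def \<beta>_def intro: arccos_le_arccos)
  show ?thesis
  \<comment> \<open>If \<open>c2 = 1\<close>, both angles vanish and any unit vector of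
    \<open>imHp\<close> can be \<open>u\<close>; otherwise \<open>sin \<beta>\<close> is positive
    and can be divided by.\<close>
  proof (cases "c2 = 1")
    case True
    then have "c3 = 1" using c0 c1 by simp
    then have "m = 0" "n = 0" using c2 c3 True by simp_all
    moreover have "\<alpha> = 0" "\<beta> = 0" using True \<open>c3 = 1\<close> by (simp_all add: \<alpha>_def \<beta>_def)
    ultimately show ?thesis using that[of E5 0 0] r2 r3 True \<open>c3 = 1\<close>
      by (simp add: imHp_def inner_7)
  next
    case False
    then have "c2 < 1" using c0 c1 by simp
    then have "\<beta> \<noteq> 0" using co by force
    then have sb: "sin \<beta> > 0" using \<alpha>\<beta> by (intro sin_gt_zero) auto
    have sa: "sin \<alpha> \<ge> 0" using \<alpha>\<beta> by (intro sin_ge_zero) auto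
    have mm: "m \<bullet> m = (sin \<beta>)\<^sup>2" using c2 sin_cos_squared_add[of \<beta>] by (simp add: co)
    define u where "u = (1 / sin \<beta>) *\<^sub>R cr F3 m"
    have "cr F3 m \<in> imHp" using F_imH mn by (intro cr_imH_imHp)
    then have u: "u \<in> imHp" by (simp add: u_def imHp_def)
    have uu: "u \<bullet> u = 1"
      using sb by (simp add: u_def inner_cr_cr F_inner ortho mm power2_eq_square)
    have m: "m = - (sin \<beta> *\<^sub>R cr F3 u)"
      using sb by (simp add: u_def cr_scaleR cr_cr F_inner ortho)
    have mn0: "n \<bullet> m = 0"
      using r(3) by (simp add: r2 r3 inner_add_left inner_add_right F_inner ortho inner_commute[of n m])
    have cr23: "cr r2 r3 = (c2 * c3) *\<^sub>R F1 + c2 *\<^sub>R cr F3 n + c3 *\<^sub>R cr m E1 + cr m n"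
      by (simp add: r2 r3 cr_add cr_scaleR F_cr algebra_simps)
    have hp: "cr F3 n \<in> imHp" "cr m E1 \<in> imHp" using F_imH mn by (auto intro: cr_imH_imHp)
    have e: "cr m n \<bullet> E1 = 0" "cr m n \<bullet> F3 = 0"
      using z(5,6) hp F_imH by (simp_all add: cr23 inner_add_left F_inner imH_imHp_inner)
    have c1eq: "cr r2 r3 \<bullet> F1 = c2 * c3 + cr m n \<bullet> F1"
      using hp F_imH by (simp add: cr23 inner_add_left F_inner imH_imHp_inner)
    have nu: "n \<bullet> u = 0" using e(2) by (simp add: u_def triple_product(1))
    have nF3: "n \<bullet> cr F3 u = 0" using mn0 sb by (simp add: m)
    have "n \<bullet> cr E1 m = 0" using e(1) by (simp add: triple_product(1))
    then have nF1: "n \<bullet> cr F1 u = 0"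
      using sb by (simp add: m cr_minus cr_scaleR cr_cr_imHp u F_imH F_inner F_cr)
    define s where "s = n \<bullet> cr E1 u"
    have n: "n = s *\<^sub>R cr E1 u"
      using imHp_expansion[OF u uu mn(2) rh(2)] nu nF3 nF1 by (simp add: s_def flip: F1_def F3_def)
    have EE: "cr E1 u \<bullet> cr E1 u = 1"
      using u uu by (simp add: inner_cr_cr F_inner imH_imHp_inner F_imH)
    have s2: "s\<^sup>2 = (sin \<alpha>)\<^sup>2"
      using c3 sin_cos_squared_add[of \<alpha>] by (simp add: co n EE power2_eq_square)
    have "cr F1 F3 = - cr F3 F1" "cr F3 F1 = - E1"
      by (simp_all add: cr_def F1_def F3_def vec7_eq_iff rh)
    then have FF: "cr F1 (cr F3 u) = - cr E1 u"
      by (simp add: cr_cr_imHp u F_imH F_inner cr_minus)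
    have "cr m n \<bullet> F1 = n \<bullet> cr F1 m" by (rule triple_product)
    also have "\<dots> = sin \<beta> * s" by (simp add: m n cr_minus cr_scaleR FF EE)
    finally have c1': "cr r2 r3 \<bullet> F1 = cos \<alpha> * cos \<beta> + sin \<beta> * s" by (simp add: c1eq co)
    have bound: "\<bar>cos \<alpha> * cos \<beta> + sin \<beta> * s\<bar> \<le> cos \<beta>"
      using c(2) by (simp add: c1' co c2_def)
    have "s = - sin \<alpha> \<and> \<alpha> + 2 * \<beta> \<le> pi"
    \<comment> \<open>For \<open>s = - sin \<alpha>\<close> the third singular value is
      \<open>cos (\<alpha> + \<beta>)\<close>, and its lower bound \<open>- cos \<beta>\<close>
      gives the inequality. For \<open>s = sin \<alpha>\<close> it is
      \<open>cos (\<beta> - \<alpha>)\<close>, and the upper bound \<open>cos \<beta>\<close> forces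
      \<open>\<alpha> = 0\<close>, where both signs agree.\<close>
    proof (cases "s = - sin \<alpha>")
      case True
      then have "cos (pi - \<beta>) \<le> cos (\<alpha> + \<beta>)" using bound by (simp add: cos_add algebra_simps)
      then have "\<alpha> + \<beta> \<le> pi - \<beta>"
        using \<alpha>\<beta> by (subst (asm) cos_mono_le_eq) auto
      then show ?thesis using True by simp
    next
      case False
      then have s: "s = sin \<alpha>" using s2 by (simp add: power2_eq_iff)
      then have "cos (\<beta> - \<alpha>) \<le> cos \<beta>" using bound by (simp add: cos_diff algebra_simps)
      then have "\<beta> \<le> \<beta> - \<alpha>" using \<alpha>\<beta> by (subst (asm) cos_mono_le_eq) auto
      then have "\<alpha> = 0" using \<alpha>\<beta> by simp
      then show ?thesis using s False by simp
    qed
    then show ?thesis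
      using that[OF u uu \<alpha>\<beta>] r2 r3 by (simp add: co m n)
  qed
qed

section \<open>The coordinate map on the adapted frame\<close>

definition Phi :: "real^8 \<Rightarrow> real^7^7" where
  "Phi a = euler_\<sigma> (a $ 1) (a $ 2) (a $ 3) ** euler_s (a $ 4) (a $ 5) (a $ 6) ** m11 (a $ 7) ** m5 (a $ 8)"

lemma coord_map_eq: "coord_map a = Phi a <#\<^bsub>G2\<^esub> SO4"
  by (simp add: coord_map_def Phi_def m11_def m5_def)

lemma Phi_G2: "Phi a \<in> carrier G2"
  unfolding Phi_def by (intro G2_mult euler_G2 m_G2)

lemma Phi_apply: "Phi a *v v = euler_\<sigma> (a $ 1) (a $ 2) (a $ 3) *v (euler_s (a $ 4) (a $ 5) (a $ 6) *v (m11 (a $ 7) *v (m5 (a $ 8) *v v)))"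
  by (simp add: Phi_def flip: matrix_vector_mul_assoc)

lemma exhaust_8:
  fixes x :: 8
  shows "x = 1 \<or> x = 2 \<or> x = 3 \<or> x = 4 \<or> x = 5 \<or> x = 6 \<or> x = 7 \<or> x = 8"
proof (induct x)
  case (of_int z)
  then have "z = 0 \<or> z = 1 \<or> z = 2 \<or> z = 3 \<or> z = 4 \<or> z = 5 \<or> z = 6 \<or> z = 7" by fastforce
  then show ?case by auto
qed

lemma forall_8: "(\<forall>i::8. P i) \<longleftrightarrow> P 1 \<and> P 2 \<and> P 3 \<and> P 4 \<and> P 5 \<and> P 6 \<and> P 7 \<and> P 8"
  by (metis exhaust_8)

lemma vec8_exists:
  obtains a :: "real^8" where "a $ 1 = x1" "a $ 2 = x2" "a $ 3 = x3" "a $ 4 = x4"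
    "a $ 5 = x5" "a $ 6 = x6" "a $ 7 = x7" "a $ 8 = x8"
proof -
  define a :: "real^8" where "a = (\<chi> i. if i = 1 then x1 else if i = 2 then x2 else if i = 3 then x3
     else if i = 4 then x4 else if i = 5 then x5 else if i = 6 then x6 else if i = 7 then x7 else x8)"
  show ?thesis by (rule that[of a]) (simp_all add: a_def)
qed

text \<open>Left multiplication by \<open>i\<close> on the quaternions \<open>y\<close> of \<open>x + y e\<^sub>4\<close>. It commutes with
  \<open>euler_\<sigma>\<close>, and for \<open>w\<close> in the orthogonal complement of the quaternions the number
  \<open>left_i w \<bullet> cr E1 w\<close> is the difference of the squared norms of the two complex coordinates of \<open>w\<close>;
  its sign selects the range \<open>[0, pi/4]\<close> of the fifth angle.\<close>

definition left_i :: "real^7 \<Rightarrow> real^7" where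
  "left_i v = vec7 0 0 0 (- v$5) (v$4) (- v$7) (v$6)"

lemma left_i_sigma: "left_i (euler_\<sigma> x y z *v v) = euler_\<sigma> x y z *v left_i v"
  by (simp add: euler_\<sigma>_eq m_apply left_i_def vec7_eq_iff algebra_simps flip: matrix_vector_mul_assoc)

lemma left_i_cr_E1: "v \<in> imHp \<Longrightarrow> left_i v \<bullet> cr E1 v = (v$4)\<^sup>2 + (v$5)\<^sup>2 - (v$6)\<^sup>2 - (v$7)\<^sup>2"
  by (simp add: left_i_def cr_def inner_7 imHp_def power2_eq_square)

lemma torus_apply:
  "m11 s *v (m5 t *v E1) = cos (2 * s) *\<^sub>R E1 - sin (2 * s) *\<^sub>R cr E1 E5"
  "m11 s *v (m5 t *v F3) = cos (t - s) *\<^sub>R F3 - sin (t - s) *\<^sub>R cr F3 E5"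
  "m11 s *v (m5 t *v F1) = cos (t + s) *\<^sub>R F1 + sin (t + s) *\<^sub>R cr F1 E5"
  by (simp_all add: m_apply vec7_eq_iff cr_def F1_def F3_def cos_diff sin_diff cos_add sin_add algebra_simps)

text \<open>\<open>euler_s\<close> fixes \<open>imH\<close> pointwise, so it enters through the
  image \<open>u\<close> of \<open>E5\<close>. The result has the form p (cos t + u sin t) with
  angles \<open>- 2 * a$7\<close>, \<open>a$7 - a$8\<close>, \<open>a$8 + a$7\<close>, whose sum is
  zero.\<close>

lemma Phi_frame:
  fixes a :: "real^8"
  defines "\<sigma> \<equiv> euler_\<sigma> (a $ 1) (a $ 2) (a $ 3)" and "u \<equiv> euler_\<sigma> (a $ 1) (a $ 2) (a $ 3) *v (euler_s (a $ 4) (a $ 5) (a $ 6) *v E5)"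
  shows "Phi a *v E1 = cos (2 * a$7) *\<^sub>R (\<sigma> *v E1) - sin (2 * a$7) *\<^sub>R cr (\<sigma> *v E1) u"
    and "Phi a *v F3 = cos (a$8 - a$7) *\<^sub>R (\<sigma> *v F3) - sin (a$8 - a$7) *\<^sub>R cr (\<sigma> *v F3) u"
    and "Phi a *v F1 = cos (a$8 + a$7) *\<^sub>R (\<sigma> *v F1) + sin (a$8 + a$7) *\<^sub>R cr (\<sigma> *v F1) u"
  unfolding Phi_apply torus_apply u_def \<sigma>_def
  by (simp_all only: matrix_vector_right_distrib matrix_vector_mult_diff_distrib matrix_vector_mult_scaleR
      G2_cr euler_G2 s_imH F_imH)

text \<open>\<open>m8 (pi / 2)\<close> fixes \<open>E1\<close> and negates \<open>F3\<close>;
  halving the range of \<open>z\<close> therefore costs a sign \<open>\<delta>\<close>.\<close>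

lemma sigma_exists_reduced:
  assumes p: "p \<in> imH" "p \<bullet> p = 1" and q: "q \<in> imH" "q \<bullet> q = 1" and pq: "p \<bullet> q = 0"
  obtains x y z and \<delta> :: real where "0 \<le> x" "x \<le> pi" "0 \<le> y" "y \<le> pi / 2" "0 \<le> z" "z \<le> pi / 2"
    "\<delta> = 1 \<or> \<delta> = -1" "euler_\<sigma> x y z *v E1 = p" "euler_\<sigma> x y z *v F3 = \<delta> *\<^sub>R q"
proof -
  have "rh\<^sup>2 + rh\<^sup>2 = 1" by (simp add: power2_eq_square rh)
  then obtain x y z where xyz: "0 \<le> x" "x \<le> pi" "0 \<le> y" "y \<le> pi / 2" "0 \<le> z" "z < pi"
    "euler_\<sigma> x y z *v E1 = p" "euler_\<sigma> x y z *v F3 = q"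
    unfolding F3_def using sigma_exists[OF p q pq] by blast
  show ?thesis
  proof (cases "z \<le> pi / 2")
    case True
    then show ?thesis using that[of x y z 1] xyz by simp
  next
    case False
    have eq: "euler_\<sigma> x y z *v v = euler_\<sigma> x y (z - pi / 2) *v (m8 (pi / 2) *v v)" for v
      by (simp add: euler_\<sigma>_eq m89_add flip: matrix_vector_mul_assoc)
    have m: "m8 (pi / 2) *v E1 = E1" "m8 (pi / 2) *v F3 = (- 1) *\<^sub>R F3"
      by (simp_all add: m_apply F3_def vec7_eq_iff)
    have "- (euler_\<sigma> x y (z - pi / 2) *v F3) = q" using xyz(8) unfolding eq m matrix_vector_mult_scaleR by simp
    then have "euler_\<sigma> x y (z - pi / 2) *v F3 = - q" by (metis minus_minus)
    moreover have "euler_\<sigma> x y (z - pi / 2) *v E1 = p" using xyz(7) by (simp add: eq m)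
    ultimately show ?thesis using that[of x y "z - pi / 2" "-1"] xyz False by simp
  qed
qed

text \<open>An element \<open>N\<close> of G2 carries \<open>E1\<close>, \<open>F3\<close> to the
  singular vectors \<open>p3\<close>, \<open>p2\<close>; the angles are read off after undoing
  \<open>N\<close>. Sign changes of singular vectors leave the subalgebra unchanged, and
  \<open>\<epsilon>\<close>, \<open>\<delta>\<close> record those that bring the fifth and third
  coordinate into their ranges.\<close>

lemma coordinates_exist:
  assumes o: "x \<bullet> x = 1" "y \<bullet> y = 1" "x \<bullet> y = 0"
  obtains a where "a \<in> R'" "x \<in> (*v) (Phi a) ` imH" "y \<in> (*v) (Phi a) ` imH"
proof -
  obtain p2 p3 q2 q3 where
    p: "p2 \<in> imH" "p3 \<in> imH" "p2 \<bullet> p2 = 1" "p3 \<bullet> p3 = 1" "p3 \<bullet> p2 = 0" and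
    q: "q2 \<in> qspan x y" "q3 \<in> qspan x y" "q2 \<bullet> q2 = 1" "q3 \<bullet> q3 = 1" "q2 \<bullet> q3 = 0" and
    c: "p2 \<bullet> q3 = 0" "p3 \<bullet> q2 = 0" "cr p2 p3 \<bullet> q2 = 0" "cr p2 p3 \<bullet> q3 = 0"
    "p2 \<bullet> cr q2 q3 = 0" "p3 \<bullet> cr q2 q3 = 0"
    "p2 \<bullet> q2 \<le> p3 \<bullet> q3" "\<bar>cr p2 p3 \<bullet> cr q2 q3\<bar> \<le> p2 \<bullet> q2"
    using o by (rule svd_frame)
  have "rh\<^sup>2 + rh\<^sup>2 = 1" by (simp add: power2_eq_square rh)
  then obtain x0 y0 z0 where "euler_\<sigma> x0 y0 z0 *v E1 = p3" "euler_\<sigma> x0 y0 z0 *v F3 = p2"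
    unfolding F3_def using sigma_exists[OF p(2,4,1,3,5)] by blast
  then obtain N where N: "N \<in> carrier G2" "N *v E1 = p3" "N *v F3 = p2" "\<And>v. v \<in> imHp \<Longrightarrow> N *v v \<in> imHp"
    using sigma_imHp euler_G2 by blast
  have NF1: "N *v F1 = cr p2 p3" using N by (simp add: G2_cr flip: F_cr)
  define r2 where "r2 = transpose N *v q2"
  define r3 where "r3 = transpose N *v q3"
  have Nr: "N *v r2 = q2" "N *v r3 = q3" by (simp_all only: r2_def r3_def G2_transpose_mult N)
  then have Nc: "N *v cr r2 r3 = cr q2 q3" by (simp add: G2_cr N)
  have i: "r2 \<bullet> v = q2 \<bullet> (N *v v)" "r3 \<bullet> v = q3 \<bullet> (N *v v)" "cr r2 r3 \<bullet> v = cr q2 q3 \<bullet> (N *v v)" for v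
    by (metis G2_inner N(1) Nr Nc)+
  have "r2 \<bullet> r2 = 1" "r3 \<bullet> r3 = 1" "r2 \<bullet> r3 = 0"
    "r3 \<bullet> F1 = 0" "r3 \<bullet> F3 = 0" "r2 \<bullet> F1 = 0" "r2 \<bullet> E1 = 0" "cr r2 r3 \<bullet> E1 = 0" "cr r2 r3 \<bullet> F3 = 0"
    "r2 \<bullet> F3 \<le> r3 \<bullet> E1" "\<bar>cr r2 r3 \<bullet> F1\<bar> \<le> r2 \<bullet> F3"
    unfolding i Nr NF1 N(2,3) using q c by (simp_all add: inner_commute)
  then obtain u' \<alpha> \<beta> where u': "u' \<in> imHp" "u' \<bullet> u' = 1" and \<alpha>\<beta>: "0 \<le> \<alpha>" "\<alpha> \<le> \<beta>" "\<beta> \<le> pi / 2" "\<alpha> + 2 * \<beta> \<le> pi"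
    and r: "r3 = cos \<alpha> *\<^sub>R E1 - sin \<alpha> *\<^sub>R cr E1 u'" "r2 = cos \<beta> *\<^sub>R F3 - sin \<beta> *\<^sub>R cr F3 u'"
    by (rule angle_form)
  define u where "u = N *v u'"
  have u: "u \<in> imHp" "u \<bullet> u = 1" using u' N by (simp_all add: u_def G2_inner)
  have q32: "q3 = cos \<alpha> *\<^sub>R p3 - sin \<alpha> *\<^sub>R cr p3 u" "q2 = cos \<beta> *\<^sub>R p2 - sin \<beta> *\<^sub>R cr p2 u"
    unfolding Nr[symmetric] u_def r
    by (simp_all only: matrix_vector_mult_diff_distrib matrix_vector_mult_scaleR G2_cr N)
  \<comment> \<open>Negating \<open>p3\<close> changes the sign of
    \<open>left_i u \<bullet> cr p3 u\<close>; its nonnegativity keeps the fifth angle at most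
    \<open>pi / 4\<close>.\<close>
  define \<epsilon> :: real where "\<epsilon> = (if left_i u \<bullet> cr p3 u \<ge> 0 then 1 else -1)"
  have \<epsilon>: "\<epsilon> * \<epsilon> = 1" "left_i u \<bullet> cr (\<epsilon> *\<^sub>R p3) u \<ge> 0"
    by (simp_all add: \<epsilon>_def cr_scaleR cr_minus)
  have "\<epsilon> *\<^sub>R p3 \<in> imH" "(\<epsilon> *\<^sub>R p3) \<bullet> (\<epsilon> *\<^sub>R p3) = 1" "(\<epsilon> *\<^sub>R p3) \<bullet> p2 = 0"
    using p \<epsilon> by (simp_all add: imH_def)
  then obtain a1 a2 a3 and \<delta> :: real where a123: "0 \<le> a1" "a1 \<le> pi" "0 \<le> a2" "a2 \<le> pi / 2" "0 \<le> a3" "a3 \<le> pi / 2"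
    and \<delta>: "\<delta> = 1 \<or> \<delta> = -1" and \<sigma>: "euler_\<sigma> a1 a2 a3 *v E1 = \<epsilon> *\<^sub>R p3" "euler_\<sigma> a1 a2 a3 *v F3 = \<delta> *\<^sub>R p2"
    using sigma_exists_reduced[of "\<epsilon> *\<^sub>R p3" p2] p by metis
  define S where "S = euler_\<sigma> a1 a2 a3"
  have S: "S \<in> carrier G2" by (simp add: S_def euler_G2)
  define w where "w = transpose S *v u"
  have Sw: "S *v w = u" by (simp only: w_def G2_transpose_mult S)
  have w: "w \<bullet> w = 1" using G2_inner[OF S, of w w] u by (simp add: Sw)
  have "e \<bullet> w = 0" if "e \<in> imH" for e
    using G2_inner[OF S, of e w] sigma_imH[OF that, of a1 a2 a3] u(1)
    by (simp add: Sw imH_imHp_inner flip: S_def)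
  then have wp: "w \<in> imHp" by (simp add: imHp_iff)
  have "left_i w \<bullet> cr E1 w = (S *v left_i w) \<bullet> (S *v cr E1 w)" by (simp add: G2_inner S)
  also have "\<dots> = left_i u \<bullet> cr (\<epsilon> *\<^sub>R p3) u"
    using \<sigma> Sw by (simp add: G2_cr euler_G2 S_def flip: left_i_sigma)
  finally have "(w$6)\<^sup>2 + (w$7)\<^sup>2 \<le> (w$4)\<^sup>2 + (w$5)\<^sup>2"
    using \<epsilon>(2) left_i_cr_E1[OF wp] by simp
  then obtain a4 a5 a6 where a456: "0 \<le> a4" "a4 \<le> 2 * pi" "0 \<le> a5" "a5 \<le> pi / 4" "0 \<le> a6" "a6 \<le> pi"
    and s: "euler_s a4 a5 a6 *v E5 = w"
    using s_exists[OF wp w] by metis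
  \<comment> \<open>The angles in \<open>Phi_frame\<close> become \<open>2 * a$7 = \<alpha>\<close>
    and \<open>a$8 - a$7 = \<beta>\<close>. Then \<open>\<alpha> \<le> \<beta>\<close> is
    \<open>3 * a$7 \<le> a$8\<close>, and \<open>\<alpha> + 2 * \<beta> \<le> pi\<close> is
    \<open>a$8 \<le> pi / 2\<close>; together they give \<open>a$7 \<le> pi / 6\<close>.\<close>
  obtain a :: "real^8" where a: "a$1 = a1" "a$2 = a2" "a$3 = a3" "a$4 = a4" "a$5 = a5" "a$6 = a6"
    "a$7 = \<alpha> / 2" "a$8 = \<beta> + \<alpha> / 2"
    by (rule vec8_exists)
  have aR: "a \<in> R'"
    using a123 a456 \<alpha>\<beta> by (simp add: R'_def a)
  have "Phi a *v E1 = \<epsilon> *\<^sub>R q3" "Phi a *v F3 = \<delta> *\<^sub>R q2"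
    unfolding Phi_frame a s \<sigma> Sw[unfolded S_def] q32 by (simp_all add: cr_scaleR algebra_simps)
  then have "Phi a *v (\<epsilon> *\<^sub>R E1) = q3" "Phi a *v (\<delta> *\<^sub>R F3) = q2"
    using \<epsilon>(1) \<delta> by (auto simp: matrix_vector_mult_scaleR)
  moreover define e3 where "e3 = \<epsilon> *\<^sub>R E1"
  moreover define e2 where "e2 = \<delta> *\<^sub>R F3"
  ultimately have e: "Phi a *v e3 = q3" "Phi a *v e2 = q2" "e3 \<in> imH" "e2 \<in> imH"
    using F_imH by (simp_all add: imH_def)
  have "z \<in> (*v) (Phi a) ` imH" if "z \<in> qspan x y" for z
  proof -
    have "z \<in> qspan q2 q3" using that qspan_eq[OF o q] by simp
    then obtain b c d where "z = b *\<^sub>R q2 + c *\<^sub>R q3 + d *\<^sub>R cr q2 q3" unfolding qspan_def span3_iff by blast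
    then have "z = Phi a *v (b *\<^sub>R e2 + c *\<^sub>R e3 + d *\<^sub>R cr e2 e3)"
      by (simp add: e G2_cr Phi_G2 matrix_vector_right_distrib matrix_vector_mult_scaleR)
    moreover have "b *\<^sub>R e2 + c *\<^sub>R e3 + d *\<^sub>R cr e2 e3 \<in> imH"
      using e(3,4) cr_imH_imHp(4)[OF e(4,3)] by (simp add: imH_def)
    ultimately show ?thesis by blast
  qed
  then show ?thesis using that[OF aR] by (simp add: qspan_def span_base)
qed

lemma coord_map_surj:
  assumes "g \<in> carrier G2"
  obtains a where "a \<in> R'" "coord_map a = g <#\<^bsub>G2\<^esub> SO4"
proof -
  have "(g *v E1) \<bullet> (g *v E1) = 1" "(g *v E2) \<bullet> (g *v E2) = 1" "(g *v E1) \<bullet> (g *v E2) = 0"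
    unfolding G2_inner[OF assms] by (simp_all add: inner_7)
  then obtain a where a: "a \<in> R'" "g *v E1 \<in> (*v) (Phi a) ` imH" "g *v E2 \<in> (*v) (Phi a) ` imH"
    by (rule coordinates_exist)
  have "transpose (Phi a) *v (g *v E1) \<in> imH" "transpose (Phi a) *v (g *v E2) \<in> imH"
    using a(2,3) G2_transpose_mult(1)[OF Phi_G2, of a] by (auto simp del: transpose_matrix_vector)
  then have "(transpose (Phi a) ** g) *v E1 \<in> imH" "(transpose (Phi a) ** g) *v E2 \<in> imH"
    by (simp_all only: matrix_vector_mul_assoc)
  then have "transpose (Phi a) ** g \<in> SO4"
    using G2_agree[of "transpose (Phi a) ** g"] euler_in_SO4 assms Phi_G2 by (metis G2_mult G2_transpose)
  then show ?thesis using that[OF a(1)] coset_eq_iff(1)[OF Phi_G2 assms] by (simp add: coord_map_eq)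
qed

section \<open>Injectivity inside the parameter domain\<close>

text \<open>Its complement in \<open>R'\<close> is the exceptional null set.\<close>

definition R_open :: "(real^8) set" where
  "R_open = {a. 0 < a $ 1 \<and> a $ 1 < pi \<and> 0 < a $ 2 \<and> a $ 2 < pi / 2 \<and>
            0 < a $ 3 \<and> a $ 3 < pi / 2 \<and> 0 < a $ 4 \<and> a $ 4 < 2 * pi \<and>
            0 < a $ 5 \<and> a $ 5 < pi / 4 \<and> 0 < a $ 6 \<and> a $ 6 < pi \<and>
            0 < a $ 7 \<and> a $ 7 < pi / 6 \<and> 3 * a $ 7 < a $ 8 \<and> a $ 8 < pi / 2}"

section \<open>Singular values recovered from the coordinate matrix\<close>

definition pH :: "real^7 \<Rightarrow> real^7" where
  "pH v = vec7 (v$1) (v$2) (v$3) 0 0 0 0"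

lemma pH_imH: "v \<in> imH \<Longrightarrow> pH v = v" and pH_imHp: "v \<in> imHp \<Longrightarrow> pH v = 0"
  and pH_add: "pH (v + w) = pH v + pH w" and pH_diff: "pH (v - w) = pH v - pH w"
  and pH_scaleR: "pH (c *\<^sub>R v) = c *\<^sub>R pH v"
  by (simp_all add: pH_def imH_def imHp_def vec7_eq_iff)

text \<open>The unit vector \<open>u\<close> orthogonal to the quaternions that occurs in
  \<open>Phi_frame\<close>.\<close>

definition shift :: "real^8 \<Rightarrow> real^7" where
  "shift a = euler_\<sigma> (a $ 1) (a $ 2) (a $ 3) *v (euler_s (a $ 4) (a $ 5) (a $ 6) *v E5)"

definition sig :: "real^8 \<Rightarrow> real^7^7" where
  "sig a = euler_\<sigma> (a $ 1) (a $ 2) (a $ 3)"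

lemma sig_G2: "sig a \<in> carrier G2" by (simp add: sig_def euler_G2)

lemma sig_imH: "v \<in> imH \<Longrightarrow> sig a *v v \<in> imH" by (simp add: sig_def sigma_imH)

lemma shift_imHp: "shift a \<in> imHp"
proof -
  have "E5 \<in> imHp" by (simp add: imHp_def)
  then show ?thesis unfolding shift_def by (intro sigma_imHp s_imHp)
qed

lemma Phi_frame':
  "Phi a *v E1 = cos (2 * a$7) *\<^sub>R (sig a *v E1) - sin (2 * a$7) *\<^sub>R cr (sig a *v E1) (shift a)"
  "Phi a *v F3 = cos (a$8 - a$7) *\<^sub>R (sig a *v F3) - sin (a$8 - a$7) *\<^sub>R cr (sig a *v F3) (shift a)"
  "Phi a *v F1 = cos (a$8 + a$7) *\<^sub>R (sig a *v F1) + sin (a$8 + a$7) *\<^sub>R cr (sig a *v F1) (shift a)"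
  unfolding sig_def shift_def by (rule Phi_frame)+

lemma pH_Phi:
  "pH (Phi a *v E1) = cos (2 * a$7) *\<^sub>R (sig a *v E1)"
  "pH (Phi a *v F3) = cos (a$8 - a$7) *\<^sub>R (sig a *v F3)"
  "pH (Phi a *v F1) = cos (a$8 + a$7) *\<^sub>R (sig a *v F1)"
  unfolding Phi_frame'
  by (simp_all add: pH_add pH_diff pH_scaleR pH_imH pH_imHp sig_imH F_imH cr_imH_imHp shift_imHp)

lemma imH_frame:
  assumes "v \<in> imH"
  shows "v = (v \<bullet> E1) *\<^sub>R E1 + (v \<bullet> F3) *\<^sub>R F3 + (v \<bullet> F1) *\<^sub>R F1"
  using assms rh by (simp add: vec7_eq_iff imH_def F1_def F3_def inner_7 algebra_simps)

text \<open>A quadratic form on \<open>imH\<close> with eigenvectors \<open>E1\<close>,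
  \<open>F3\<close>, \<open>F1\<close>; its eigenvalues are the squared singular values.\<close>

lemma pH_Phi_norm:
  assumes "v \<in> imH"
  shows "pH (Phi a *v v) \<bullet> pH (Phi a *v v) = (cos (2 * a$7))\<^sup>2 * (v \<bullet> E1)\<^sup>2 +
    (cos (a$8 - a$7))\<^sup>2 * (v \<bullet> F3)\<^sup>2 + (cos (a$8 + a$7))\<^sup>2 * (v \<bullet> F1)\<^sup>2"
proof -
  define x y z where "x = v \<bullet> E1" and "y = v \<bullet> F3" and "z = v \<bullet> F1"
  have v: "v = x *\<^sub>R E1 + y *\<^sub>R F3 + z *\<^sub>R F1" using imH_frame[OF assms] by (simp add: x_def y_def z_def)
  show ?thesis
    unfolding x_def[symmetric] y_def[symmetric] z_def[symmetric] unfolding v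
    by (simp add: matrix_vector_right_distrib matrix_vector_mult_scaleR pH_add pH_scaleR pH_Phi
        inner_add_left inner_add_right G2_inner sig_G2 F_inner power2_eq_square)
qed

lemma imH_parseval:
  assumes "v \<in> imH"
  shows "v \<bullet> v = (v \<bullet> E1)\<^sup>2 + (v \<bullet> F3)\<^sup>2 + (v \<bullet> F1)\<^sup>2"
proof -
  define x y z where "x = v \<bullet> E1" and "y = v \<bullet> F3" and "z = v \<bullet> F1"
  have v: "v = x *\<^sub>R E1 + y *\<^sub>R F3 + z *\<^sub>R F1" using imH_frame[OF assms] by (simp add: x_def y_def z_def)
  show ?thesis
    unfolding x_def[symmetric] y_def[symmetric] z_def[symmetric] unfolding v
    by (simp add: inner_add_left inner_add_right F_inner power2_eq_square)
qed

lemma R_open_cos: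
  assumes "a \<in> R_open"
  shows "(cos (a$8 + a$7))\<^sup>2 < (cos (a$8 - a$7))\<^sup>2" "(cos (a$8 - a$7))\<^sup>2 < (cos (2 * a$7))\<^sup>2"
    "0 < cos (a$8 - a$7)" "0 < cos (2 * a$7)" "0 < sin (2 * a$7)"
proof -
  have a: "0 < a$7" "3 * a$7 < a$8" "a$8 < pi / 2" using assms by (auto simp: R_open_def)
  then show p: "0 < cos (a$8 - a$7)" "0 < cos (2 * a$7)" "0 < sin (2 * a$7)"
    by (auto intro!: cos_gt_zero_pi sin_gt_zero)
  have "cos (a$8 - a$7) < cos (2 * a$7)" using a by (intro cos_monotone_0_pi) auto
  then show "(cos (a$8 - a$7))\<^sup>2 < (cos (2 * a$7))\<^sup>2" using p by (intro power_strict_mono) auto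
  have "cos (a$8 + a$7) < cos (a$8 - a$7)" using a by (intro cos_monotone_0_pi) auto
  \<comment> \<open>\<open>a$8 + a$7\<close> may exceed \<open>pi / 2\<close> and its cosine be
    negative; the reflected angle supplies the lower bound \<open>- cos (a$8 - a$7)\<close>.\<close>
  moreover have "cos (pi - (a$8 - a$7)) < cos (a$8 + a$7)" using a by (intro cos_monotone_0_pi) auto
  ultimately have "\<bar>cos (a$8 + a$7)\<bar> < \<bar>cos (a$8 - a$7)\<bar>" by simp
  then show "(cos (a$8 + a$7))\<^sup>2 < (cos (a$8 - a$7))\<^sup>2" by (metis abs_le_square_iff not_le)
qed

section \<open>Comparison of two parameter points in the same coset\<close>

lemma weighted_max:
  fixes A B C x y z :: real
  assumes "C < B" "B < A" "x\<^sup>2 + y\<^sup>2 + z\<^sup>2 = 1"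
  shows "A * x\<^sup>2 + B * y\<^sup>2 + C * z\<^sup>2 \<le> A" and "A * x\<^sup>2 + B * y\<^sup>2 + C * z\<^sup>2 = A \<Longrightarrow> y = 0 \<and> z = 0"
proof -
  have e: "A - (A * x\<^sup>2 + B * y\<^sup>2 + C * z\<^sup>2) = (A - B) * y\<^sup>2 + (A - C) * z\<^sup>2"
    using assms(3) by algebra
  have n: "0 \<le> (A - B) * y\<^sup>2" "0 \<le> (A - C) * z\<^sup>2" using assms by simp_all
  show "A * x\<^sup>2 + B * y\<^sup>2 + C * z\<^sup>2 \<le> A" using e n by linarith
  assume "A * x\<^sup>2 + B * y\<^sup>2 + C * z\<^sup>2 = A"
  then have "(A - B) * y\<^sup>2 = 0" "(A - C) * z\<^sup>2 = 0" using e n by linarith+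
  then show "y = 0 \<and> z = 0" using assms by auto
qed

lemma weighted_max':
  fixes B C y z :: real
  assumes "C < B" "y\<^sup>2 + z\<^sup>2 = 1"
  shows "B * y\<^sup>2 + C * z\<^sup>2 \<le> B" and "B * y\<^sup>2 + C * z\<^sup>2 = B \<Longrightarrow> z = 0"
proof -
  have e: "B - (B * y\<^sup>2 + C * z\<^sup>2) = (B - C) * z\<^sup>2"
    using assms(2) by algebra
  have n: "0 \<le> (B - C) * z\<^sup>2" using assms by simp
  show "B * y\<^sup>2 + C * z\<^sup>2 \<le> B" using e n by linarith
  assume "B * y\<^sup>2 + C * z\<^sup>2 = B"
  then have "(B - C) * z\<^sup>2 = 0" using e n by linarith
  then show "z = 0" using assms by auto
qed

text \<open>\<open>M\<close> is the transition between two representatives of one coset. Exchanging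
  the points and transposing \<open>M\<close> preserves the relation, which turns inequalities
  between singular values into equalities.\<close>

definition related :: "real^8 \<Rightarrow> real^8 \<Rightarrow> real^7^7 \<Rightarrow> bool" where
  "related a b M \<longleftrightarrow> a \<in> R_open \<and> b \<in> R_open \<and> M \<in> SO4 \<and> Phi b = Phi a ** M"

lemma related_sym:
  assumes "related a b M"
  shows "related b a (transpose M)"
proof -
  have M: "M \<in> SO4" "Phi b = Phi a ** M" using assms by (auto simp: related_def)
  then have "Phi b ** transpose M = Phi a"
    using G2_orthogonal[of M] by (simp add: SO4_iff flip: matrix_mul_assoc)
  then show ?thesis using assms M SO4_transpose by (auto simp: related_def)
qed

lemma related_cos:
  assumes "related a b M" "v \<in> imH"
  shows "M *v v \<in> imH" "(M *v v) \<bullet> (M *v w) = v \<bullet> w"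
    "(cos (2 * a$7))\<^sup>2 * ((M *v v) \<bullet> E1)\<^sup>2 + (cos (a$8 - a$7))\<^sup>2 * ((M *v v) \<bullet> F3)\<^sup>2 + (cos (a$8 + a$7))\<^sup>2 * ((M *v v) \<bullet> F1)\<^sup>2
     = (cos (2 * b$7))\<^sup>2 * (v \<bullet> E1)\<^sup>2 + (cos (b$8 - b$7))\<^sup>2 * (v \<bullet> F3)\<^sup>2 + (cos (b$8 + b$7))\<^sup>2 * (v \<bullet> F1)\<^sup>2"
proof -
  have M: "M \<in> SO4" "Phi b = Phi a ** M" using assms by (auto simp: related_def)
  show Mv: "M *v v \<in> imH" using SO4_preserves(2)[OF M(1)] assms by blast
  show "(M *v v) \<bullet> (M *v w) = v \<bullet> w" using SO4_preserves(1)[OF M(1)] by (simp add: G2_inner)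
  show "(cos (2 * a$7))\<^sup>2 * ((M *v v) \<bullet> E1)\<^sup>2 + (cos (a$8 - a$7))\<^sup>2 * ((M *v v) \<bullet> F3)\<^sup>2 + (cos (a$8 + a$7))\<^sup>2 * ((M *v v) \<bullet> F1)\<^sup>2
     = (cos (2 * b$7))\<^sup>2 * (v \<bullet> E1)\<^sup>2 + (cos (b$8 - b$7))\<^sup>2 * (v \<bullet> F3)\<^sup>2 + (cos (b$8 + b$7))\<^sup>2 * (v \<bullet> F1)\<^sup>2"
    using pH_Phi_norm[OF Mv, of a] pH_Phi_norm[OF assms(2), of b] M(2)
    by (simp flip: matrix_vector_mul_assoc)
qed

text \<open>The form of \<open>a\<close> at \<open>M *v E1\<close> takes the largest eigenvalue
  belonging to \<open>b\<close>, which is thus at most the one belonging to \<open>a\<close>.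
  Symmetry gives equality, and as this eigenvalue is simple, \<open>M *v E1\<close> is
  \<open>E1\<close> up to sign.\<close>

lemma related_E1:
  assumes "related a b M"
  obtains \<epsilon> where "\<epsilon> = 1 \<or> \<epsilon> = -1" "M *v E1 = \<epsilon> *\<^sub>R E1" "(cos (2 * a$7))\<^sup>2 = (cos (2 * b$7))\<^sup>2"
proof -
  have le: "(cos (2 * b$7))\<^sup>2 \<le> (cos (2 * a$7))\<^sup>2" if r: "related a b M" for a b M
  proof -
    have "a \<in> R_open" using r by (simp add: related_def)
    then show ?thesis
      using weighted_max(1)[OF R_open_cos(1,2), of a "(M *v E1) \<bullet> E1" "(M *v E1) \<bullet> F3" "(M *v E1) \<bullet> F1"]
        related_cos[OF r F_imH(1)] imH_parseval[of "M *v E1"] by (simp add: F_inner)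
  qed
  have eq: "(cos (2 * a$7))\<^sup>2 = (cos (2 * b$7))\<^sup>2"
    using le[OF assms] le[OF related_sym[OF assms]] by simp
  have aR: "a \<in> R_open" using assms by (simp add: related_def)
  define x where "x = (M *v E1) \<bullet> E1"
  have p: "x\<^sup>2 + ((M *v E1) \<bullet> F3)\<^sup>2 + ((M *v E1) \<bullet> F1)\<^sup>2 = 1"
    using related_cos[OF assms F_imH(1)] imH_parseval[of "M *v E1"] by (simp add: F_inner x_def)
  have z: "(M *v E1) \<bullet> F3 = 0" "(M *v E1) \<bullet> F1 = 0"
    using weighted_max(2)[OF R_open_cos(1,2)[OF aR] p] related_cos(3)[OF assms F_imH(1)] eq
    by (simp_all add: F_inner x_def)
  have "x = 1 \<or> x = -1" using p z by (simp add: power2_eq_1_iff)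
  moreover have "M *v E1 = x *\<^sub>R E1"
    using imH_frame[OF related_cos(1)[OF assms F_imH(1)]] z by (simp add: x_def)
  ultimately show ?thesis using that eq by blast
qed

text \<open>The argument of \<open>related_E1\<close> on the orthogonal complement of
  \<open>E1\<close> in \<open>imH\<close>, where the middle eigenvalue is the largest.\<close>

lemma related_F3:
  assumes "related a b M"
  obtains \<delta> where "\<delta> = 1 \<or> \<delta> = -1" "M *v F3 = \<delta> *\<^sub>R F3" "(cos (a$8 - a$7))\<^sup>2 = (cos (b$8 - b$7))\<^sup>2"
proof -
  have perp: "(M *v F3) \<bullet> E1 = 0" if r: "related a b M" for a b M
  proof -
    obtain \<epsilon> where "\<epsilon> = 1 \<or> \<epsilon> = -1" "M *v E1 = \<epsilon> *\<^sub>R E1" using r by (rule related_E1)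
    then show ?thesis using related_cos(2)[OF r F_imH(3), of E1] by (auto simp: F_inner)
  qed
  have le: "(cos (b$8 - b$7))\<^sup>2 \<le> (cos (a$8 - a$7))\<^sup>2" if r: "related a b M" for a b M
  proof -
    have "a \<in> R_open" using r by (simp add: related_def)
    then show ?thesis
      using weighted_max'(1)[OF R_open_cos(1), of a "(M *v F3) \<bullet> F3" "(M *v F3) \<bullet> F1"]
        related_cos[OF r F_imH(3)] imH_parseval[of "M *v F3"] perp[OF r] by (simp add: F_inner)
  qed
  have eq: "(cos (a$8 - a$7))\<^sup>2 = (cos (b$8 - b$7))\<^sup>2"
    using le[OF assms] le[OF related_sym[OF assms]] by simp
  have aR: "a \<in> R_open" using assms by (simp add: related_def)
  define x where "x = (M *v F3) \<bullet> F3"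
  have p: "x\<^sup>2 + ((M *v F3) \<bullet> F1)\<^sup>2 = 1"
    using related_cos[OF assms F_imH(3)] imH_parseval[of "M *v F3"] perp[OF assms] by (simp add: F_inner x_def)
  have z: "(M *v F3) \<bullet> F1 = 0"
    using weighted_max'(2)[OF R_open_cos(1)[OF aR] p] related_cos(3)[OF assms F_imH(3)] eq perp[OF assms]
    by (simp add: F_inner x_def)
  have "x = 1 \<or> x = -1" using p z by (simp add: power2_eq_1_iff)
  moreover have "M *v F3 = x *\<^sub>R F3"
    using imH_frame[OF related_cos(1)[OF assms F_imH(3)]] z perp[OF assms] by (simp add: x_def)
  ultimately show ?thesis using that eq by blast
qed

lemma imH_imHp_unique:
  assumes "p \<in> imH" "p' \<in> imH" "v \<in> imHp" "v' \<in> imHp" "p - v = p' - v'"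
  shows "p = p'" "v = v'"
proof -
  have "pH (p - v) = p" "pH (p' - v') = p'" using assms(1-4) by (simp_all add: pH_diff pH_imH pH_imHp)
  then show "p = p'" using assms(5) by simp
  then show "v = v'" using assms by simp
qed

lemma scaleR_cancel_factor:
  fixes x y :: "'a::real_vector"
  assumes "c \<noteq> 0" "c *\<^sub>R x = (e * c) *\<^sub>R y"
  shows "x = e *\<^sub>R y"
proof -
  have "c *\<^sub>R x = c *\<^sub>R (e *\<^sub>R y)" using assms(2) by (simp add: mult.commute)
  then show ?thesis using assms(1) by (simp only: scaleR_cancel_left) simp
qed

lemma angle_unique:
  assumes "cos s = cos t" "sin s = sin t" "\<bar>s - t\<bar> < 2 * pi"
  shows "s = t"
proof -
  obtain n :: int where n: "s = t + 2 * pi * of_int n"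
    using assms(1,2) sin_cos_eq_iff[of s t] by (auto simp: mult.commute mult.left_commute)
  then have "\<bar>2 * pi * real_of_int n\<bar> < 2 * pi" using assms(3) by simp
  then have "\<bar>real_of_int n\<bar> < 1" by (simp add: abs_mult)
  then have "n = 0" by linarith
  then show ?thesis using n by simp
qed

text \<open>\<open>left_i\<close> commutes with \<open>euler_\<sigma>\<close>, so the value depends
  on the \<open>euler_s\<close> factor alone. It is positive on \<open>R_open\<close> and changes
  sign with \<open>sig a *v E1\<close>, which fixes the sign of that singular vector.\<close>

lemma left_i_shift:
  "left_i (shift a) \<bullet> cr (sig a *v E1) (shift a) = cos (2 * a$5)"
proof -
  define w where "w = euler_s (a$4) (a$5) (a$6) *v E5"
  have "E5 \<in> imHp" by (simp add: imHp_def)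
  then have w: "w \<in> imHp" unfolding w_def by (rule s_imHp)
  have u: "shift a = sig a *v w" by (simp add: shift_def sig_def w_def)
  have "left_i (shift a) \<bullet> cr (sig a *v E1) (shift a) = left_i w \<bullet> cr E1 w"
    unfolding u by (simp add: sig_def left_i_sigma G2_inner euler_G2 flip: G2_cr[OF euler_G2(1)])
  also have "\<dots> = (cos (a$5))\<^sup>2 * ((cos (a$4 + a$6))\<^sup>2 + (sin (a$4 + a$6))\<^sup>2) - (sin (a$5))\<^sup>2 * ((cos (a$4 - a$6))\<^sup>2 + (sin (a$4 - a$6))\<^sup>2)"
    unfolding left_i_cr_E1[OF w] unfolding w_def s_E5 vec7_nth by algebra
  also have "\<dots> = cos (2 * a$5)" by (simp add: cos_double)
  finally show ?thesis .
qed

lemma G2_cancel: "M \<in> carrier G2 \<Longrightarrow> M *v v = M *v w \<longleftrightarrow> v = w"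
  by (metis G2_transpose_mult(1))

text \<open>The singular values give \<open>a$7\<close>, \<open>a$8\<close>. The singular vectors
  are then determined up to the signs \<open>\<epsilon>\<close>, \<open>\<delta>\<close>, and
  \<open>shift a\<close> is determined; the ranges of the fifth and third coordinate exclude
  negative signs, and the Euler angles are read off.\<close>

lemma coord_map_inj: "inj_on coord_map R_open"
proof (rule inj_onI)
  fix a b assume aR: "a \<in> R_open" and bR: "b \<in> R_open" and eq: "coord_map a = coord_map b"
  define M where "M = transpose (Phi a) ** Phi b"
  have "M \<in> SO4" using eq coset_eq_iff(1)[OF Phi_G2 Phi_G2] by (simp add: coord_map_eq M_def)
  moreover have "Phi b = Phi a ** M"
    using G2_orthogonal[OF Phi_G2, of a] by (simp add: M_def matrix_mul_assoc)
  ultimately have rel: "related a b M" using aR bR by (simp add: related_def)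
  have Mb: "Phi b *v v = Phi a *v (M *v v)" for v
    using rel by (simp add: related_def flip: matrix_vector_mul_assoc)
  obtain \<epsilon> where \<epsilon>: "\<epsilon> = 1 \<or> \<epsilon> = -1" "M *v E1 = \<epsilon> *\<^sub>R E1" and c7: "(cos (2 * a$7))\<^sup>2 = (cos (2 * b$7))\<^sup>2"
    using rel by (rule related_E1)
  obtain \<delta> where \<delta>: "\<delta> = 1 \<or> \<delta> = -1" "M *v F3 = \<delta> *\<^sub>R F3" and c8: "(cos (a$8 - a$7))\<^sup>2 = (cos (b$8 - b$7))\<^sup>2"
    using rel by (rule related_F3)
  have a: "0 < a$7" "3 * a$7 < a$8" "a$8 < pi / 2" "0 < b$7" "3 * b$7 < b$8" "b$8 < pi / 2"
    using aR bR by (auto simp: R_open_def)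
  note ca = R_open_cos(3,4,5)[OF aR] and cb = R_open_cos(3,4,5)[OF bR]
  have "cos (2 * a$7) = cos (2 * b$7)" "cos (a$8 - a$7) = cos (b$8 - b$7)"
    using power2_eq_imp_eq[OF c7] power2_eq_imp_eq[OF c8] ca cb by simp_all
  note cos78 = this
  have "2 * a$7 = 2 * b$7" by (rule cos_inj_pi) (use a cos78 in auto)
  moreover have "a$8 - a$7 = b$8 - b$7" by (rule cos_inj_pi) (use a cos78 in auto)
  ultimately have e78: "a$7 = b$7" "a$8 = b$8" by auto
  define p where "p = sig a *v E1"
  have pH: "p \<in> imH" "p \<bullet> p = 1" by (simp_all add: p_def sig_imH F_imH G2_inner sig_G2 F_inner)
  \<comment> \<open>The components in \<open>imH\<close> and \<open>imHp\<close> of the two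
    expressions for \<open>Phi b *v E1\<close> are compared.\<close>
  have 1: "cos (2 * b$7) *\<^sub>R (sig b *v E1) = (\<epsilon> * cos (2 * a$7)) *\<^sub>R p"
     "sin (2 * b$7) *\<^sub>R cr (sig b *v E1) (shift b) = (\<epsilon> * sin (2 * a$7)) *\<^sub>R cr p (shift a)"
  proof -
    have "cos (2 * b$7) *\<^sub>R (sig b *v E1) - sin (2 * b$7) *\<^sub>R cr (sig b *v E1) (shift b) =
        (\<epsilon> * cos (2 * a$7)) *\<^sub>R p - (\<epsilon> * sin (2 * a$7)) *\<^sub>R cr p (shift a)"
      using Mb[of E1] \<epsilon>(2) by (simp add: matrix_vector_mult_scaleR Phi_frame' p_def scaleR_diff_right)
    moreover have "(\<epsilon> * cos (2 * a$7)) *\<^sub>R p \<in> imH" "cos (2 * b$7) *\<^sub>R (sig b *v E1) \<in> imH"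
      using pH sig_imH[OF F_imH(1), of b] by (simp_all add: imH_def)
    moreover have "(\<epsilon> * sin (2 * a$7)) *\<^sub>R cr p (shift a) \<in> imHp" "sin (2 * b$7) *\<^sub>R cr (sig b *v E1) (shift b) \<in> imHp"
      using cr_imH_imHp(1)[OF pH(1) shift_imHp[of a]] cr_imH_imHp(1)[OF sig_imH[OF F_imH(1)] shift_imHp, of b]
      by (simp_all add: imHp_def)
    ultimately show "cos (2 * b$7) *\<^sub>R (sig b *v E1) = (\<epsilon> * cos (2 * a$7)) *\<^sub>R p"
     "sin (2 * b$7) *\<^sub>R cr (sig b *v E1) (shift b) = (\<epsilon> * sin (2 * a$7)) *\<^sub>R cr p (shift a)"
      using imH_imHp_unique by blast+
  qed
  have sE: "sig b *v E1 = \<epsilon> *\<^sub>R p" by (rule scaleR_cancel_factor[of "cos (2 * b$7)"]) (use 1(1) ca(2) in \<open>simp_all add: e78\<close>)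
  have "cr (sig b *v E1) (shift b) = \<epsilon> *\<^sub>R cr p (shift a)"
    by (rule scaleR_cancel_factor[of "sin (2 * b$7)"]) (use 1(2) ca(3) in \<open>simp_all add: e78\<close>)
  then have "cr p (shift b) = cr p (shift a)" using \<epsilon>(1) by (auto simp: sE cr_scaleR cr_minus)
  then have "cr p (cr p (shift b)) = cr p (cr p (shift a))" by simp
  then have u: "shift b = shift a"
    using pH by (simp add: cr_cr imH_imHp_inner shift_imHp)
  have "\<epsilon> = 1"
  proof -
    have "cos (2 * a$5) > 0" "cos (2 * b$5) > 0"
      using aR bR by (auto simp: R_open_def intro!: cos_gt_zero_pi)
    moreover have "cos (2 * b$5) = \<epsilon> * cos (2 * a$5)"
      using left_i_shift[of a] left_i_shift[of b] by (simp add: u sE cr_scaleR flip: p_def)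
    ultimately show ?thesis using \<epsilon>(1) by auto
  qed
  then have sE1: "sig b *v E1 = sig a *v E1" by (simp add: sE p_def)
  have ra: "0 < a$1" "a$1 < pi" "0 < b$1" "b$1 < pi" "0 < a$2" "a$2 < pi/2" "0 < b$2" "b$2 < pi/2"
     "0 < a$3" "a$3 < pi/2" "0 < b$3" "b$3 < pi/2" "0 < a$4" "a$4 < 2*pi" "0 < b$4" "b$4 < 2*pi"
     "0 < a$5" "a$5 < pi/4" "0 < b$5" "b$5 < pi/4" "0 < a$6" "a$6 < pi" "0 < b$6" "b$6 < pi"
    using aR bR by (auto simp: R_open_def)
  have s1: "cos (2 * b$2) = cos (2 * a$2)" "cos (2 * b$1) * sin (2 * b$2) = cos (2 * a$1) * sin (2 * a$2)"
    "sin (2 * b$1) * sin (2 * b$2) = sin (2 * a$1) * sin (2 * a$2)"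
    using sE1 by (simp_all add: sig_def sigma_E1 vec7_eq_iff)
  have "2 * b$2 = 2 * a$2" by (rule cos_inj_pi) (use s1(1) ra in auto)
  then have e2: "b$2 = a$2" by simp
  have "sin (2 * a$2) > 0" using ra by (intro sin_gt_zero) auto
  then have cs1: "cos (2 * b$1) = cos (2 * a$1)" "sin (2 * b$1) = sin (2 * a$1)" using s1(2,3) by (simp_all add: e2)
  have "2 * b$1 = 2 * a$1" by (rule angle_unique) (use cs1 ra in auto)
  then have e1: "b$1 = a$1" by simp
  have "pH (Phi b *v F3) = \<delta> *\<^sub>R pH (Phi a *v F3)"
    unfolding Mb[of F3] \<delta>(2) by (simp add: matrix_vector_mult_scaleR pH_scaleR)
  note pF3 = this
  have "sig b *v F3 = \<delta> *\<^sub>R (sig a *v F3)"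
    by (rule scaleR_cancel_factor[of "cos (b$8 - b$7)"]) (use pF3 ca(1) in \<open>simp_all add: pH_Phi e78\<close>)
  then have "m8 (a$1) *v (m9 (a$2) *v (m8 (b$3) *v F3)) = m8 (a$1) *v (m9 (a$2) *v (m8 (a$3) *v (\<delta> *\<^sub>R F3)))"
    by (simp add: sig_def euler_\<sigma>_eq e1 e2 matrix_vector_mult_scaleR flip: matrix_vector_mul_assoc)
  then have "m8 (b$3) *v F3 = m8 (a$3) *v (\<delta> *\<^sub>R F3)" by (simp add: G2_cancel m_G2)
  then have m: "cos (2 * b$3) * rh - sin (2 * b$3) * rh = cos (2 * a$3) * (\<delta> * rh) - sin (2 * a$3) * (\<delta> * rh)"
     "sin (2 * b$3) * rh + cos (2 * b$3) * rh = sin (2 * a$3) * (\<delta> * rh) + cos (2 * a$3) * (\<delta> * rh)"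
    by (simp_all add: m_apply F3_def vec7_eq_iff)
  have "2 * (rh * sin (2 * b$3)) = 2 * (rh * (\<delta> * sin (2 * a$3)))" "2 * (rh * cos (2 * b$3)) = 2 * (rh * (\<delta> * cos (2 * a$3)))"
    using m by algebra+
  then have m3: "sin (2 * b$3) = \<delta> * sin (2 * a$3)" "cos (2 * b$3) = \<delta> * cos (2 * a$3)"
    using rh(1) by simp_all
  moreover have "sin (2 * b$3) > 0" "sin (2 * a$3) > 0" using ra by (auto intro!: sin_gt_zero)
  ultimately have "\<delta> = 1" using \<delta>(1) by auto
  then have m3': "sin (2 * b$3) = sin (2 * a$3)" "cos (2 * b$3) = cos (2 * a$3)" using m3 by simp_all
  have "2 * b$3 = 2 * a$3" by (rule angle_unique) (use m3' ra in auto)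
  then have e3: "b$3 = a$3" by simp
  have "sig a *v (euler_s (b$4) (b$5) (b$6) *v E5) = sig a *v (euler_s (a$4) (a$5) (a$6) *v E5)"
    using u by (simp add: shift_def sig_def e1 e2 e3)
  then have "euler_s (b$4) (b$5) (b$6) *v E5 = euler_s (a$4) (a$5) (a$6) *v E5" by (simp add: G2_cancel sig_G2)
  then have s: "cos (b$5) * sin (b$4 + b$6) = cos (a$5) * sin (a$4 + a$6)" "cos (b$5) * cos (b$4 + b$6) = cos (a$5) * cos (a$4 + a$6)"
     "sin (b$5) * sin (b$4 - b$6) = sin (a$5) * sin (a$4 - a$6)" "sin (b$5) * cos (b$4 - b$6) = sin (a$5) * cos (a$4 - a$6)"
    by (simp_all add: s_E5 vec7_eq_iff)
  have "cos (2 * b$5) = cos (2 * a$5)"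
    using left_i_shift[of a] left_i_shift[of b] by (simp add: u sE1)
  note cos5 = this
  have "2 * b$5 = 2 * a$5" by (rule cos_inj_pi) (use cos5 ra in auto)
  then have e5: "b$5 = a$5" by simp
  have "cos (a$5) > 0" "sin (a$5) > 0" using ra by (auto intro!: cos_gt_zero_pi sin_gt_zero)
  then have t: "sin (b$4 + b$6) = sin (a$4 + a$6)" "cos (b$4 + b$6) = cos (a$4 + a$6)"
    "sin (b$4 - b$6) = sin (a$4 - a$6)" "cos (b$4 - b$6) = cos (a$4 - a$6)"
    using s by (simp_all add: e5)
  \<comment> \<open>Sum and difference of the fourth and sixth angle are known modulo a full turn.
    They give \<open>2 * a$6\<close> modulo a full turn, hence \<open>a$6\<close> by its range, and
    then \<open>a$4\<close> from the sum.\<close>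
  have d6: "2 * b$6 = (b$4 + b$6) - (b$4 - b$6)" "2 * a$6 = (a$4 + a$6) - (a$4 - a$6)" by simp_all
  have "2 * b$6 = 2 * a$6"
    by (rule angle_unique) (unfold d6, unfold cos_diff[of "_ + _"] sin_diff[of "_ + _"] t, use ra in auto)
  then have e6: "b$6 = a$6" by simp
  have d4: "b$4 = (b$4 + b$6) - a$6" "a$4 = (a$4 + a$6) - a$6" by (simp_all add: e6)
  have "cos (b$4) = cos (a$4)" "sin (b$4) = sin (a$4)"
    by (subst d4(1), subst d4(2), simp only: cos_diff sin_diff t)+
  note cs4 = this
  have e4: "b$4 = a$4" by (rule angle_unique) (use cs4 ra in auto)
  show "a = b" by (simp add: vec_eq_iff forall_8 e1 e2 e3 e4 e5 e6 e78)
qed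

section \<open>Null sets of parameters\<close>

text \<open>Compactness makes the continuous image of the boundary in matrices closed, which later
  supplies measurability.\<close>

lemma compact_boundary: "compact (R' - R_open)"
proof -
  have R: "R' = R' \<inter> cbox 0 (\<chi> i. 8)"
    using pi_less_4 by (auto simp: R'_def mem_box_cart forall_8)
  have "closed R'"
    unfolding R'_def by (intro closed_Collect_conj closed_Collect_le continuous_intros)
  then have "compact R'"
    by (subst R) (intro closed_Int_compact compact_cbox)
  moreover have "open R_open"
    unfolding R_open_def by (intro open_Collect_conj open_Collect_less continuous_intros)
  ultimately show ?thesis by (rule compact_diff)
qed

lemma negligible_coordinate: "negligible {a::real^'n. a $ i = c}"
  using negligible_standard_hyperplane[of "axis i 1 :: real^'n" c] by (simp add: inner_axis axis_in_Basis_iff)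

lemma negligible_boundary: "negligible (R' - R_open)"
proof -
  have *: "negligible {a::real^8. a $ 8 = 3 * a $ 7}"
  proof -
    have "(axis 8 1 - 3 *\<^sub>R axis 7 1 :: real^8) $ 8 = 1" by (simp add: axis_def)
    then have "(axis 8 1 - 3 *\<^sub>R axis 7 1 :: real^8) \<noteq> 0" by force
    then have "negligible {a::real^8. (axis 8 1 - 3 *\<^sub>R axis 7 1) \<bullet> a = 0}"
      by (intro negligible_hyperplane) simp
    moreover have "{a::real^8. (axis 8 1 - 3 *\<^sub>R axis 7 1) \<bullet> a = 0} = {a. a $ 8 = 3 * a $ 7}"
      by (auto simp: inner_diff_left inner_axis')
    ultimately show ?thesis by simp
  qed
  \<comment> \<open>Each point of \<open>R' - R_open\<close> lies on one of the sixteen hyperplanes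
    where a defining inequality is an equality.\<close>
  show ?thesis
    by (rule negligible_subset[of "{a. a $ 1 = 0} \<union> {a. a $ 1 = pi} \<union> {a. a $ 2 = 0} \<union> {a. a $ 2 = pi / 2} \<union>
      {a. a $ 3 = 0} \<union> {a. a $ 3 = pi / 2} \<union> {a. a $ 4 = 0} \<union> {a. a $ 4 = 2 * pi} \<union>
      {a. a $ 5 = 0} \<union> {a. a $ 5 = pi / 4} \<union> {a. a $ 6 = 0} \<union> {a. a $ 6 = pi} \<union>
      {a. a $ 7 = 0} \<union> {a. a $ 7 = pi / 6} \<union> {a. a $ 8 = 3 * a $ 7} \<union> {a. a $ 8 = pi / 2}"])
      (intro negligible_Un negligible_coordinate *, auto simp: R'_def R_open_def less_le)
qed

section \<open>Differentiability in the parameters\<close>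

lemma vec7_basis: "vec7 x1 x2 x3 x4 x5 x6 x7 =
    x1 *\<^sub>R axis 1 1 + x2 *\<^sub>R axis 2 1 + x3 *\<^sub>R axis 3 1 + x4 *\<^sub>R axis 4 1 + x5 *\<^sub>R axis 5 1 +
    x6 *\<^sub>R axis 6 1 + x7 *\<^sub>R axis 7 1"
  by (simp add: vec7_eq_iff axis_def)

lemma differentiable_nth: "g differentiable F \<Longrightarrow> (\<lambda>x. (g x :: real^'n) $ i) differentiable F"
  using bounded_linear.has_derivative[OF bounded_linear_vec_nth] unfolding differentiable_def by blast

lemma differentiable_cos_sin:
  fixes f :: "'a::real_normed_vector \<Rightarrow> real"
  assumes "f differentiable (at x within S)"
  shows "(\<lambda>x. cos (f x)) differentiable (at x within S)" "(\<lambda>x. sin (f x)) differentiable (at x within S)"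
  using assms by (auto simp: differentiable_def intro: has_derivative_cos has_derivative_sin)

lemma differentiable_m:
  fixes f :: "'a::real_normed_vector \<Rightarrow> real"
  assumes "f differentiable (at x within S)" "g differentiable (at x within S)"
  shows "(\<lambda>x. m8 (f x) *v g x) differentiable (at x within S)" "(\<lambda>x. m9 (f x) *v g x) differentiable (at x within S)"
    "(\<lambda>x. m11 (f x) *v g x) differentiable (at x within S)" "(\<lambda>x. m2 (f x) *v g x) differentiable (at x within S)"
    "(\<lambda>x. m3 (f x) *v g x) differentiable (at x within S)" "(\<lambda>x. m5 (f x) *v g x) differentiable (at x within S)"
  unfolding m_apply vec7_basis
  by (intro differentiable_add differentiable_diff differentiable_scaleR differentiable_mult differentiable_cos_sin
      differentiable_const differentiable_nth assms)+

lemma differentiable_euler: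
  assumes "f differentiable (at x within S)" "g differentiable (at x within S)" "h differentiable (at x within S)" "k differentiable (at x within S)"
  shows "(\<lambda>x. euler_\<sigma> (f x) (g x) (h x) *v k x) differentiable (at x within S)"
    "(\<lambda>x. euler_s (f x) (g x) (h x) *v k x) differentiable (at x within S)"
  unfolding euler_\<sigma>_eq euler_s_eq matrix_vector_mul_assoc[symmetric]
  by (intro differentiable_m assms)+

text \<open>Products of the coordinate matrix of \<open>a\<close>, an element of \<open>SO(4)\<close> with Euler angles \<open>b\<close> and a fixed
  matrix \<open>h\<close>, followed by a change from orthonormal to arbitrary triples of vectors with coefficients \<open>l\<close>.
  Domain and target both have dimension 21.\<close>

definition frame :: "real^7^7 \<Rightarrow> (real^8) \<times> (real^6) \<times> (real^7) \<Rightarrow> real^7 \<Rightarrow> real^7" where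
  "frame h p v = (let a = fst p; b = fst (snd p) in
     Phi a *v (euler_\<sigma> (b $ 1) (b $ 2) (b $ 3) *v (euler_s (b $ 4) (b $ 5) (b $ 6) *v (h *v v))))"

definition triple :: "real^7^7 \<Rightarrow> (real^8) \<times> (real^6) \<times> (real^7) \<Rightarrow> (real^7) \<times> (real^7) \<times> (real^7)" where
  "triple h p = (let l = snd (snd p) in
     (l $ 1 *\<^sub>R frame h p E1, l $ 2 *\<^sub>R frame h p E1 + l $ 3 *\<^sub>R frame h p E2,
      l $ 4 *\<^sub>R frame h p E1 + l $ 5 *\<^sub>R frame h p E2 + l $ 6 *\<^sub>R frame h p E3 + l $ 7 *\<^sub>R frame h p E4))"

lemma differentiable_proj:
  "fst differentiable F" "(\<lambda>p. fst (snd p)) differentiable F" "(\<lambda>p. snd (snd p)) differentiable F"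
  by (intro bounded_linear_imp_differentiable bounded_linear_fst bounded_linear_snd
      bounded_linear_compose[OF bounded_linear_fst bounded_linear_snd]
      bounded_linear_compose[OF bounded_linear_snd bounded_linear_snd])+

lemma differentiable_Pair:
  "f differentiable (at x within S) \<Longrightarrow> g differentiable (at x within S) \<Longrightarrow>
    (\<lambda>x. (f x, g x)) differentiable (at x within S)"
  unfolding differentiable_def using has_derivative_Pair by blast

lemma differentiable_triple: "triple h differentiable (at p within S)"
proof -
  have "(\<lambda>p. frame h p v) differentiable (at p within S)" for v
    unfolding frame_def Let_def Phi_apply
    by (intro differentiable_euler differentiable_m differentiable_nth differentiable_proj differentiable_const)
  then show ?thesis
    unfolding triple_def Let_def
    by (intro differentiable_Pair differentiable_add differentiable_scaleR differentiable_nth differentiable_proj)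
qed

text \<open>A Lebesgue null set is enclosed in a Borel null set, to which the product measure
  formula applies.\<close>

lemma negligible_Times:
  fixes N :: "'a::euclidean_space set"
  assumes "negligible N"
  shows "negligible (N \<times> (UNIV :: 'b::euclidean_space set))"
proof -
  have "N \<in> null_sets lebesgue" using assms by (simp add: negligible_iff_null_sets)
  then obtain M where M: "M \<in> null_sets lborel" "N \<subseteq> M"
    by (auto simp: null_sets_completion_iff2)
  then have "M \<times> UNIV \<in> null_sets (lborel \<Otimes>\<^sub>M (lborel :: 'b measure))"
    by (simp add: null_sets_def lborel.emeasure_pair_measure_Times)
  then have "M \<times> (UNIV :: 'b set) \<in> null_sets lborel" by (simp only: lborel_prod)
  then have "negligible (M \<times> (UNIV :: 'b set))"
    by (simp add: negligible_iff_null_sets null_sets_completionI)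
  then show ?thesis by (rule negligible_subset) (use M in auto)
qed

text \<open>Differentiable maps between spaces of equal dimension, here 8 + 6 + 7 = 3 * 7, take null
  sets to null sets.\<close>

lemma negligible_triple: "negligible (triple h ` ((R' - R_open) \<times> UNIV))"
  by (rule negligible_differentiable_image_negligible)
    (auto simp: negligible_Times negligible_boundary differentiable_on_def differentiable_triple)

section \<open>Orthonormal frames\<close>

text \<open>By \<open>coordinates_exist\<close> the image of \<open>imH\<close> under some
  \<open>Phi a\<close> contains \<open>u1\<close> and \<open>u2\<close>. An
  \<open>euler_\<sigma>\<close> factor aligns \<open>E1\<close>, \<open>E2\<close> with them, and an
  \<open>euler_s\<close> factor then aligns \<open>E4\<close> with \<open>u4\<close>.\<close>

lemma basic_triple:
  assumes u: "u1 \<bullet> u1 = 1" "u2 \<bullet> u2 = 1" "u4 \<bullet> u4 = 1" "u1 \<bullet> u2 = 0" "u1 \<bullet> u4 = 0" "u2 \<bullet> u4 = 0" "cr u1 u2 \<bullet> u4 = 0"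
  obtains g where "g \<in> carrier G2" "g *v E1 = u1" "g *v E2 = u2" "g *v E4 = u4"
proof -
  obtain a where "u1 \<in> (*v) (Phi a) ` imH" "u2 \<in> (*v) (Phi a) ` imH"
    using coordinates_exist[OF u(1,2,4)] by blast
  then obtain e1 e2 where e: "e1 \<in> imH" "u1 = Phi a *v e1" "e2 \<in> imH" "u2 = Phi a *v e2" by blast
  have "e1 \<bullet> e1 = 1" "e2 \<bullet> e2 = 1" "e1 \<bullet> e2 = 0" using u by (simp_all add: e G2_inner Phi_G2)
  then obtain x y z where xyz: "euler_\<sigma> x y z *v E1 = e1" "euler_\<sigma> x y z *v E2 = e2"
    using sigma_exists[OF e(1) _ e(3), of 1 0] by simp blast
  define N where "N = Phi a ** euler_\<sigma> x y z"
  have N: "N \<in> carrier G2" unfolding N_def by (intro G2_mult Phi_G2 euler_G2)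
  have NE: "N *v E1 = u1" "N *v E2 = u2" by (simp_all add: N_def e xyz flip: matrix_vector_mul_assoc)
  have "cr E1 E2 = E3" by (simp add: cr_def vec7_eq_iff)
  then have N3: "N *v E3 = cr u1 u2" using G2_cr[OF N, of E1 E2] by (simp add: NE)
  define w where "w = transpose N *v u4"
  have Nw: "N *v w = u4" by (simp only: w_def G2_transpose_mult N)
  have i: "E1 \<bullet> w = 0" "E2 \<bullet> w = 0" "E3 \<bullet> w = 0" "w \<bullet> w = 1"
    unfolding G2_inner[OF N, of _ w, symmetric] Nw NE N3 using u by simp_all
  then have "w \<in> imHp" by (simp add: imHp_def inner_7)
  then obtain x' y' z' where s: "euler_s x' y' z' *v E5 = w" using i(4) by (rule s_exists)
  define T where "T = euler_s x' y' (z' + pi / 2)"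
  have T: "T \<in> carrier G2" "T *v E1 = E1" "T *v E2 = E2" "T *v E4 = w"
    by (simp_all add: T_def euler_G2 s_imH imH_def s_E4 s)
  show ?thesis
  proof (rule that)
    show "N ** T \<in> carrier G2" using N T(1) by (rule G2_mult)
  qed (simp_all add: T NE Nw flip: matrix_vector_mul_assoc)
qed

text \<open>Gram-Schmidt without division: on nondegenerate input \<open>W2\<close> and
  \<open>W4\<close> are positive multiples of the orthogonal components, for \<open>W4\<close> also
  orthogonal to the product of the first two vectors. Being polynomial, they make
  \<open>generic\<close> open.\<close>

definition W2 :: "(real^7) \<times> (real^7) \<times> (real^7) \<Rightarrow> real^7" where
  "W2 v = (fst v \<bullet> fst v) *\<^sub>R fst (snd v) - (fst (snd v) \<bullet> fst v) *\<^sub>R fst v"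

definition W4 :: "(real^7) \<times> (real^7) \<times> (real^7) \<Rightarrow> real^7" where
  "W4 v = (let x = fst v; y = W2 v; z = cr x y; w = snd (snd v) in
     ((x \<bullet> x) * (y \<bullet> y)) *\<^sub>R w - ((y \<bullet> y) * (w \<bullet> x)) *\<^sub>R x - ((x \<bullet> x) * (w \<bullet> y)) *\<^sub>R y - (w \<bullet> z) *\<^sub>R z)"

definition generic :: "((real^7) \<times> (real^7) \<times> (real^7)) set" where
  "generic = {v. fst v \<noteq> 0 \<and> W2 v \<noteq> 0 \<and> W4 v \<noteq> 0}"

definition gs1 :: "(real^7) \<times> (real^7) \<times> (real^7) \<Rightarrow> real^7" where "gs1 v = fst v /\<^sub>R norm (fst v)"
definition gs2 :: "(real^7) \<times> (real^7) \<times> (real^7) \<Rightarrow> real^7" where "gs2 v = W2 v /\<^sub>R norm (W2 v)"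
definition gs4 :: "(real^7) \<times> (real^7) \<times> (real^7) \<Rightarrow> real^7" where "gs4 v = W4 v /\<^sub>R norm (W4 v)"

text \<open>For generic \<open>v\<close> the columns are the images of \<open>E1\<close> to
  \<open>E7\<close> under the automorphism sending \<open>E1\<close>, \<open>E2\<close>,
  \<open>E4\<close> to the Gram-Schmidt vectors. The explicit form makes continuity in
  \<open>v\<close> visible.\<close>

definition gs_matrix :: "(real^7) \<times> (real^7) \<times> (real^7) \<Rightarrow> real^7^7" where
  "gs_matrix v = (\<chi> i. vec7 (gs1 v $ i) (gs2 v $ i) (cr (gs1 v) (gs2 v) $ i) (gs4 v $ i)
     (cr (gs1 v) (gs4 v) $ i) (cr (gs2 v) (gs4 v) $ i) (cr (cr (gs1 v) (gs2 v)) (gs4 v) $ i))"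

lemma gs_matrix_G2:
  assumes "v \<in> generic"
  shows "gs_matrix v \<in> carrier G2" "gs_matrix v *v E1 = gs1 v" "gs_matrix v *v E2 = gs2 v" "gs_matrix v *v E4 = gs4 v"
proof -
  define x y z w where "x = fst v" and "y = W2 v" and "z = cr x y" and "w = W4 v"
  have ne: "x \<noteq> 0" "y \<noteq> 0" "w \<noteq> 0" using assms by (simp_all add: generic_def x_def y_def w_def)
  have xy: "x \<bullet> y = 0" by (simp add: x_def y_def W2_def inner_diff_right inner_commute)
  have w_eq: "w = ((x \<bullet> x) * (y \<bullet> y)) *\<^sub>R snd (snd v) - ((y \<bullet> y) * (snd (snd v) \<bullet> x)) *\<^sub>R x
      - ((x \<bullet> x) * (snd (snd v) \<bullet> y)) *\<^sub>R y - (snd (snd v) \<bullet> z) *\<^sub>R z"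
    by (simp add: w_def W4_def x_def y_def z_def Let_def)
  have zz: "z \<bullet> z = (x \<bullet> x) * (y \<bullet> y)" by (simp add: z_def inner_cr_cr xy)
  have xz: "x \<bullet> z = 0" "y \<bullet> z = 0" "z \<bullet> x = 0" "z \<bullet> y = 0" by (simp_all add: z_def)
  have yx: "y \<bullet> x = 0" using xy by (simp add: inner_commute)
  have xw: "x \<bullet> w = 0" by (simp add: w_eq inner_diff_right xy xz inner_commute[of x "snd (snd v)"])
  have yw: "y \<bullet> w = 0" by (simp add: w_eq inner_diff_right yx xz inner_commute[of y "snd (snd v)"])
  have zw: "z \<bullet> w = 0" by (simp add: w_eq inner_diff_right xz zz inner_commute[of z "snd (snd v)"])
  have n1: "(r /\<^sub>R norm r) \<bullet> (r /\<^sub>R norm r) = 1" if "r \<noteq> 0" for r :: "real^7"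
    using that by (simp add: dot_square_norm power2_eq_square)
  have gs: "gs1 v = x /\<^sub>R norm x" "gs2 v = y /\<^sub>R norm y" "gs4 v = w /\<^sub>R norm w"
    by (simp_all add: gs1_def gs2_def gs4_def x_def y_def w_def)
  have "gs1 v \<bullet> gs1 v = 1" "gs2 v \<bullet> gs2 v = 1" "gs4 v \<bullet> gs4 v = 1" unfolding gs by (rule n1, rule ne)+
  moreover have "gs1 v \<bullet> gs2 v = 0" "gs1 v \<bullet> gs4 v = 0" "gs2 v \<bullet> gs4 v = 0" "cr (gs1 v) (gs2 v) \<bullet> gs4 v = 0"
    unfolding gs using zw by (simp_all add: xy xw yw cr_scaleR z_def)
  ultimately obtain g where g: "g \<in> carrier G2" "g *v E1 = gs1 v" "g *v E2 = gs2 v" "g *v E4 = gs4 v"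
    by (rule basic_triple)
  have c: "E3 = cr E1 E2" "E5 = cr E1 E4" "E6 = cr E2 E4" "E7 = cr (cr E1 E2) E4"
    by (simp_all add: cr_def vec7_eq_iff)
  have e: "g *v E3 = cr (gs1 v) (gs2 v)" "g *v E5 = cr (gs1 v) (gs4 v)" "g *v E6 = cr (gs2 v) (gs4 v)"
    "g *v E7 = cr (cr (gs1 v) (gs2 v)) (gs4 v)"
    unfolding c using g by (simp_all add: G2_cr)
  have col: "g $ i $ 1 = (g *v E1) $ i" "g $ i $ 2 = (g *v E2) $ i" "g $ i $ 3 = (g *v E3) $ i" "g $ i $ 4 = (g *v E4) $ i"
     "g $ i $ 5 = (g *v E5) $ i" "g $ i $ 6 = (g *v E6) $ i" "g $ i $ 7 = (g *v E7) $ i" for i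
    by (simp_all add: matrix_vector_mult_def sum_7)
  have "g $ i = gs_matrix v $ i" for i
    unfolding vec7_eq_iff by (simp only: col g e gs_matrix_def vec_lambda_beta vec7_nth)
  then have "g = gs_matrix v" by (simp add: vec_eq_iff)
  then show "gs_matrix v \<in> carrier G2" "gs_matrix v *v E1 = gs1 v" "gs_matrix v *v E2 = gs2 v" "gs_matrix v *v E4 = gs4 v"
    using g by simp_all
qed

text \<open>The coefficients undo the orthonormalisation; their number 1 + 2 + 4 = 7 accounts for
  the last block of parameters of \<open>triple\<close>.\<close>

lemma generic_expansion:
  assumes "v \<in> generic"
  obtains l :: "real^7" where "fst v = l $ 1 *\<^sub>R gs1 v" "fst (snd v) = l $ 2 *\<^sub>R gs1 v + l $ 3 *\<^sub>R gs2 v"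
    "snd (snd v) = l $ 4 *\<^sub>R gs1 v + l $ 5 *\<^sub>R gs2 v + l $ 6 *\<^sub>R cr (gs1 v) (gs2 v) + l $ 7 *\<^sub>R gs4 v"
proof -
  define x y z w where "x = fst v" and "y = W2 v" and "z = cr x y" and "w = W4 v"
  have ne: "x \<noteq> 0" "y \<noteq> 0" "w \<noteq> 0" using assms by (simp_all add: generic_def x_def y_def w_def)
  define v2 v4 where "v2 = fst (snd v)" and "v4 = snd (snd v)"
  have y: "y = (x \<bullet> x) *\<^sub>R v2 - (v2 \<bullet> x) *\<^sub>R x" by (simp add: y_def W2_def x_def v2_def)
  have w: "w = ((x \<bullet> x) * (y \<bullet> y)) *\<^sub>R v4 - ((y \<bullet> y) * (v4 \<bullet> x)) *\<^sub>R x
      - ((x \<bullet> x) * (v4 \<bullet> y)) *\<^sub>R y - (v4 \<bullet> z) *\<^sub>R z"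
    by (simp add: w_def W4_def x_def y_def z_def v4_def Let_def)
  have gs: "x = norm x *\<^sub>R gs1 v" "y = norm y *\<^sub>R gs2 v" "w = norm w *\<^sub>R gs4 v"
    using ne by (simp_all add: gs1_def gs2_def gs4_def x_def y_def w_def)
  have z: "z = (norm x * norm y) *\<^sub>R cr (gs1 v) (gs2 v)"
    unfolding z_def by (subst gs(1), subst gs(2)) (simp add: cr_scaleR)
  have pos: "x \<bullet> x \<noteq> 0" "y \<bullet> y \<noteq> 0" using ne by simp_all
  have "(x \<bullet> x) *\<^sub>R v2 = (v2 \<bullet> x) *\<^sub>R x + y" by (simp add: y)
  then have "v2 = (1 / (x \<bullet> x)) *\<^sub>R ((v2 \<bullet> x) *\<^sub>R x + y)" using pos by (metis scaleR_one scaleR_scaleR nonzero_divide_eq_eq)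
  also have "\<dots> = (1 / (x \<bullet> x) * (v2 \<bullet> x) * norm x) *\<^sub>R gs1 v + (1 / (x \<bullet> x) * norm y) *\<^sub>R gs2 v"
    by (subst (4) gs(1), subst gs(2)) (simp add: scaleR_add_right)
  finally have v2: "v2 = (1 / (x \<bullet> x) * (v2 \<bullet> x) * norm x) *\<^sub>R gs1 v + (1 / (x \<bullet> x) * norm y) *\<^sub>R gs2 v" .
  define c where "c = 1 / ((x \<bullet> x) * (y \<bullet> y))"
  have "((x \<bullet> x) * (y \<bullet> y)) *\<^sub>R v4 = ((y \<bullet> y) * (v4 \<bullet> x)) *\<^sub>R x + ((x \<bullet> x) * (v4 \<bullet> y)) *\<^sub>R y + (v4 \<bullet> z) *\<^sub>R z + w"
    by (simp add: w)
  moreover have "c * ((x \<bullet> x) * (y \<bullet> y)) = 1" using pos by (simp add: c_def)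
  ultimately have "v4 = c *\<^sub>R (((y \<bullet> y) * (v4 \<bullet> x)) *\<^sub>R x + ((x \<bullet> x) * (v4 \<bullet> y)) *\<^sub>R y + (v4 \<bullet> z) *\<^sub>R z + w)"
    by (metis scaleR_one scaleR_scaleR)
  then have "v4 = (c * ((y \<bullet> y) * (v4 \<bullet> x))) *\<^sub>R x + (c * ((x \<bullet> x) * (v4 \<bullet> y))) *\<^sub>R y + (c * (v4 \<bullet> z)) *\<^sub>R z + c *\<^sub>R w"
    by (simp only: scaleR_add_right scaleR_scaleR)
  then obtain p q r s where "v4 = p *\<^sub>R x + q *\<^sub>R y + r *\<^sub>R z + s *\<^sub>R w" by blast
  then have v4: "v4 = (p * norm x) *\<^sub>R gs1 v + (q * norm y) *\<^sub>R gs2 v + (r * (norm x * norm y)) *\<^sub>R cr (gs1 v) (gs2 v) + (s * norm w) *\<^sub>R gs4 v"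
    using gs z by (metis scaleR_scaleR)
  show ?thesis
    by (rule that[of "vec7 (norm x) (1 / (x \<bullet> x) * (v2 \<bullet> x) * norm x) (1 / (x \<bullet> x) * norm y)
        (p * norm x) (q * norm y) (r * (norm x * norm y)) (s * norm w)"])
      (use gs(1) v2 v4 in \<open>simp_all only: vec7_nth flip: x_def v2_def v4_def\<close>)
qed

section \<open>Continuity and openness\<close>

lemma continuous_on_matrix_mult:
  fixes f g :: "'a::topological_space \<Rightarrow> real^7^7"
  assumes "continuous_on S f" "continuous_on S g"
  shows "continuous_on S (\<lambda>x. f x ** g x)"
  unfolding matrix_matrix_mult_def by (intro continuous_intros assms)

lemma continuous_on_transpose:
  fixes f :: "'a::topological_space \<Rightarrow> real^7^7"
  assumes "continuous_on S f"
  shows "continuous_on S (\<lambda>x. transpose (f x))"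
  unfolding transpose_def by (intro continuous_intros assms)

lemma continuous_on_vec7:
  assumes "continuous_on S f1" "continuous_on S f2" "continuous_on S f3" "continuous_on S f4" "continuous_on S f5"
    "continuous_on S f6" "continuous_on S f7"
  shows "continuous_on S (\<lambda>x. vec7 (f1 x) (f2 x) (f3 x) (f4 x) (f5 x) (f6 x) (f7 x))"
  unfolding vec7_basis by (intro continuous_intros assms)

lemma continuous_on_cr:
  assumes "continuous_on S f" "continuous_on S g"
  shows "continuous_on S (\<lambda>x. cr (f x) (g x))"
  unfolding cr_def by (intro continuous_on_vec7 continuous_intros assms)

lemma continuous_on_W: "continuous_on S W2" "continuous_on S W4"
proof -
  show "continuous_on S W2" for S unfolding W2_def by (intro continuous_intros)
  then show "continuous_on S W4" unfolding W4_def Let_def by (intro continuous_intros continuous_on_cr)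
qed

lemma open_generic: "open generic"
proof -
  have eq: "generic = fst -` (- {0}) \<inter> W2 -` (- {0}) \<inter> W4 -` (- {0})" by (auto simp: generic_def)
  show ?thesis
    unfolding eq by (intro open_Int open_vimage continuous_on_W continuous_on_fst continuous_on_id open_Compl closed_singleton)
qed

lemma continuous_on_gs_matrix: "continuous_on generic gs_matrix"
proof -
  have "continuous_on generic gs1" "continuous_on generic gs2" "continuous_on generic gs4"
    unfolding gs1_def gs2_def gs4_def
    by (intro continuous_intros continuous_on_W; simp add: generic_def)+
  then show ?thesis
    unfolding gs_matrix_def by (intro continuous_intros continuous_on_vec7 continuous_on_cr)
qed

lemma emeasure_generic: "emeasure lborel generic \<noteq> 0"
proof
  assume "emeasure lborel generic = 0"
  then have "generic \<in> null_sets lebesgue"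
    using open_generic by (intro null_sets_completionI) auto
  then have "negligible generic" by (simp add: negligible_iff_null_sets)
  moreover have "(E1, E2, E4) \<in> generic"
  proof -
    have 2: "W2 (E1, E2, E4) = E2" by (simp add: W2_def inner_7)
    have "cr E1 E2 = E3" by (simp add: cr_def vec7_eq_iff)
    then have "W4 (E1, E2, E4) = E4" by (simp add: W4_def 2 inner_7)
    then show ?thesis using 2 by (simp add: generic_def vec7_eq_iff)
  qed
  ultimately show False using open_not_negligible[OF open_generic] by blast
qed

lemma continuous_on_Phi: "continuous_on S Phi"
proof -
  have "continuous_on S (\<lambda>a. Phi a *v v)" for v
  proof -
    have "(\<lambda>a. Phi a *v v) differentiable_on S"
      unfolding differentiable_on_def Phi_apply
      by (intro ballI differentiable_euler differentiable_m differentiable_nth differentiable_const differentiable_ident)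
    then show ?thesis by (rule differentiable_imp_continuous_on)
  qed
  then have "continuous_on S (\<lambda>a. (Phi a *v axis j 1) $ i)" for i j by (intro continuous_intros)
  then have "continuous_on S (\<lambda>a. Phi a $ i $ j)" for i j by (simp add: matrix_vector_mul_component inner_axis)
  then have "continuous_on S (\<lambda>a. \<chi> i j. Phi a $ i $ j)" by (intro continuous_on_vec_lambda)
  moreover have "(\<lambda>a. \<chi> i j. Phi a $ i $ j) = Phi" by (simp add: fun_eq_iff vec_eq_iff)
  ultimately show ?thesis by simp
qed

lemma continuous_on_conj_refl: "continuous_on S conj_refl"
  unfolding conj_refl_def by (intro continuous_on_matrix_mult continuous_on_transpose continuous_intros)

section \<open>Cosets as points of a matrix space\<close>

lemma quat_variety_cases:
  assumes "c \<in> quat_variety"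
  obtains h where "h \<in> carrier G2" "c = h <#\<^bsub>G2\<^esub> SO4"
  using assms by (auto simp: quat_variety_eq)

text \<open>By \<open>coset_eq_iff\<close> the value is independent of the representative and
  separates cosets. Measurability on the quotient can thus be checked through Borel sets of
  matrices.\<close>

definition coset_refl :: "(real^7^7) set \<Rightarrow> real^7^7" where
  "coset_refl c = conj_refl (SOME g. g \<in> carrier G2 \<and> c = g <#\<^bsub>G2\<^esub> SO4)"

lemma coset_refl: "g \<in> carrier G2 \<Longrightarrow> coset_refl (g <#\<^bsub>G2\<^esub> SO4) = conj_refl g"
proof -
  assume g: "g \<in> carrier G2"
  define h where "h = (SOME h. h \<in> carrier G2 \<and> g <#\<^bsub>G2\<^esub> SO4 = h <#\<^bsub>G2\<^esub> SO4)"
  have "h \<in> carrier G2 \<and> g <#\<^bsub>G2\<^esub> SO4 = h <#\<^bsub>G2\<^esub> SO4"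
    unfolding h_def by (rule someI[of _ g]) (use g in simp)
  then show ?thesis using coset_eq_iff(2)[OF g, of h] by (simp add: coset_refl_def h_def)
qed

text \<open>\<open>coset_refl\<close> is continuous for the quotient topology, since its composition
  with the projection from G2 is \<open>conj_refl\<close>.\<close>

lemma G2_invariant_measure_sets:
  assumes "G2_invariant_measure \<mu>"
  shows "space \<mu> = quat_variety" "coset_refl \<in> borel_measurable \<mu>"
proof -
  have sub: "{U. quat_variety_open U} \<subseteq> Pow quat_variety" by (auto simp: quat_variety_open_def)
  have s: "sets \<mu> = sets (sigma quat_variety {U. quat_variety_open U})"
    using assms by (simp add: G2_invariant_measure_def)
  then show space: "space \<mu> = quat_variety"
    using sets_eq_imp_space_eq[OF s] sub by (simp add: space_measure_of)
  show "coset_refl \<in> borel_measurable \<mu>"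
  proof (rule borel_measurableI)
    fix S :: "(real^7^7) set" assume S: "open S"
    have eq: "{g \<in> carrier G2. g <#\<^bsub>G2\<^esub> SO4 \<in> coset_refl -` S \<inter> space \<mu>} = carrier G2 \<inter> conj_refl -` S"
      by (auto simp: space quat_variety_eq coset_refl)
    have "openin (top_of_set (carrier G2)) (carrier G2 \<inter> conj_refl -` S)"
      using continuous_on_conj_refl S by (rule continuous_openin_preimage_gen)
    then have "quat_variety_open (coset_refl -` S \<inter> space \<mu>)"
      unfolding quat_variety_open_def eq by (simp add: space)
    then show "coset_refl -` S \<inter> space \<mu> \<in> sets \<mu>"
      by (simp add: s sub sets_measure_of sigma_sets.Basic)
  qed
qed

section \<open>The image of the boundary is null\<close>

lemma conj_refl_mult: "conj_refl (g ** h) = g ** conj_refl h ** transpose g"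
  by (simp add: conj_refl_def matrix_transpose_mul matrix_mul_assoc)

lemma conj_refl_in_image_iff:
  assumes "g \<in> carrier G2"
  shows "conj_refl g \<in> conj_refl ` Phi ` N \<longleftrightarrow> g <#\<^bsub>G2\<^esub> SO4 \<in> coord_map ` N"
  using coset_eq_iff(2)[OF assms Phi_G2] by (auto simp: coord_map_eq image_iff)

text \<open>If the coset of \<open>gs_matrix v ** h\<close> comes from a boundary point
  \<open>a\<close>, then \<open>gs_matrix v = Phi a ** k ** transpose h\<close> with
  \<open>k\<close> in \<open>SO4\<close>. Euler angles of \<open>k\<close> and expansion
  coefficients of \<open>v\<close> exhibit \<open>v\<close> as a value of
  \<open>triple (transpose h)\<close> over the boundary.\<close>

lemma generic_slice_negligible:
  assumes h: "h \<in> carrier G2"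
  shows "negligible {v \<in> generic. conj_refl (gs_matrix v ** h) \<in> conj_refl ` Phi ` (R' - R_open)}"
proof (rule negligible_subset[OF negligible_triple[of "transpose h"]], rule subsetI)
  fix v assume "v \<in> {v \<in> generic. conj_refl (gs_matrix v ** h) \<in> conj_refl ` Phi ` (R' - R_open)}"
  then obtain a where v: "v \<in> generic" and a: "a \<in> R' - R_open" and eq: "conj_refl (Phi a) = conj_refl (gs_matrix v ** h)"
    by force
  have g: "gs_matrix v \<in> carrier G2" using v by (rule gs_matrix_G2)
  have "gs_matrix v ** h \<in> carrier G2" using g h by (rule G2_mult)
  then have "transpose (Phi a) ** (gs_matrix v ** h) \<in> SO4"
    using coset_eq_iff[OF Phi_G2, of "gs_matrix v ** h" a] eq by blast
  then obtain x y z x' y' z' where k: "transpose (Phi a) ** (gs_matrix v ** h) = euler_\<sigma> x y z ** euler_s x' y' z'"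
    by (rule SO4_cases)
  have "gs_matrix v = Phi a ** (transpose (Phi a) ** (gs_matrix v ** h)) ** transpose h"
    using G2_orthogonal[OF h] G2_orthogonal[OF Phi_G2[of a]] by (simp add: matrix_mul_assoc) (simp flip: matrix_mul_assoc)
  then have gv: "gs_matrix v *v w = Phi a *v (euler_\<sigma> x y z *v (euler_s x' y' z' *v (transpose h *v w)))" for w
    unfolding k by (simp only: matrix_vector_mul_assoc matrix_mul_assoc)
  obtain b :: "real^6" where b: "b $ 1 = x" "b $ 2 = y" "b $ 3 = z" "b $ 4 = x'" "b $ 5 = y'" "b $ 6 = z'"
  proof -
    define b :: "real^6" where "b = (\<chi> i. if i = 1 then x else if i = 2 then y else if i = 3 then z
     else if i = 4 then x' else if i = 5 then y' else z')"
    show ?thesis by (rule that[of b]) (simp_all add: b_def)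
  qed
  obtain l :: "real^7" where l: "fst v = l $ 1 *\<^sub>R gs1 v" "fst (snd v) = l $ 2 *\<^sub>R gs1 v + l $ 3 *\<^sub>R gs2 v"
    "snd (snd v) = l $ 4 *\<^sub>R gs1 v + l $ 5 *\<^sub>R gs2 v + l $ 6 *\<^sub>R cr (gs1 v) (gs2 v) + l $ 7 *\<^sub>R gs4 v"
    using v by (rule generic_expansion)
  have fr: "frame (transpose h) (a, b, l) w = gs_matrix v *v w" for w
    unfolding gv by (simp only: frame_def Let_def fst_conv snd_conv b)
  have "cr E1 E2 = E3" by (simp add: cr_def vec7_eq_iff)
  then have "gs_matrix v *v E3 = cr (gs1 v) (gs2 v)"
    using G2_cr[OF g, of E1 E2] gs_matrix_G2[OF v] by simp
  then have "triple (transpose h) (a, b, l) = (fst v, fst (snd v), snd (snd v))"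
    unfolding triple_def Let_def fr fst_conv snd_conv l gs_matrix_G2[OF v] by simp
  then have "v = triple (transpose h) (a, b, l)" by simp
  then show "v \<in> triple (transpose h) ` ((R' - R_open) \<times> UNIV)" using a by blast
qed

text \<open>Fubini for the set \<open>Q\<close> of pairs \<open>(v, c)\<close> with \<open>v\<close>
  generic and the translate of \<open>c\<close> by \<open>gs_matrix v\<close> in \<open>B\<close>.
  At fixed generic \<open>v\<close> the slice has measure \<open>emeasure \<mu> B\<close> by
  invariance; at fixed \<open>c\<close> it is null. As \<open>generic\<close> has positive measure,
  \<open>B\<close> is null.\<close>

theorem boundary_null:
  assumes \<mu>: "G2_invariant_measure \<mu>"
  shows "coord_map ` (R' - R_open) \<in> null_sets \<mu>"
proof -
  define B where "B = coord_map ` (R' - R_open)"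
  define P where "P = conj_refl ` Phi ` (R' - R_open)"
  note space = G2_invariant_measure_sets(1)[OF \<mu>] and meas = G2_invariant_measure_sets(2)[OF \<mu>]
  interpret fin: finite_measure \<mu> using \<mu> by (simp add: G2_invariant_measure_def)
  interpret pair: pair_sigma_finite "lborel :: ((real^7) \<times> (real^7) \<times> (real^7)) measure" \<mu> ..
  have cP: "closed P"
    unfolding P_def by (intro compact_imp_closed compact_continuous_image continuous_on_conj_refl continuous_on_Phi compact_boundary)
  \<comment> \<open>Conjugating \<open>coset_refl c\<close> by \<open>gs_matrix v\<close> gives
    \<open>coset_refl\<close> of the translated coset; in this form \<open>Q\<close> is the preimage
    of a Borel set under a measurable map.\<close>
  define Q where "Q = {p \<in> space (lborel \<Otimes>\<^sub>M \<mu>). fst p \<in> generic \<and>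
     gs_matrix (fst p) ** coset_refl (snd p) ** transpose (gs_matrix (fst p)) \<in> P}"
  have Q_sets: "Q \<in> sets (lborel \<Otimes>\<^sub>M \<mu>)"
  proof -
    define C :: "(((real^7) \<times> (real^7) \<times> (real^7)) \<times> (real^7^7)) set" where
      "C = {p \<in> generic \<times> UNIV. gs_matrix (fst p) ** snd p ** transpose (gs_matrix (fst p)) \<in> P}"
    have o: "open (generic \<times> (UNIV :: (real^7^7) set))" by (intro open_Times open_generic open_UNIV)
    have cont: "continuous_on (generic \<times> (UNIV :: (real^7^7) set)) (\<lambda>p. gs_matrix (fst p) ** snd p ** transpose (gs_matrix (fst p)))"
      by (intro continuous_on_matrix_mult continuous_on_transpose continuous_on_compose2[OF continuous_on_gs_matrix] continuous_intros) auto
    have "open (generic \<times> UNIV - C)"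
    proof -
      have "generic \<times> UNIV - C = (generic \<times> UNIV) \<inter> (\<lambda>p. gs_matrix (fst p) ** snd p ** transpose (gs_matrix (fst p))) -` (- P)"
        by (auto simp: C_def)
      moreover have "open (- P)" using cP by (simp add: open_Compl)
      ultimately show ?thesis using continuous_open_preimage[OF cont o] by simp
    qed
    moreover have "C = generic \<times> UNIV - (generic \<times> UNIV - C)" by (auto simp: C_def)
    ultimately have "C \<in> sets borel" using o by (metis borel_open sets.Diff)
    moreover have "(\<lambda>p. (fst p, coset_refl (snd p))) \<in> lborel \<Otimes>\<^sub>M \<mu> \<rightarrow>\<^sub>M borel \<Otimes>\<^sub>M borel"
      using meas by measurable
    then have "(\<lambda>p. (fst p, coset_refl (snd p))) \<in> lborel \<Otimes>\<^sub>M \<mu> \<rightarrow>\<^sub>M borel"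
      by (simp only: borel_prod)
    ultimately have "(\<lambda>p. (fst p, coset_refl (snd p))) -` C \<inter> space (lborel \<Otimes>\<^sub>M \<mu>) \<in> sets (lborel \<Otimes>\<^sub>M \<mu>)"
      by (rule measurable_sets[rotated])
    moreover have "(\<lambda>p. (fst p, coset_refl (snd p))) -` C \<inter> space (lborel \<Otimes>\<^sub>M \<mu>) = Q"
      by (auto simp: Q_def C_def)
    ultimately show ?thesis by simp
  qed
  have BP: "coset_refl (g <#\<^bsub>G2\<^esub> SO4) \<in> P \<longleftrightarrow> g <#\<^bsub>G2\<^esub> SO4 \<in> B" if "g \<in> carrier G2" for g
    using that by (simp add: coset_refl P_def B_def conj_refl_in_image_iff)
  have Bsub: "B \<subseteq> quat_variety" using Phi_G2 by (auto simp: B_def coord_map_eq quat_variety_eq)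
  have "B = coset_refl -` P \<inter> space \<mu>"
    using BP Bsub by (auto simp: space quat_variety_eq)
  then have B_sets: "B \<in> sets \<mu>" using measurable_sets[OF meas, of P] cP by simp
  have slice1: "emeasure \<mu> (Pair v -` Q) = emeasure \<mu> B * indicator generic v" for v
  proof (cases "v \<in> generic")
    case True
    define g where "g = gs_matrix v"
    have g: "g \<in> carrier G2" using True by (simp add: g_def gs_matrix_G2)
    define A where "A = Pair v -` Q"
    have A_sets: "A \<in> sets \<mu>" unfolding A_def using Q_sets by (rule sets_Pair1)
    have A: "A = {c \<in> quat_variety. g <#\<^bsub>G2\<^esub> c \<in> B}"
    proof -
      have "g ** coset_refl c ** transpose g \<in> P \<longleftrightarrow> g <#\<^bsub>G2\<^esub> c \<in> B" if c: "c \<in> quat_variety" for c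
      proof -
        obtain h where h: "h \<in> carrier G2" "c = h <#\<^bsub>G2\<^esub> SO4" using c by (rule quat_variety_cases)
        have gh: "g ** h \<in> carrier G2" using g h by blast
        show ?thesis using BP[OF gh] by (simp add: h coset_refl gh coset_translate flip: conj_refl_mult)
      qed
      then show ?thesis using True by (auto simp: A_def Q_def space space_pair_measure g_def)
    qed
    \<comment> \<open>Invariance is stated for forward images, so \<open>A\<close> must be mapped
      onto \<open>B\<close>; the inverse translation supplies the preimages.\<close>
    have "(\<lambda>c. g <#\<^bsub>G2\<^esub> c) ` A = B"
    proof
      show "(\<lambda>c. g <#\<^bsub>G2\<^esub> c) ` A \<subseteq> B" by (auto simp: A)
      show "B \<subseteq> (\<lambda>c. g <#\<^bsub>G2\<^esub> c) ` A"
      proof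
        fix c assume c: "c \<in> B"
        then have "c \<in> quat_variety" using Bsub by blast
        then obtain h where h: "h \<in> carrier G2" "c = h <#\<^bsub>G2\<^esub> SO4" by (rule quat_variety_cases)
        define c' where "c' = (transpose g ** h) <#\<^bsub>G2\<^esub> SO4"
        have "g <#\<^bsub>G2\<^esub> c' = c"
          using G2_orthogonal[OF g] by (simp add: c'_def coset_translate h matrix_mul_assoc)
        moreover have "c' \<in> quat_variety" using g h by (auto simp: c'_def quat_variety_eq)
        ultimately show "c \<in> (\<lambda>c. g <#\<^bsub>G2\<^esub> c) ` A" using c by (auto simp: A)
      qed
    qed
    then have "emeasure \<mu> A = emeasure \<mu> B"
      using \<mu> g A_sets unfolding G2_invariant_measure_def by metis
    then show ?thesis using True by (simp add: A_def)
  next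
    case False
    then show ?thesis by (simp add: Q_def vimage_def)
  qed
  have slice2: "emeasure lborel ((\<lambda>v. (v, c)) -` Q) = 0" if c: "c \<in> space \<mu>" for c
  proof -
    obtain h where h: "h \<in> carrier G2" "c = h <#\<^bsub>G2\<^esub> SO4" using c unfolding space by (rule quat_variety_cases)
    have "(\<lambda>v. (v, c)) -` Q = {v \<in> generic. conj_refl (gs_matrix v ** h) \<in> conj_refl ` Phi ` (R' - R_open)}"
      using c h by (auto simp: Q_def space_pair_measure coset_refl conj_refl_mult P_def)
    then have "negligible ((\<lambda>v. (v, c)) -` Q)" using generic_slice_negligible[OF h(1)] by simp
    then have "(\<lambda>v. (v, c)) -` Q \<in> null_sets lebesgue" by (simp add: negligible_iff_null_sets)
    moreover have "(\<lambda>v. (v, c)) -` Q \<in> sets lborel" using Q_sets by (rule sets_Pair2)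
    ultimately have "(\<lambda>v. (v, c)) -` Q \<in> null_sets lborel" by (simp add: null_sets_completion_iff)
    then show ?thesis by auto
  qed
  have gen: "generic \<in> sets lborel" using open_generic by simp
  have "emeasure \<mu> B * emeasure lborel generic = (\<integral>\<^sup>+v. emeasure \<mu> B * indicator generic v \<partial>lborel)"
    using gen by (simp add: nn_integral_cmult)
  also have "\<dots> = emeasure (lborel \<Otimes>\<^sub>M \<mu>) Q"
    by (simp add: fin.emeasure_pair_measure_alt[OF Q_sets] slice1)
  also have "\<dots> = (\<integral>\<^sup>+c. emeasure lborel ((\<lambda>v. (v, c)) -` Q) \<partial>\<mu>)"
    by (rule pair.emeasure_pair_measure_alt2[OF Q_sets])
  also have "\<dots> = (\<integral>\<^sup>+c. 0 \<partial>\<mu>)" by (rule nn_integral_cong) (rule slice2)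
  finally have "emeasure \<mu> B = 0" using emeasure_generic by simp
  then show ?thesis using B_sets by (auto simp: B_def)
qed

theorem mainTheorem3:
  shows "coord_map ` R' \<subseteq> quat_variety \<and>
    (\<exists>N' \<subseteq> R'. N' \<in> null_sets lebesgue \<and>
       inj_on coord_map (R' - N') \<and>
       (\<forall>\<mu>. G2_invariant_measure \<mu> \<longrightarrow> (AE c in \<mu>. c \<in> coord_map ` (R' - N'))))"
proof (intro conjI exI[of _ "R' - R_open"])
  show "coord_map ` R' \<subseteq> quat_variety" using Phi_G2 by (auto simp: coord_map_eq quat_variety_eq)
  show "R' - R_open \<subseteq> R'" by blast
  show "R' - R_open \<in> null_sets lebesgue" using negligible_boundary by (simp add: negligible_iff_null_sets)
  show "inj_on coord_map (R' - (R' - R_open))" by (rule inj_on_subset[OF coord_map_inj]) blast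
  show "\<forall>\<mu>. G2_invariant_measure \<mu> \<longrightarrow> (AE c in \<mu>. c \<in> coord_map ` (R' - (R' - R_open)))"
  proof (intro allI impI)
    fix \<mu> :: "(real^7^7) set measure" assume \<mu>: "G2_invariant_measure \<mu>"
    show "AE c in \<mu>. c \<in> coord_map ` (R' - (R' - R_open))"
    \<comment> \<open>By surjectivity on all of \<open>R'\<close>, a coset missed by the interior is
      attained on the boundary, whose image is null.\<close>
    proof (rule AE_I'[OF boundary_null[OF \<mu>]], rule subsetI)
      fix c assume c: "c \<in> {c \<in> space \<mu>. c \<notin> coord_map ` (R' - (R' - R_open))}"
      then obtain g where "g \<in> carrier G2" "c = g <#\<^bsub>G2\<^esub> SO4"
        using G2_invariant_measure_sets(1)[OF \<mu>] by (auto simp: quat_variety_eq)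
      then obtain a where "a \<in> R'" "coord_map a = c" using coord_map_surj by metis
      then show "c \<in> coord_map ` (R' - R_open)" using c by blast
    qed
  qed
qed

end
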